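(* Let $\alpha_\star:=\log_2(1+\sqrt3)$ and $\beta_\star:=\frac{2\alpha_\star}{1+\alpha_\star}$. There exists a universal constant $C_\star>0$ such that every positive infinite step-size schedule $\boldsymbol\eta=(\eta_1,\eta_2,\dots)\in(0,\infty)^{\mathbb N}$ satisfies $$\limsup_{n\to\infty} n^{\beta_\star}\,\mathcal R_n(\boldsymbol\eta_{1:n})\ge C_\star .$$ In particular, no positive infinite schedule satisfies $\mathcal R_n(\boldsymbol\eta_{1:n})=o(n^{-\beta_\star})$ as $n\to\infty$.
   Context: $\boldsymbol\eta_{1:n}:=(\eta_1,\dots,\eta_n)$. For $d\ge1$, $\mathscr F_1(\mathbb R^d)$ is the class of convex differentiable functions $f:\mathbb R^d\to\mathbb R$ with $1$-Lipschitz gradient (Euclidean norm) whose set of minimizers $X_f^\star:=\arg\min f$ satisfies $\emptyset\ne X_f^\star\subsetneq\mathbb R^d$. Given an initial point $\boldsymbol x_0$ and step-sizes $\eta_t>0$, gradient descent is $\boldsymbol x_t=\boldsymbol x_{t-1}-\eta_t\nabla f(\boldsymbol x_{t-1})$. The worst-case convergence rate of a finite schedule $(\eta_1,\dots,\eta_n)\in(0,\infty)^n$ is $$\mathcal R_n(\eta_1,\dots,\eta_n):=\sup\frac{f(\boldsymbol x_n)-f(\boldsymbol x^\star)}{\|\boldsymbol x_0-\boldsymbol x^\star\|^2},$$ where the supremum is over all $d\ge1$, $f\in\mathscr F_1(\mathbb R^d)$, $\boldsymbol x^\star\in X_f^\star$, $\boldsymbol x_0\in\mathbb R^d\setminus X_f^\star$,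 and $\boldsymbol x_n$ is the $n$-th gradient descent iterate started at $\boldsymbol x_0$ with this schedule. *)

theory Defs
  imports "HOL-Analysis.Analysis" "HOL-Library.Landau_Symbols"
begin

section \<open>All Euclidean spaces inside one inner product space\<close>

text \<open>
  The supremum defining the worst-case rate runs over all dimensions, so the dimension cannot be a
  type parameter. Instead, \<open>rvec\<close> is the space of finitely supported real sequences with
  the \<open>\<ell>\<^sup>2\<close> inner product, and the \<open>d\<close>-dimensional Euclidean space is the
  subspace \<open>\<R> d\<close> of sequences supported in \<open>{..<d}\<close>. Convexity,
  derivatives and Lipschitz continuity are always taken relative to \<open>\<R> d\<close>, so the
  values of an objective function outside \<open>\<R> d\<close> are irrelevant.
\<close>

typedef rvec = "{x :: nat \<Rightarrow> real. finite {i. x i \<noteq> 0}}"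
  morphisms coord Abs_rvec
  by (rule exI[of _ "\<lambda>_. 0"]) simp

setup_lifting type_definition_rvec

lemma finite_coord: "finite {i. coord x i \<noteq> 0}"
  using coord[of x] by simp

lemma rvec_eqI: "(\<And>i. coord x i = coord y i) \<Longrightarrow> x = y"
  by (metis coord_inject ext)

instantiation rvec :: real_vector
begin

lift_definition zero_rvec :: rvec is "\<lambda>_. 0" by simp

lift_definition plus_rvec :: "rvec \<Rightarrow> rvec \<Rightarrow> rvec" is "\<lambda>x y i. x i + y i"
  subgoal for x y by (rule finite_subset[of _ "{i. x i \<noteq> 0} \<union> {i. y i \<noteq> 0}"]) auto
  done

lift_definition minus_rvec :: "rvec \<Rightarrow> rvec \<Rightarrow> rvec" is "\<lambda>x y i. x i - y i"
  subgoal for x y by (rule finite_subset[of _ "{i. x i \<noteq> 0} \<union> {i. y i \<noteq> 0}"]) auto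
  done

lift_definition uminus_rvec :: "rvec \<Rightarrow> rvec" is "\<lambda>x i. - x i" by simp

lift_definition scaleR_rvec :: "real \<Rightarrow> rvec \<Rightarrow> rvec" is "\<lambda>c x i. c * x i"
  subgoal for c x by (rule finite_subset[of _ "{i. x i \<noteq> 0}"]) auto
  done

instance
  by standard (transfer, simp add: algebra_simps fun_eq_iff)+

end

lemma coord_simps [simp]:
  "coord 0 i = 0"
  "coord (x + y) i = coord x i + coord y i"
  "coord (x - y) i = coord x i - coord y i"
  "coord (- x) i = - coord x i"
  "coord (c *\<^sub>R x) i = c * coord x i"
  by (transfer, simp)+

instantiation rvec :: real_inner
begin

definition inner_rvec :: "rvec \<Rightarrow> rvec \<Rightarrow> real"
  where "inner_rvec x y = (\<Sum>i | coord x i \<noteq> 0. coord x i * coord y i)"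

definition norm_rvec :: "rvec \<Rightarrow> real"
  where "norm_rvec x = sqrt (inner x x)"

definition sgn_rvec :: "rvec \<Rightarrow> rvec"
  where "sgn_rvec x = x /\<^sub>R norm x"

definition dist_rvec :: "rvec \<Rightarrow> rvec \<Rightarrow> real"
  where "dist_rvec x y = norm (x - y)"

definition uniformity_rvec :: "(rvec \<times> rvec) filter"
  where "uniformity_rvec = (INF e\<in>{0 <..}. principal {(x, y). dist x y < e})"

definition open_rvec :: "rvec set \<Rightarrow> bool"
  where "open_rvec S \<longleftrightarrow> (\<forall>x\<in>S. \<forall>\<^sub>F (x', y) in uniformity. x' = x \<longrightarrow> y \<in> S)"

lemma inner_rvec_superset:
  assumes "finite A" "\<And>i. i \<notin> A \<Longrightarrow> coord x i = 0"
  shows "inner x y = (\<Sum>i\<in>A. coord x i * coord y i)"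
  unfolding inner_rvec_def using assms by (intro sum.mono_neutral_left) auto

instance
proof
  fix x y z :: rvec and r :: real
  let ?A = "{i. coord x i \<noteq> 0} \<union> {i. coord y i \<noteq> 0}"
  have fA: "finite ?A" by (simp add: finite_coord)
  show "inner x y = inner y x"
    by (subst (1 2) inner_rvec_superset[OF fA]) (auto simp: mult.commute)
  show "inner (x + y) z = inner x z + inner y z"
    by (subst (1 2 3) inner_rvec_superset[OF fA]) (auto simp: algebra_simps sum.distrib)
  show "inner (r *\<^sub>R x) y = r * inner x y"
    by (subst (1 2) inner_rvec_superset[OF fA]) (auto simp: algebra_simps sum_distrib_left)
  show "0 \<le> inner x x"
    unfolding inner_rvec_def by (intro sum_nonneg) auto
  show "inner x x = 0 \<longleftrightarrow> x = 0"
  proof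
    assume "inner x x = 0"
    then have "\<forall>i\<in>{i. coord x i \<noteq> 0}. coord x i * coord x i = 0"
      unfolding inner_rvec_def by (subst (asm) sum_nonneg_eq_0_iff) (auto simp: finite_coord)
    then show "x = 0" by (intro rvec_eqI) auto
  qed (simp add: inner_rvec_def)
qed (rule dist_rvec_def sgn_rvec_def uniformity_rvec_def open_rvec_def norm_rvec_def)+

end

definition Rd :: "nat \<Rightarrow> rvec set"  ("\<R>")
  where "\<R> d = {x. \<forall>i\<ge>d. coord x i = 0}"

lemma inner_Rd: "x \<in> \<R> d \<Longrightarrow> inner x y = (\<Sum>i<d. coord x i * coord y i)"
  by (rule inner_rvec_superset) (auto simp: Rd_def)

lemma norm_Rd: "x \<in> \<R> d \<Longrightarrow> norm x = L2_set (coord x) {..<d}"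
  by (simp add: norm_rvec_def inner_Rd L2_set_def power2_eq_square)

lemma subspace_Rd: "subspace (\<R> d)"
  by (auto simp: subspace_def Rd_def)

lemma coord_Rd_surj:
  assumes "\<forall>i\<ge>d. a i = 0"
  obtains x where "x \<in> \<R> d" "coord x = a"
proof
  have "{i. a i \<noteq> 0} \<subseteq> {..<d}"
    using assms by (auto intro: leI)
  then have "finite {i. a i \<noteq> 0}"
    by (rule finite_subset) simp
  then show "coord (Abs_rvec a) = a" by (simp add: Abs_rvec_inverse)
  then show "Abs_rvec a \<in> \<R> d" using assms by (simp add: Rd_def)
qed

section \<open>Gradient descent and its worst-case rate\<close>

text \<open>Outside \<open>\<R> d\<close> a gradient would not be unique, hence the constraint
  \<open>g \<in> \<R> d\<close>; see \<open>gradient_eqI\<close> and \<open>gradient_works\<close>.\<close>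

definition gradient :: "nat \<Rightarrow> (rvec \<Rightarrow> real) \<Rightarrow> rvec \<Rightarrow> rvec"
  where "gradient d f x =
    (THE g. g \<in> \<R> d \<and> (f has_derivative (\<lambda>h. inner g h)) (at x within \<R> d))"

lemma has_derivative_Rd_line:
  assumes "(f has_derivative D) (at x within \<R> d)" "x \<in> \<R> d" "v \<in> \<R> d"
  shows "((\<lambda>t. f (x + t *\<^sub>R v)) has_real_derivative D v) (at 0)"
proof -
  interpret D: bounded_linear D using assms(1) by (rule has_derivative_bounded_linear)
  have "((\<lambda>t. x + t *\<^sub>R v) has_derivative (\<lambda>t. t *\<^sub>R v)) (at (0::real))"
    by (auto intro!: derivative_eq_intros)
  moreover have "(f has_derivative D) (at (x + 0 *\<^sub>R v) within range (\<lambda>t. x + t *\<^sub>R v))"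
    using assms by (auto intro!: has_derivative_subset[OF assms(1)] simp: Rd_def)
  ultimately have "(f \<circ> (\<lambda>t. x + t *\<^sub>R v) has_derivative D \<circ> (\<lambda>t. t *\<^sub>R v)) (at 0)"
    by (rule diff_chain_within)
  then show ?thesis
    by (simp add: has_field_derivative_def o_def D.scaleR mult.commute[of _ "D v"])
qed

lemma gradient_unique:
  assumes "x \<in> \<R> d" "g \<in> \<R> d" "g' \<in> \<R> d"
    and "(f has_derivative (\<lambda>h. inner g h)) (at x within \<R> d)"
    and "(f has_derivative (\<lambda>h. inner g' h)) (at x within \<R> d)"
  shows "g = g'"
proof -
  have v: "g - g' \<in> \<R> d" using assms by (auto simp: Rd_def)
  have "inner g (g - g') = inner g' (g - g')"
    using has_derivative_Rd_line[OF assms(4) assms(1) v] has_derivative_Rd_line[OF assms(5) assms(1) v]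
    by (rule DERIV_unique)
  then have "inner (g - g') (g - g') = 0" by (simp add: inner_diff_left)
  then show ?thesis by simp
qed

lemma gradient_eqI:
  assumes "x \<in> \<R> d" "g \<in> \<R> d" "(f has_derivative (\<lambda>h. inner g h)) (at x within \<R> d)"
  shows "gradient d f x = g"
  unfolding gradient_def using assms gradient_unique[of x d] by blast

lemma gradient_exists:
  assumes x: "x \<in> \<R> d" and D: "(f has_derivative D) (at x within \<R> d)"
  shows "\<exists>g\<in>\<R> d. (f has_derivative (\<lambda>h. inner g h)) (at x within \<R> d)"
proof -
  interpret D: bounded_linear D using D by (rule has_derivative_bounded_linear)
  define e where "e = (\<lambda>i::nat. Abs_rvec (\<lambda>j. if j = i then 1 else 0))"
  have e: "coord (e i) j = (if j = i then 1 else 0)" for i j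
    by (simp add: e_def Abs_rvec_inverse)
  obtain g where g: "g \<in> \<R> d" "coord g = (\<lambda>i. if i < d then D (e i) else 0)"
    by (rule coord_Rd_surj[of d "\<lambda>i. if i < d then D (e i) else 0"]) auto
  have eq: "D h = inner g h" if h: "h \<in> \<R> d" for h
  proof -
    have cs: "coord (\<Sum>i\<in>A. u i) j = (\<Sum>i\<in>A. coord (u i) j)" for u j and A :: "nat set"
      by (induction A rule: infinite_finite_induct) auto
    have "h = (\<Sum>i<d. coord h i *\<^sub>R e i)"
      using h by (intro rvec_eqI) (auto simp: cs e Rd_def if_distrib cong: if_cong)
    then have "D h = D (\<Sum>i<d. coord h i *\<^sub>R e i)" by simp
    also have "\<dots> = (\<Sum>i<d. coord g i * coord h i)"
      by (simp add: D.sum D.scaleR g mult.commute)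
    finally show ?thesis by (simp add: inner_Rd[OF g(1)])
  qed
  have "(f has_derivative (\<lambda>h. inner g h)) (at x within \<R> d)"
    unfolding has_derivative_within
  proof
    show "bounded_linear (inner g)" by (rule bounded_linear_inner_right)
    have "((\<lambda>y. (1 / norm (y - x)) *\<^sub>R (f y - (f x + D (y - x)))) \<longlongrightarrow> 0) (at x within \<R> d)"
      using D unfolding has_derivative_within by blast
    then show "((\<lambda>y. (1 / norm (y - x)) *\<^sub>R (f y - (f x + inner g (y - x)))) \<longlongrightarrow> 0) (at x within \<R> d)"
    proof (rule Lim_transform_eventually)
      have "D (y - x) = inner g (y - x)" if "y \<in> \<R> d" for y
        using that x by (intro eq) (auto simp: Rd_def)
      then show "\<forall>\<^sub>F y in at x within \<R> d. (1 / norm (y - x)) *\<^sub>R (f y - (f x + D (y - x)))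
          = (1 / norm (y - x)) *\<^sub>R (f y - (f x + inner g (y - x)))"
        by (auto simp: eventually_at_filter)
    qed
  qed
  with g show ?thesis by blast
qed

lemma gradient_works:
  assumes "f differentiable_on \<R> d" "x \<in> \<R> d"
  shows "gradient d f x \<in> \<R> d"
    and "(f has_derivative (\<lambda>h. inner (gradient d f x) h)) (at x within \<R> d)"
proof -
  obtain D where "(f has_derivative D) (at x within \<R> d)"
    using assms by (auto simp: differentiable_on_def differentiable_def)
  then obtain g where "g \<in> \<R> d" "(f has_derivative (\<lambda>h. inner g h)) (at x within \<R> d)"
    using gradient_exists assms(2) by blast
  then show "gradient d f x \<in> \<R> d"
    "(f has_derivative (\<lambda>h. inner (gradient d f x) h)) (at x within \<R> d)"
    using gradient_eqI[OF assms(2)] by auto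
qed

definition minimizers :: "nat \<Rightarrow> (rvec \<Rightarrow> real) \<Rightarrow> rvec set"
  where "minimizers d f = {x. is_arg_min f (\<lambda>x. x \<in> \<R> d) x}"

definition smooth_convex :: "nat \<Rightarrow> (rvec \<Rightarrow> real) set"  ("\<F>\<^sub>1")
  where "\<F>\<^sub>1 d = {f. convex_on (\<R> d) f \<and> f differentiable_on \<R> d
    \<and> 1-lipschitz_on (\<R> d) (gradient d f)
    \<and> minimizers d f \<noteq> {} \<and> minimizers d f \<subset> \<R> d}"

text \<open>Schedules are indexed from \<open>1\<close>; the entry \<open>\<eta> 0\<close> is never used.\<close>

fun gd :: "nat \<Rightarrow> (rvec \<Rightarrow> real) \<Rightarrow> (nat \<Rightarrow> real) \<Rightarrow> rvec \<Rightarrow> nat \<Rightarrow> rvec"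
  where
    "gd d f \<eta> x0 0 = x0"
  | "gd d f \<eta> x0 (Suc t) = gd d f \<eta> x0 t - \<eta> (Suc t) *\<^sub>R gradient d f (gd d f \<eta> x0 t)"

text \<open>The supremum is taken in \<^typ>\<open>ereal\<close>, so that it needs no boundedness side condition;
  it is finite by \<open>worst_rate_finite\<close> below. Only \<open>\<eta> 1, \<dots>, \<eta> n\<close> enter.\<close>

definition worst_rate :: "nat \<Rightarrow> (nat \<Rightarrow> real) \<Rightarrow> ereal"
  where "worst_rate n \<eta> = Sup {ereal ((f (gd d f \<eta> x0 n) - f xs) / (norm (x0 - xs))\<^sup>2) | d f xs x0.
    d \<ge> 1 \<and> f \<in> \<F>\<^sub>1 d \<and> xs \<in> minimizers d f \<and> x0 \<in> \<R> d - minimizers d f}"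

lemma minimizersD:
  assumes "xs \<in> minimizers d f"
  shows "xs \<in> \<R> d" "y \<in> \<R> d \<Longrightarrow> f xs \<le> f y"
  using assms by (auto simp: minimizers_def is_arg_min_def not_less)

lemma gradient_minimizer:
  assumes "f \<in> \<F>\<^sub>1 d" "xs \<in> minimizers d f"
  shows "gradient d f xs = 0"
proof -
  let ?g = "gradient d f xs"
  have xs: "xs \<in> \<R> d" using minimizersD(1)[OF assms(2)] .
  have df: "f differentiable_on \<R> d" using assms(1) by (simp add: smooth_convex_def)
  note g = gradient_works[OF df xs]
  have "f (xs + 0 *\<^sub>R ?g) \<le> f (xs + t *\<^sub>R ?g)" for t
    using minimizersD(2)[OF assms(2), of "xs + t *\<^sub>R ?g"] xs g(1) by (auto simp: Rd_def)
  then have "inner ?g ?g = 0"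
    by (intro DERIV_local_min[OF has_derivative_Rd_line[OF g(2) xs g(1)], of 1]) auto
  then show ?thesis by simp
qed

lemma convex_gradient_ineq:
  assumes f: "f \<in> \<F>\<^sub>1 d" and x: "x \<in> \<R> d" and y: "y \<in> \<R> d"
  shows "f x + inner (gradient d f x) (y - x) \<le> f y"
proof -
  have df: "f differentiable_on \<R> d" and cf: "convex_on (\<R> d) f"
    using f by (auto simp: smooth_convex_def)
  have v: "y - x \<in> \<R> d" using x y by (auto simp: Rd_def)
  let ?\<phi> = "\<lambda>t. f (x + t *\<^sub>R (y - x))"
  have "(?\<phi> has_real_derivative inner (gradient d f x) (y - x)) (at 0)"
    by (rule has_derivative_Rd_line[OF gradient_works(2)[OF df x] x v])
  then have "((\<lambda>t. (?\<phi> t - ?\<phi> 0) / t) \<longlongrightarrow> inner (gradient d f x) (y - x)) (at 0)"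
    by (simp add: has_field_derivative_iff)
  then have lim: "((\<lambda>t. (?\<phi> t - ?\<phi> 0) / t) \<longlongrightarrow> inner (gradient d f x) (y - x)) (at_right 0)"
    by (rule filterlim_mono) (auto simp: at_le)
  have "inner (gradient d f x) (y - x) \<le> f y - f x"
  proof (rule tendsto_upperbound[OF lim])
    have "(?\<phi> t - ?\<phi> 0) / t \<le> f y - f x" if t: "0 < t" "t < 1" for t
    proof -
      have "x + t *\<^sub>R (y - x) = (1 - t) *\<^sub>R x + t *\<^sub>R y"
        by (simp add: algebra_simps)
      then have "?\<phi> t \<le> (1 - t) * f x + t * f y"
        using cf x y t by (auto simp: convex_on_def)
      then show ?thesis using t by (simp add: field_simps)
    qed
    then show "\<forall>\<^sub>F t in at_right 0. (?\<phi> t - ?\<phi> 0) / t \<le> f y - f x"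
      unfolding eventually_at_right_field by (intro exI[of _ 1]) auto
  qed simp
  then show ?thesis by simp
qed

lemma gd_Rd:
  assumes "f \<in> \<F>\<^sub>1 d" "x0 \<in> \<R> d"
  shows "gd d f \<eta> x0 n \<in> \<R> d"
proof (induction n)
  case (Suc n)
  have df: "f differentiable_on \<R> d" using assms(1) by (simp add: smooth_convex_def)
  show ?case using Suc gradient_works(1)[OF df Suc] by (auto simp: Rd_def)
qed (use assms in auto)

lemma norm_gradient_le:
  assumes "f \<in> \<F>\<^sub>1 d" "xs \<in> minimizers d f" "x \<in> \<R> d"
  shows "norm (gradient d f x) \<le> norm (x - xs)"
proof -
  have "1-lipschitz_on (\<R> d) (gradient d f)" using assms(1) by (simp add: smooth_convex_def)
  from lipschitz_onD[OF this assms(3) minimizersD(1)[OF assms(2)]] show ?thesis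
    by (simp add: gradient_minimizer[OF assms(1,2)] dist_norm)
qed

lemma gd_norm_bound:
  assumes "f \<in> \<F>\<^sub>1 d" "xs \<in> minimizers d f" "x0 \<in> \<R> d"
  shows "norm (gd d f \<eta> x0 n - xs) \<le> (\<Prod>t=1..n. 1 + \<bar>\<eta> t\<bar>) * norm (x0 - xs)"
proof (induction n)
  case (Suc n)
  let ?x = "gd d f \<eta> x0 n" and ?h = "\<bar>\<eta> (Suc n)\<bar>"
  have "norm (gd d f \<eta> x0 (Suc n) - xs) = norm ((?x - xs) - \<eta> (Suc n) *\<^sub>R gradient d f ?x)"
    by (simp add: algebra_simps)
  also have "\<dots> \<le> norm (?x - xs) + ?h * norm (gradient d f ?x)"
    by (metis norm_triangle_ineq4 norm_scaleR)
  also have "\<dots> \<le> norm (?x - xs) + ?h * norm (?x - xs)"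
    using norm_gradient_le[OF assms(1,2) gd_Rd[OF assms(1,3)]]
    by (intro add_left_mono mult_left_mono) auto
  also have "\<dots> = (1 + ?h) * norm (?x - xs)" by (simp add: algebra_simps)
  also have "\<dots> \<le> (1 + ?h) * ((\<Prod>t=1..n. 1 + \<bar>\<eta> t\<bar>) * norm (x0 - xs))"
    using Suc by (intro mult_left_mono) auto
  finally show ?case by (simp add: mult_ac)
qed simp

lemma rate_quotient_bound:
  assumes "f \<in> \<F>\<^sub>1 d" "xs \<in> minimizers d f" "x0 \<in> \<R> d - minimizers d f"
  shows "(f (gd d f \<eta> x0 n) - f xs) / (norm (x0 - xs))\<^sup>2 \<le> (\<Prod>t=1..n. 1 + \<bar>\<eta> t\<bar>)\<^sup>2"
proof -
  let ?x = "gd d f \<eta> x0 n" and ?P = "\<Prod>t=1..n. 1 + \<bar>\<eta> t\<bar>"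
  have x: "?x \<in> \<R> d" using assms gd_Rd by auto
  have ne: "norm (x0 - xs) > 0" using assms by auto
  have "f ?x - f xs \<le> - inner (gradient d f ?x) (xs - ?x)"
    using convex_gradient_ineq[OF assms(1) x minimizersD(1)[OF assms(2)]] by simp
  also have "\<dots> \<le> norm (gradient d f ?x) * norm (xs - ?x)"
    using Cauchy_Schwarz_ineq2[of "gradient d f ?x" "xs - ?x"] by linarith
  also have "\<dots> \<le> norm (?x - xs) * norm (?x - xs)"
    using norm_gradient_le[OF assms(1,2) x] by (simp add: norm_minus_commute mult_right_mono)
  also have "\<dots> \<le> (?P * norm (x0 - xs)) * (?P * norm (x0 - xs))"
    using gd_norm_bound[OF assms(1,2), of x0 \<eta> n] assms(3) by (intro mult_mono') auto
  finally show ?thesis using ne by (simp add: divide_le_eq power2_eq_square mult_ac)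
qed

lemma half_norm_square_smooth_convex:
  assumes "d \<ge> 1"
  shows "(\<lambda>x. inner x x / 2) \<in> \<F>\<^sub>1 d" "minimizers d (\<lambda>x. inner x x / 2) = {0}"
proof -
  let ?f = "\<lambda>x::rvec. inner x x / 2"
  have D: "(?f has_derivative (\<lambda>h. inner x h)) (at x within S)" for x S
    by (auto intro!: derivative_eq_intros simp: inner_commute)
  have grad: "gradient d ?f x = x" if "x \<in> \<R> d" for x
    using that by (intro gradient_eqI D)
  have z: "0 \<in> \<R> d" by (simp add: Rd_def)
  show m: "minimizers d ?f = {0}"
  proof (intro set_eqI iffI)
    fix x assume "x \<in> minimizers d ?f"
    then have "inner x x \<le> 0" using minimizersD(2)[of x d ?f 0] z by simp
    then have "inner x x = 0" using inner_ge_zero[of x] by (rule antisym)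
    then show "x \<in> {0}" by simp
  next
    fix x :: rvec assume "x \<in> {0}"
    then show "x \<in> minimizers d ?f"
      using z by (simp add: minimizers_def is_arg_min_def not_less)
  qed
  have "convex_on (\<R> d) ?f"
    unfolding convex_on_def
  proof (intro conjI ballI allI impI)
    fix x y :: rvec and u v :: real
    assume uv: "0 \<le> u" "0 \<le> v" "u + v = 1"
    have "u * inner x x + v * inner y y - inner (u *\<^sub>R x + v *\<^sub>R y) (u *\<^sub>R x + v *\<^sub>R y)
        = u * v * inner (x - y) (x - y)"
    proof -
      have v: "v = 1 - u" using uv by simp
      show ?thesis unfolding v
        by (simp add: inner_add_left inner_add_right inner_diff_left inner_diff_right
            inner_commute algebra_simps)
    qed
    moreover have "0 \<le> u * v * inner (x - y) (x - y)" using uv by simp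
    ultimately show "?f (u *\<^sub>R x + v *\<^sub>R y) \<le> u * ?f x + v * ?f y" by linarith
  qed (rule subspace_imp_convex[OF subspace_Rd])
  moreover have "?f differentiable_on \<R> d"
    using D by (auto simp: differentiable_on_def differentiable_def)
  moreover have "1-lipschitz_on (\<R> d) (gradient d ?f)"
    by (auto simp: lipschitz_on_def grad)
  moreover obtain e where "e \<in> \<R> d" "coord e = (\<lambda>i. if i = 0 then 1 else 0)"
    by (rule coord_Rd_surj[of d "\<lambda>i. if i = 0 then 1 else 0"]) (use assms in auto)
  then have "e \<in> \<R> d" "e \<noteq> 0" by (auto dest: fun_cong[of _ _ 0])
  then have "{0} \<subset> \<R> d" using z by blast
  ultimately show "?f \<in> \<F>\<^sub>1 d" by (simp add: smooth_convex_def m)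
qed

lemma worst_rate_finite: "0 \<le> worst_rate n \<eta>" "worst_rate n \<eta> < \<infinity>"
proof -
  have "worst_rate n \<eta> \<le> ereal ((\<Prod>t=1..n. 1 + \<bar>\<eta> t\<bar>)\<^sup>2)"
    unfolding worst_rate_def using rate_quotient_bound by (intro Sup_least) fastforce
  also have "\<dots> < \<infinity>" by simp
  finally show "worst_rate n \<eta> < \<infinity>" .
  let ?f = "\<lambda>x::rvec. inner x x / 2"
  note h = half_norm_square_smooth_convex[of 1, OF order_refl]
  have "minimizers 1 ?f \<subset> \<R> 1"
    using h(1) by (simp add: smooth_convex_def)
  then obtain e where e: "e \<in> \<R> 1 - minimizers 1 ?f"
    by (metis psubset_imp_ex_mem)
  have "0 \<le> ereal ((?f (gd 1 ?f \<eta> e n) - ?f 0) / (norm (e - 0))\<^sup>2)" by simp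
  also have "\<dots> \<le> worst_rate n \<eta>"
    unfolding worst_rate_def
  proof (rule Sup_upper, rule CollectI, intro exI conjI)
    show "(1::nat) \<le> 1" by simp
    show "?f \<in> \<F>\<^sub>1 1" by (rule h)
    show "0 \<in> minimizers 1 ?f" unfolding h(2) by simp
  qed (rule refl e)+
  finally show "0 \<le> worst_rate n \<eta>" .
qed

definition alpha_star :: real  ("\<alpha>\<^sub>\<star>")
  where "\<alpha>\<^sub>\<star> = log 2 (1 + sqrt 3)"

definition beta_star :: real  ("\<beta>\<^sub>\<star>")
  where "\<beta>\<^sub>\<star> = 2 * \<alpha>\<^sub>\<star> / (1 + \<alpha>\<^sub>\<star>)"

end

theory Submission
  imports Defs
begin

text \<open>Since \<open>59/50 < \<beta>\<^sub>\<star>\<close>, it suffices to refute \<open>worst_rate n \<eta> \<le> n powr (-59/50)\<close> for all large \<open>n\<close>.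
  The hard instances are Moreau envelopes of maxima of affine functions, arranged such that gradient descent
  uses prescribed pieces one after the other. For arbitrary times \<open>T 0 < \<dots> < T m\<close> with steps exceeding \<open>1\<close>,
  they show that the rate at time \<open>T m - 1\<close> is at least of the order of the square of the product of the
  \<open>\<eta> (T j) / W j\<close>, where \<open>W j\<close> is essentially the sum of the steps between \<open>T j\<close> and \<open>T (j + 1)\<close>
  plus a multiple of the number of these steps.

  A single piece shows that the total length \<open>A n\<close> of the first \<open>n\<close> steps is at least of order
  \<open>n powr (59/50)\<close>, and a single jump that \<open>\<eta> t\<close> is at most of order \<open>t powr (-59/100) * A (t - 1)\<close>;
  hence \<open>ln (A n)\<close> is of order at most \<open>sqrt n\<close>. By the first bound \<open>A (2 * L) \<ge> 2 * A L\<close> for infinitely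
  many \<open>L\<close>. For such an \<open>L\<close> and every threshold \<open>H\<close> the jump bound applies to the times in \<open>{L<..2 * L}\<close>
  with steps at least \<open>H\<close>. Integrating its logarithm over \<open>H\<close> with weight \<open>H powr (-3/10)\<close> shows that the steps
  in this window sum up to less than \<open>A (2 * L) / 2\<close>, a contradiction.\<close>

section \<open>Envelopes of finitely many pieces\<close>

text \<open>Two conditions meet. With weight \<open>H powr (-s)\<close> and a loss factor z per
  jump, integrating the jump bound leaves each step x a positive multiple of
  \<open>x powr (1 - s)\<close> once 1 / (1 - s) > ln (1 / z) + ln ((1 - s) / s), which favours
  large s. The error in the window is o(A (2 * L)) if the assumed decay exponent b satisfies b * (1
  - s / 2) > 1, which favours small s. For z = 3/5, s = 3/10 satisfies both with b = 59/50 > 20/17,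
  while \<open>\<beta>\<^sub>\<star>\<close> is about 1.1837; for z = 1/2 no s works for any b up to
  \<open>\<beta>\<^sub>\<star>\<close>. As the exponents differ strictly, multiplicative constants
  need no care. Reaching z = 3/5 is the obstacle in the construction. Turning the gradient at once
  from the old coordinate to the new one needs a step longer than all that follow it in the gap.
  Otherwise each turn has to end in the disc whose diameter is the previous gradient: three turns
  through a right angle in total keep at most cos (pi/6) ^ 3, about 0.65, of the length, two turns
  only 1/2.\<close>

definition hull_val :: "rvec \<Rightarrow> rvec \<times> real \<Rightarrow> real"
  where "hull_val x p = inner (fst p) x + snd p - (norm (fst p))\<^sup>2 / 2"

text \<open>For finite \<open>P\<close> this is the Moreau envelope of \<open>y \<mapsto> Max {inner a y + b | (a, b) \<in> P}\<close>, by minimax;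
  hence it is convex and \<open>1\<close>-smooth, and its gradient at \<open>x\<close> is \<open>a\<close> as soon as the piece
  \<open>(a, b)\<close> is maximal at the proximal point \<open>x - a\<close>.\<close>

definition env :: "(rvec \<times> real) set \<Rightarrow> rvec \<Rightarrow> real"
  where "env P x = Sup (hull_val x ` (convex hull P))"

lemma env_attained:
  assumes "finite P" "P \<noteq> {}"
  shows "\<exists>p\<in>convex hull P. env P x = hull_val x p \<and> (\<forall>q\<in>convex hull P. hull_val x q \<le> hull_val x p)"
proof -
  have "compact (convex hull P)" using assms(1) by (rule finite_imp_compact_convex_hull)
  moreover have "convex hull P \<noteq> {}" using assms(2) by simp
  moreover have "continuous_on (convex hull P) (hull_val x)"
    unfolding hull_val_def by (intro continuous_intros) auto
  ultimately obtain p where p: "p \<in> convex hull P" "\<forall>q\<in>convex hull P. hull_val x q \<le> hull_val x p"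
    using continuous_attains_sup by blast
  then have "env P x = hull_val x p"
    unfolding env_def by (intro cSup_eq_maximum) auto
  with p show ?thesis by blast
qed

section \<open>Strong concavity over the hull and smoothness of the envelope\<close>

lemma hull_val_convex_comb:
  "hull_val x ((1 - t) *\<^sub>R p + t *\<^sub>R q) =
    (1 - t) * hull_val x p + t * hull_val x q + t * (1 - t) * (norm (fst q - fst p))\<^sup>2 / 2"
  unfolding hull_val_def
  by (simp add: power2_norm_eq_inner inner_add_left inner_add_right inner_diff_left inner_diff_right
      inner_commute[of "fst q" "fst p"] field_simps)

text \<open>Strong concavity in the slope, tested on the segment from p to q near p. This margin is
  the source of both the quadratic upper bound and the Lipschitz gradient of the envelope.\<close>

lemma hull_val_max_strong:
  assumes p: "p \<in> convex hull P" and max: "\<forall>q\<in>convex hull P. hull_val x q \<le> hull_val x p"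
    and q: "q \<in> convex hull P"
  shows "hull_val x q \<le> hull_val x p - (norm (fst q - fst p))\<^sup>2 / 2"
proof -
  let ?N = "(norm (fst q - fst p))\<^sup>2 / 2"
  have "hull_val x q - hull_val x p + ?N \<le> t * ?N" if t: "0 < t" "t < 1" for t
  proof -
    have "(1 - t) *\<^sub>R p + t *\<^sub>R q \<in> convex hull P"
      using p q t by (intro convexD[OF convex_convex_hull]) auto
    then have "(1 - t) * hull_val x p + t * hull_val x q + t * (1 - t) * ?N \<le> hull_val x p"
      using max hull_val_convex_comb[of x t p q] by auto
    then have "t * (hull_val x q - hull_val x p + (1 - t) * ?N) \<le> 0"
      by (simp add: algebra_simps)
    then have "hull_val x q - hull_val x p + (1 - t) * ?N \<le> 0"
      using t by (simp add: mult_le_0_iff)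
    then show ?thesis by (simp add: field_simps)
  qed
  then have "\<forall>\<^sub>F t in at_right 0. hull_val x q - hull_val x p + ?N \<le> t * ?N"
    unfolding eventually_at_right_field by (intro exI[of _ 1]) auto
  moreover have "((\<lambda>t. t * ?N) \<longlongrightarrow> 0 * ?N) (at_right 0)"
    by (intro tendsto_intros)
  ultimately have "hull_val x q - hull_val x p + ?N \<le> 0 * ?N"
    by (intro tendsto_lowerbound[of "\<lambda>t. t * ?N"]) auto
  then show ?thesis by simp
qed

lemma has_derivative_quadratic_bound:
  fixes f :: "'a::real_inner \<Rightarrow> real"
  assumes "\<And>z. \<bar>f z - (f x + inner a (z - x))\<bar> \<le> (norm (z - x))\<^sup>2 / 2"
  shows "(f has_derivative (\<lambda>h. inner a h)) (at x within S)"
  unfolding has_derivative_within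
proof
  show "bounded_linear (inner a)" by (rule bounded_linear_inner_right)
  show "((\<lambda>y. (1 / norm (y - x)) *\<^sub>R (f y - (f x + inner a (y - x)))) \<longlongrightarrow> 0) (at x within S)"
  proof (rule Lim_null_comparison)
    have "norm ((1 / norm (y - x)) *\<^sub>R (f y - (f x + inner a (y - x)))) \<le> norm (y - x)" for y
    proof (cases "y = x")
      case False
      have "norm ((1 / norm (y - x)) *\<^sub>R (f y - (f x + inner a (y - x))))
          \<le> 1 / norm (y - x) * (norm (y - x))\<^sup>2"
        using assms[of y] by (auto simp: abs_mult intro!: mult_left_mono divide_right_mono)
          (smt (verit) zero_le_power2 divide_nonneg_nonneg assms)
      then show ?thesis using False by (simp add: power2_eq_square)
    qed simp
    then show "\<forall>\<^sub>F y in at x within S.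
        norm ((1 / norm (y - x)) *\<^sub>R (f y - (f x + inner a (y - x)))) \<le> norm (y - x)"
      by simp
    have "((\<lambda>y. norm (y - x)) \<longlongrightarrow> norm (x - x)) (at x within S)"
      by (intro tendsto_intros)
    then show "((\<lambda>y. norm (y - x)) \<longlongrightarrow> 0) (at x within S)" by simp
  qed
qed

text \<open>Moving from x to z changes each \<open>hull_val\<close> by a term linear in its slope,
  so the maximiser at x yields a subgradient. For the upper bound the maximiser at z pays its
  quadratic margin at x, which Young's inequality turns into the squared displacement.\<close>

lemma env_bounds:
  assumes P: "finite P" and p: "p \<in> convex hull P" and max: "\<forall>q\<in>convex hull P. hull_val x q \<le> hull_val x p"
  shows "env P x = hull_val x p"
    and "env P x + inner (fst p) (z - x) \<le> env P z"
    and "env P z \<le> env P x + inner (fst p) (z - x) + (norm (z - x))\<^sup>2 / 2"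
proof -
  have ne: "P \<noteq> {}" using p by auto
  show eq: "env P x = hull_val x p"
    using env_attained[OF P ne, of x] p max by force
  obtain q where q: "q \<in> convex hull P" "env P z = hull_val z q" "\<forall>r\<in>convex hull P. hull_val z r \<le> hull_val z q"
    using env_attained[OF P ne, of z] by blast
  have shift: "hull_val z r = hull_val x r + inner (fst r) (z - x)" for r
    by (simp add: hull_val_def inner_diff_right)
  show "env P x + inner (fst p) (z - x) \<le> env P z"
    using q p eq shift[of p] by auto
  have "env P z = hull_val x q + inner (fst q) (z - x)" using q shift by simp
  also have "\<dots> \<le> hull_val x p - (norm (fst q - fst p))\<^sup>2 / 2 + inner (fst q) (z - x)"
    using hull_val_max_strong[OF p max q(1)] by simp
  also have "\<dots> \<le> hull_val x p + inner (fst p) (z - x) + (norm (z - x))\<^sup>2 / 2"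
  proof -
    have "0 \<le> (norm ((fst q - fst p) - (z - x)))\<^sup>2" by simp
    then have "2 * inner (fst q - fst p) (z - x) \<le> (norm (fst q - fst p))\<^sup>2 + (norm (z - x))\<^sup>2"
      by (simp only: power2_norm_eq_inner) (simp add: inner_diff_left inner_diff_right inner_commute)
    then show ?thesis by (simp add: inner_diff_left field_simps)
  qed
  finally show "env P z \<le> env P x + inner (fst p) (z - x) + (norm (z - x))\<^sup>2 / 2"
    using eq by simp
qed

lemma env_gradient:
  assumes P: "finite P" and sub: "P \<subseteq> \<R> d \<times> UNIV" and x: "x \<in> \<R> d"
    and p: "p \<in> convex hull P" and max: "\<forall>q\<in>convex hull P. hull_val x q \<le> hull_val x p"
  shows "gradient d (env P) x = fst p" "(env P has_derivative (\<lambda>h. inner (fst p) h)) (at x within \<R> d)"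
proof -
  have "convex (\<R> d \<times> (UNIV::real set))"
    using subspace_imp_convex[OF subspace_Rd] by (intro convex_Times) auto
  then have "convex hull P \<subseteq> \<R> d \<times> UNIV" using sub by (intro hull_minimal)
  then have a: "fst p \<in> \<R> d" using p by auto
  show D: "(env P has_derivative (\<lambda>h. inner (fst p) h)) (at x within \<R> d)"
  proof (rule has_derivative_quadratic_bound)
    fix z
    show "\<bar>env P z - (env P x + inner (fst p) (z - x))\<bar> \<le> (norm (z - x))\<^sup>2 / 2"
      using env_bounds(2,3)[OF P p max, of z] by (simp add: abs_le_iff)
  qed
  show "gradient d (env P) x = fst p"
    by (rule gradient_eqI[OF x a D])
qed

lemma env_nonneg:
  assumes "finite P" "(0, 0) \<in> P"
  shows "0 \<le> env P x"
proof -
  obtain p where p: "p \<in> convex hull P" "env P x = hull_val x p" "\<forall>q\<in>convex hull P. hull_val x q \<le> hull_val x p"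
    using env_attained[of P x] assms by blast
  have "(0, 0) \<in> convex hull P" using assms(2) by (rule hull_inc)
  then have "hull_val x (0, 0) \<le> env P x" using p by auto
  then show ?thesis by (simp add: hull_val_def)
qed

text \<open>The difference \<open>hull_val x q - hull_val x p\<close> is the difference of the
  affine pieces at \<open>x - fst p\<close> minus half the squared distance of the slopes. The
  affine comparison describes a half-space and so passes from P to its hull.\<close>

lemma env_piece:
  assumes P: "finite P" and p: "p \<in> P"
    and dom: "\<And>q. q \<in> P \<Longrightarrow> inner (fst q) (x - fst p) + snd q \<le> inner (fst p) (x - fst p) + snd p"
  shows "p \<in> convex hull P" "\<forall>q\<in>convex hull P. hull_val x q \<le> hull_val x p"
proof -
  show "p \<in> convex hull P" using p by (rule hull_inc)
  let ?y = "x - fst p" and ?S = "{q. inner (fst q) (x - fst p) + snd q \<le> inner (fst p) (x - fst p) + snd p}"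
  have "?S = {q. inner (?y, 1::real) q \<le> inner (fst p) ?y + snd p}"
    by (auto simp: inner_prod_def inner_commute)
  then have "convex ?S" using convex_halfspace_le by metis
  then have sub: "convex hull P \<subseteq> ?S" using dom by (intro hull_minimal) auto
  show "\<forall>q\<in>convex hull P. hull_val x q \<le> hull_val x p"
  proof
    fix q assume "q \<in> convex hull P"
    then have "inner (fst q) ?y + snd q \<le> inner (fst p) ?y + snd p" using sub by auto
    moreover have "0 \<le> (norm (fst q - fst p))\<^sup>2" by simp
    ultimately show "hull_val x q \<le> hull_val x p"
      unfolding hull_val_def
      by (simp only: power2_norm_eq_inner)
        (simp add: inner_diff_left inner_diff_right inner_commute[of "fst q" "fst p"] field_simps)
  qed
qed

lemma env_smooth_convex:
  assumes P: "finite P" and zero: "(0, 0) \<in> P" and sub: "P \<subseteq> \<R> d \<times> UNIV"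
    and xs: "xs \<in> \<R> d" "\<And>p. p \<in> P \<Longrightarrow> inner (fst p) xs + snd p \<le> 0"
    and x0: "x0 \<in> \<R> d" "env P x0 > 0"
  shows "env P \<in> \<F>\<^sub>1 d" "env P xs = 0" "xs \<in> minimizers d (env P)" "x0 \<notin> minimizers d (env P)"
proof -
  have ne: "P \<noteq> {}" using zero by auto
  show e0: "env P xs = 0"
    using env_bounds(1)[OF P env_piece[OF P zero, of xs]] xs(2) by (auto simp: hull_val_def)
  have le: "env P xs \<le> env P y" for y using e0 env_nonneg[OF P zero] by simp
  show m: "xs \<in> minimizers d (env P)"
    using xs(1) le by (auto simp: minimizers_def is_arg_min_def not_less)
  show nm: "x0 \<notin> minimizers d (env P)"
    using x0 e0 xs(1) by (auto simp: minimizers_def is_arg_min_def)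
  have sel: "\<exists>p\<in>convex hull P. \<forall>q\<in>convex hull P. hull_val x q \<le> hull_val x p" for x
    using env_attained[OF P ne, of x] by blast
  have "convex_on (\<R> d) (env P)"
    unfolding convex_on_def
  proof (intro conjI ballI allI impI)
    show "convex (\<R> d)" by (rule subspace_imp_convex[OF subspace_Rd])
    fix x y :: rvec and u v :: real
    assume uv: "0 \<le> u" "0 \<le> v" "u + v = 1"
    let ?w = "u *\<^sub>R x + v *\<^sub>R y"
    obtain p where p: "p \<in> convex hull P" "\<forall>q\<in>convex hull P. hull_val ?w q \<le> hull_val ?w p"
      using sel by blast
    note b = env_bounds(2)[OF P p]
    have "u * (env P ?w + inner (fst p) (x - ?w)) + v * (env P ?w + inner (fst p) (y - ?w))
        \<le> u * env P x + v * env P y"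
      using b[of x] b[of y] uv by (intro add_mono mult_left_mono) auto
    moreover have "u * (env P ?w + inner (fst p) (x - ?w)) + v * (env P ?w + inner (fst p) (y - ?w))
        = env P ?w"
    proof -
      have "u * (env P ?w + inner (fst p) (x - ?w)) + v * (env P ?w + inner (fst p) (y - ?w))
        = (u + v) * env P ?w + (inner (fst p) ?w - (u + v) * inner (fst p) ?w)"
        by (simp add: inner_diff_right inner_add_right algebra_simps)
      then show ?thesis using uv by simp
    qed
    ultimately show "env P ?w \<le> u * env P x + v * env P y" by simp
  qed
  moreover have "env P differentiable_on \<R> d"
    unfolding differentiable_on_def differentiable_def
    using sel env_gradient(2)[OF P sub] by blast
  moreover have "1-lipschitz_on (\<R> d) (gradient d (env P))"
  proof (rule lipschitz_onI)
    fix x y assume x: "x \<in> \<R> d" and y: "y \<in> \<R> d"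
    obtain p where p: "p \<in> convex hull P" "\<forall>q\<in>convex hull P. hull_val x q \<le> hull_val x p"
      using sel by blast
    obtain q where q: "q \<in> convex hull P" "\<forall>r\<in>convex hull P. hull_val y r \<le> hull_val y q"
      using sel by blast
    \<comment> \<open>Adding the two margins makes the gradient cocoercive.\<close>
    have "hull_val x q \<le> hull_val x p - (norm (fst q - fst p))\<^sup>2 / 2"
      "hull_val y p \<le> hull_val y q - (norm (fst p - fst q))\<^sup>2 / 2"
      using hull_val_max_strong[OF p q(1)] hull_val_max_strong[OF q p(1)] by auto
    then have "(norm (fst p - fst q))\<^sup>2 \<le> inner (fst p - fst q) (x - y)"
      by (simp add: hull_val_def inner_diff_left inner_diff_right norm_minus_commute[of "fst q"])
    also have "\<dots> \<le> norm (fst p - fst q) * norm (x - y)"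
      by (rule norm_cauchy_schwarz)
    finally have "norm (fst p - fst q) \<le> norm (x - y)"
      by (cases "norm (fst p - fst q) = 0") (auto simp: power2_eq_square)
    then show "dist (gradient d (env P) x) (gradient d (env P) y) \<le> 1 * dist x y"
      using env_gradient(1)[OF P sub x p] env_gradient(1)[OF P sub y q] by (simp add: dist_norm)
  qed simp
  moreover have "minimizers d (env P) \<subset> \<R> d"
    using nm x0(1) minimizersD(1) by blast
  ultimately show "env P \<in> \<F>\<^sub>1 d" using m by (auto simp: smooth_convex_def)
qed

text \<open>A certificate for a lower bound: X is the claimed trajectory, G the piece claimed active
  at each time. Dominance at the proximal points identifies the gradients, so X is gradient descent;
  the zero piece and xs together make 0 the minimum.\<close>

lemma worst_rate_ge_env:
  assumes d: "d \<ge> 1" and P: "finite P" and zero: "(0, 0) \<in> P" and sub: "P \<subseteq> \<R> d \<times> UNIV"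
    and xs: "xs \<in> \<R> d" "\<And>p. p \<in> P \<Longrightarrow> inner (fst p) xs + snd p \<le> 0"
    and X0: "X 0 \<in> \<R> d" and G0: "fst (G 0) \<noteq> 0"
    and step: "\<And>t. t < n \<Longrightarrow> X (Suc t) = X t - \<eta> (Suc t) *\<^sub>R fst (G t)"
    and G: "\<And>t. t \<le> n \<Longrightarrow> G t \<in> P"
    and dom: "\<And>t q. t \<le> n \<Longrightarrow> q \<in> P \<Longrightarrow>
      inner (fst q) (X t - fst (G t)) + snd q \<le> inner (fst (G t)) (X t - fst (G t)) + snd (G t)"
  shows "ereal (hull_val (X n) (G n) / (norm (X 0 - xs))\<^sup>2) \<le> worst_rate n \<eta>"
proof -
  have max: "G t \<in> convex hull P" "\<forall>q\<in>convex hull P. hull_val (X t) q \<le> hull_val (X t) (G t)" if "t \<le> n" for t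
    using env_piece[OF P G[OF that], of "X t"] dom[OF that] by blast+
  have "0 \<le> inner (fst (G 0)) (X 0 - fst (G 0)) + snd (G 0)"
    using dom[OF _ zero, of 0] by simp
  moreover have "0 < inner (fst (G 0)) (fst (G 0))" using G0 by simp
  ultimately have "0 < hull_val (X 0) (G 0)"
    unfolding hull_val_def power2_norm_eq_inner inner_diff_right by linarith
  then have pos: "0 < env P (X 0)" using env_bounds(1)[OF P max[of 0]] by simp
  note sm = env_smooth_convex[OF P zero sub xs X0 pos]
  have X: "gd d (env P) \<eta> (X 0) t = X t \<and> X t \<in> \<R> d" if "t \<le> n" for t
    using that
  proof (induction t)
    case (Suc t)
    then have t: "gd d (env P) \<eta> (X 0) t = X t" "X t \<in> \<R> d" "t \<le> n" "t < n" by auto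
    have "gradient d (env P) (X t) = fst (G t)"
      by (rule env_gradient(1)[OF P sub t(2) max[OF t(3)]])
    then have "gd d (env P) \<eta> (X 0) (Suc t) = X (Suc t)"
      using step[OF t(4)] t(1) by simp
    then show ?case using gd_Rd[OF sm(1) X0, of \<eta> "Suc t"] by simp
  qed (use X0 in simp)
  have "env P (gd d (env P) \<eta> (X 0) n) = hull_val (X n) (G n)"
    using X[of n] env_bounds(1)[OF P max[of n]] by simp
  then have "hull_val (X n) (G n) / (norm (X 0 - xs))\<^sup>2 =
      (env P (gd d (env P) \<eta> (X 0) n) - env P xs) / (norm (X 0 - xs))\<^sup>2"
    using sm(2) by simp
  then show ?thesis
    unfolding worst_rate_def using d sm X0 by (intro Sup_upper) blast
qed

section \<open>Chains of pieces\<close>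

text \<open>Between two consecutive long steps the iterate runs through up to four pieces, with gradients
  proportional to \<open>(- cx, cz)\<close> in the plane of the coordinates \<open>j - 1\<close> and \<open>j\<close>, visited in the order
  \<open>0, 1, 2, 3\<close>. The total length of block \<open>i\<close> is \<open>\<theta>i\<close>, and \<open>s\<close> is the last step of block \<open>0\<close>.
  The offset \<open>\<nu> l\<close> makes piece \<open>l\<close> tie with its successor where the blocks switch, and
  \<open>V l a0 a1 a2 a3\<close> is the value of piece \<open>l\<close> at the point from which the remaining travel along
  direction \<open>i\<close> is \<open>ai\<close>.\<close>

fun cx :: "real \<Rightarrow> nat \<Rightarrow> real" where
  "cx e 0 = 1" | "cx e (Suc 0) = 3/4" | "cx e (Suc (Suc 0)) = 3/8" | "cx e _ = e"

fun cz :: "nat \<Rightarrow> real" where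
  "cz 0 = 0" | "cz (Suc 0) = 2/5" | "cz _ = 3/5"

text \<open>The flags say which blocks are nonempty. The slopes satisfy
  \<open>D l l \<le> D (l - 1) l\<close> for l = 1, 2, 3: travel along block l lowers piece l - 1 at
  least as fast as piece l. Later blocks may undo this margin, so it is bought in advance, by a long
  block (the factors 6 and 9) or by a switching step s that exceeds what follows.\<close>

locale gap_blocks =
  fixes e \<theta>1 \<theta>2 \<theta>3 s :: real and u0 u1 u2 :: bool
  assumes e: "0 \<le> e" "e \<le> 9/25"
    and \<theta>: "0 \<le> \<theta>1" "0 \<le> \<theta>2" "0 \<le> \<theta>3"
    and unused: "\<not> u1 \<Longrightarrow> \<theta>1 = 0" "\<not> u2 \<Longrightarrow> \<theta>2 = 0"
    and u1: "u1 \<Longrightarrow> u2" "u1 \<Longrightarrow> \<theta>2 \<ge> 6 * (\<theta>3 + 1)"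
    and s: "u0 \<Longrightarrow> s \<ge> 1"
    and u0: "u0 \<Longrightarrow> s \<ge> 2 + \<theta>1 + \<theta>2 + \<theta>3 \<or> (u1 \<and> \<theta>1 \<ge> 9 * (\<theta>2 + \<theta>3 + 1))"
begin

definition D :: "nat \<Rightarrow> nat \<Rightarrow> real"
  where "D l i = cx e l * cx e i + cz l * cz i"

definition \<nu>2 :: real where "\<nu>2 = (\<theta>3 + 1) * (e\<^sup>2 - 3/8 * e)"

definition \<nu>1 :: real where "\<nu>1 = \<nu>2 + (\<theta>3 + 1) * (3/25 - 3/8 * e) - \<theta>2 * (33/1600)"

definition \<nu> :: "nat \<Rightarrow> real" where
  "\<nu> l = (if l = 0 then
      (if u1 then \<nu>1 + (\<theta>3 + 1) * (6/25 - e/4) + \<theta>2 * (117/800) - \<theta>1 * (11/400) - (s - 1) / 4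
       else if u2 then \<nu>2 + (\<theta>3 + 1) * (9/25 - 5/8 * e) + \<theta>2 * (201/1600) - (s - 1) * (5/8)
       else (\<theta>3 + 1) * (e\<^sup>2 + 9/25 - e) - (s - 1) * (1 - e))
    else if l = 1 then \<nu>1 else if l = 2 then \<nu>2 else 0)"

definition V :: "nat \<Rightarrow> real \<Rightarrow> real \<Rightarrow> real \<Rightarrow> real \<Rightarrow> real"
  where "V l a0 a1 a2 a3 = a0 * D l 0 + a1 * D l 1 + a2 * D l 2 + a3 * D l 3 + \<nu> l"

definition used :: "nat \<Rightarrow> bool"
  where "used l \<longleftrightarrow> (l = 0 \<and> u0) \<or> (l = 1 \<and> u1) \<or> (l = 2 \<and> u2) \<or> l = 3"

lemma D_simps:
  "D 0 0 = 1" "D 0 1 = 3/4" "D 0 2 = 3/8" "D 0 3 = e"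
  "D 1 0 = 3/4" "D 1 1 = 289/400" "D 1 2 = 417/800" "D 1 3 = 3/4 * e + 6/25"
  "D 2 0 = 3/8" "D 2 1 = 417/800" "D 2 2 = 801/1600" "D 2 3 = 3/8 * e + 9/25"
  "D 3 0 = e" "D 3 1 = 3/4 * e + 6/25" "D 3 2 = 3/8 * e + 9/25" "D 3 3 = e\<^sup>2 + 9/25"
  "D (Suc 0) 0 = 3/4" "D (Suc 0) (Suc 0) = 289/400" "D (Suc 0) 2 = 417/800" "D (Suc 0) 3 = 3/4 * e + 6/25"
  "D 0 (Suc 0) = 3/4" "D 2 (Suc 0) = 417/800" "D 3 (Suc 0) = 3/4 * e + 6/25"
  by (simp_all add: D_def numeral_2_eq_2 numeral_3_eq_3 power2_eq_square)

lemmas V_eq = V_def D_simps \<nu>_def \<nu>1_def \<nu>2_def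

lemma e_sq: "e\<^sup>2 \<le> 9/25 * e"
  using mult_right_mono[OF e(2) e(1)] by (simp add: power2_eq_square)

text \<open>The coefficients of the difference are nonnegative because e \<le> 9/25; that of
  \<open>a1\<close> goes down to 9/800 at e = 9/25.\<close>

lemma V32: "0 \<le> a0 \<Longrightarrow> 0 \<le> a1 \<Longrightarrow> 0 \<le> a2 \<Longrightarrow> a3 \<ge> \<theta>3 + 1 \<Longrightarrow> V 3 a0 a1 a2 a3 \<le> V 2 a0 a1 a2 a3"
proof -
  assume a: "0 \<le> a0" "0 \<le> a1" "0 \<le> a2" "a3 \<ge> \<theta>3 + 1"
  have "V 2 a0 a1 a2 a3 - V 3 a0 a1 a2 a3 =
    a0 * (3/8 - e) + a1 * (417/800 - (3/4 * e + 6/25)) + a2 * (801/1600 - (3/8 * e + 9/25))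
     + (a3 - (\<theta>3 + 1)) * (3/8 * e - e\<^sup>2)"
    by (simp add: V_eq field_simps)
  also have "\<dots> \<ge> 0"
    using a e e_sq by (intro add_nonneg_nonneg mult_nonneg_nonneg) auto
  finally show ?thesis by simp
qed

lemma V23: "a3 \<le> \<theta>3 + 1 \<Longrightarrow> V 2 0 0 0 a3 \<le> V 3 0 0 0 a3"
proof -
  assume a: "a3 \<le> \<theta>3 + 1"
  have "V 3 0 0 0 a3 - V 2 0 0 0 a3 = (\<theta>3 + 1 - a3) * (3/8 * e - e\<^sup>2)"
    by (simp add: V_eq field_simps)
  also have "\<dots> \<ge> 0" using a e e_sq by (intro mult_nonneg_nonneg) auto
  finally show ?thesis by simp
qed

lemma V21: "0 \<le> a0 \<Longrightarrow> 0 \<le> a1 \<Longrightarrow> V 2 a0 a1 \<theta>2 (\<theta>3 + 1) \<le> V 1 a0 a1 \<theta>2 (\<theta>3 + 1)"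
proof -
  assume a: "0 \<le> a0" "0 \<le> a1"
  have "V 1 a0 a1 \<theta>2 (\<theta>3 + 1) - V 2 a0 a1 \<theta>2 (\<theta>3 + 1) = a0 * (3/8) + a1 * (161/800)"
    by (simp add: V_eq field_simps)
  with a show ?thesis by simp
qed

text \<open>Piece 1 falls behind piece 2 by 33/1600 per unit of block 2 and regains at most 3/25 per
  unit of block 3. The factor 6 suffices since 6 * 33/1600 > 3/25.\<close>

lemma V12:
  assumes u: u1 and a: "0 \<le> a2" "a2 \<le> \<theta>2" "0 \<le> a3" "a3 \<le> \<theta>3 + 1" and or: "a3 = \<theta>3 + 1 \<or> a2 = 0"
  shows "V 1 0 0 a2 a3 \<le> V 2 0 0 a2 a3"
proof -
  have eq: "V 2 0 0 a2 a3 - V 1 0 0 a2 a3 =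
      (\<theta>2 - a2) * (33/1600) - (\<theta>3 + 1 - a3) * (3/25 - 3/8 * e)"
    by (simp add: V_eq field_simps)
  show ?thesis
  proof (cases "a3 = \<theta>3 + 1")
    case True
    then show ?thesis using eq a by simp
  next
    case False
    then have a2: "a2 = 0" using or by simp
    have "(\<theta>3 + 1 - a3) * (3/25 - 3/8 * e) \<le> (\<theta>3 + 1 - a3) * (3/25)"
      using a e by (intro mult_left_mono) auto
    then show ?thesis using eq a2 u1(2)[OF u] a by simp
  qed
qed

text \<open>Piece 0 falls behind piece 1 by 11/400 per unit of block 1 and regains at most 117/800
  and 6/25 per unit of blocks 2 and 3; 9 * 11/400 exceeds both. Otherwise the overshoot s - 1 of the
  switching step pays, at the rate 1/4, 5/8 or at least 16/25 according to the block that
  follows.\<close>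

lemma V0_le:
  assumes u: u0
    and a: "0 \<le> a1" "a1 \<le> \<theta>1" "0 \<le> a2" "a2 \<le> \<theta>2" "0 \<le> a3" "a3 \<le> \<theta>3 + 1"
    and or: "(a2 = \<theta>2 \<and> a3 = \<theta>3 + 1) \<or> a1 = 0"
  shows "u1 \<Longrightarrow> V 0 0 a1 a2 a3 \<le> V 1 0 a1 a2 a3"
    and "\<not> u1 \<Longrightarrow> u2 \<Longrightarrow> V 0 0 a1 a2 a3 \<le> V 2 0 a1 a2 a3"
    and "\<not> u1 \<Longrightarrow> \<not> u2 \<Longrightarrow> V 0 0 a1 a2 a3 \<le> V 3 0 a1 a2 a3"
proof -
  have s: "s \<ge> 1" using s u .
  have e3: "(\<theta>3 + 1 - a3) * (c - k * e) \<le> (\<theta>3 + 1 - a3) * c" if "k \<ge> 0" for c k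
    using a e that by (intro mult_left_mono) auto
  show "V 0 0 a1 a2 a3 \<le> V 1 0 a1 a2 a3" if v: u1
  proof -
    have eq: "V 1 0 a1 a2 a3 - V 0 0 a1 a2 a3 =
        (s - 1) / 4 + (\<theta>1 - a1) * (11/400) - (\<theta>2 - a2) * (117/800) - (\<theta>3 + 1 - a3) * (6/25 - 1/4 * e)"
      unfolding V_eq using v by (simp add: field_simps)
    have e3': "(\<theta>3 + 1 - a3) * (6/25 - 1/4 * e) \<le> (\<theta>3 + 1 - a3) * (6/25)" by (rule e3) simp
    show ?thesis
    proof (cases "a1 = 0")
      case True
      define Z where "Z = (\<theta>3 + 1 - a3) * (6/25 - 1/4 * e)"
      have "0 \<le> (s - 1) / 4 + (\<theta>1 - a1) * (11/400) - (\<theta>2 - a2) * (117/800) - Z"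
        using u0[OF u] e3'[folded Z_def] True a s \<theta> by (elim disjE conjE) (simp_all add: field_simps)
      then have "0 \<le> (s - 1) / 4 + (\<theta>1 - a1) * (11/400) - (\<theta>2 - a2) * (117/800) - (\<theta>3 + 1 - a3) * (6/25 - 1/4 * e)"
        unfolding Z_def .
      then show ?thesis using eq by linarith
    next
      case False
      then have "a2 = \<theta>2" "a3 = \<theta>3 + 1" using or by auto
      then have "0 \<le> (s - 1) / 4 + (\<theta>1 - a1) * (11/400) - (\<theta>2 - a2) * (117/800) - (\<theta>3 + 1 - a3) * (6/25 - 1/4 * e)"
        using a s by simp
      then show ?thesis using eq by linarith
    qed
  qed
  show "V 0 0 a1 a2 a3 \<le> V 2 0 a1 a2 a3" if v: "\<not> u1" u2
  proof -
    have z: "a1 = 0" "\<theta>1 = 0" using a unused v by auto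
    have eq: "V 2 0 a1 a2 a3 - V 0 0 a1 a2 a3 =
        (s - 1) * (5/8) - (\<theta>2 - a2) * (201/1600) - (\<theta>3 + 1 - a3) * (9/25 - 5/8 * e)"
      unfolding V_eq using v z by (simp add: field_simps)
    have e3': "(\<theta>3 + 1 - a3) * (9/25 - 5/8 * e) \<le> (\<theta>3 + 1 - a3) * (9/25)" by (rule e3) simp
    have "s \<ge> 2 + \<theta>1 + \<theta>2 + \<theta>3" using u0[OF u] v by blast
    define Z where "Z = (\<theta>3 + 1 - a3) * (9/25 - 5/8 * e)"
    have "0 \<le> (s - 1) * (5/8) - (\<theta>2 - a2) * (201/1600) - Z"
      using \<open>s \<ge> 2 + \<theta>1 + \<theta>2 + \<theta>3\<close> e3'[folded Z_def] z a s \<theta> by (simp add: field_simps)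
    then have "0 \<le> (s - 1) * (5/8) - (\<theta>2 - a2) * (201/1600) - (\<theta>3 + 1 - a3) * (9/25 - 5/8 * e)"
      unfolding Z_def .
    then show ?thesis using eq by linarith
  qed
  show "V 0 0 a1 a2 a3 \<le> V 3 0 a1 a2 a3" if v: "\<not> u1" "\<not> u2"
  proof -
    have z: "a1 = 0" "\<theta>1 = 0" "a2 = 0" "\<theta>2 = 0" using a unused v by auto
    have eq: "V 3 0 a1 a2 a3 - V 0 0 a1 a2 a3 =
        (s - 1) * (1 - e) - (\<theta>3 + 1 - a3) * (9/25 + e\<^sup>2 - e)"
      unfolding V_eq using v z by (simp add: field_simps)
    define Y Z where "Y = (s - 1) * (1 - e)" and "Z = (\<theta>3 + 1 - a3) * (9/25 + e\<^sup>2 - e)"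
    have "Y \<ge> (s - 1) * (16/25)" unfolding Y_def using s e by (intro mult_left_mono) auto
    moreover have "Z \<le> (\<theta>3 + 1 - a3) * (9/25)"
      unfolding Z_def using a e e_sq by (intro mult_left_mono) auto
    moreover have "s \<ge> 2 + \<theta>1 + \<theta>2 + \<theta>3" using u0[OF u] v by blast
    ultimately have "0 \<le> Y - Z"
      using z a s \<theta> by (simp add: field_simps)
    then show ?thesis using eq unfolding Y_def Z_def by linarith
  qed
qed

lemma V3_nonneg: "0 \<le> a0 \<Longrightarrow> 0 \<le> a1 \<Longrightarrow> 0 \<le> a2 \<Longrightarrow> 0 \<le> a3 \<Longrightarrow> 0 \<le> V 3 a0 a1 a2 a3"
  using e by (simp add: V_eq)

text \<open>The tie is at \<open>a0 = s - 1\<close>: the last iterate of block 0 has travel s left,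
  and its proximal point lies one unit further along.\<close>

lemma V_first:
  assumes u: u0 and a: "a0 \<ge> s - 1"
  shows "u1 \<Longrightarrow> V 1 a0 \<theta>1 \<theta>2 (\<theta>3 + 1) \<le> V 0 a0 \<theta>1 \<theta>2 (\<theta>3 + 1)"
    and "\<not> u1 \<Longrightarrow> u2 \<Longrightarrow> V 2 a0 \<theta>1 \<theta>2 (\<theta>3 + 1) \<le> V 0 a0 \<theta>1 \<theta>2 (\<theta>3 + 1)"
    and "\<not> u1 \<Longrightarrow> \<not> u2 \<Longrightarrow> V 3 a0 \<theta>1 \<theta>2 (\<theta>3 + 1) \<le> V 0 a0 \<theta>1 \<theta>2 (\<theta>3 + 1)"
proof -
  show "V 1 a0 \<theta>1 \<theta>2 (\<theta>3 + 1) \<le> V 0 a0 \<theta>1 \<theta>2 (\<theta>3 + 1)" if v: u1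
  proof -
    have "V 0 a0 \<theta>1 \<theta>2 (\<theta>3 + 1) - V 1 a0 \<theta>1 \<theta>2 (\<theta>3 + 1) = (a0 - (s - 1)) / 4"
      unfolding V_eq using v by (simp add: field_simps)
    then show ?thesis using a by simp
  qed
  show "V 2 a0 \<theta>1 \<theta>2 (\<theta>3 + 1) \<le> V 0 a0 \<theta>1 \<theta>2 (\<theta>3 + 1)" if v: "\<not> u1" u2
  proof -
    have "V 0 a0 \<theta>1 \<theta>2 (\<theta>3 + 1) - V 2 a0 \<theta>1 \<theta>2 (\<theta>3 + 1) = (a0 - (s - 1)) * (5/8)"
      unfolding V_eq using v unused(1) by (simp add: field_simps)
    then show ?thesis using a by simp
  qed
  show "V 3 a0 \<theta>1 \<theta>2 (\<theta>3 + 1) \<le> V 0 a0 \<theta>1 \<theta>2 (\<theta>3 + 1)" if v: "\<not> u1" "\<not> u2"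
  proof -
    have "V 0 a0 \<theta>1 \<theta>2 (\<theta>3 + 1) - V 3 a0 \<theta>1 \<theta>2 (\<theta>3 + 1) = (a0 - (s - 1)) * (1 - e)"
      unfolding V_eq using v unused by (simp add: field_simps)
    also have "\<dots> \<ge> 0" using a e by (intro mult_nonneg_nonneg) auto
    finally show ?thesis by simp
  qed
qed

text \<open>Travel is measured at proximal points, and its origin is the proximal point of the last
  iterate before the closing long step. Hence the range up to \<open>\<theta>3\<close> inside block
  3, but the value \<open>\<theta>3 + 1\<close> before it.\<close>

definition in_block :: "nat \<Rightarrow> real \<Rightarrow> real \<Rightarrow> real \<Rightarrow> real \<Rightarrow> bool"
  where "in_block i a0 a1 a2 a3 \<longleftrightarrow> used i \<and>
    ((i = 3 \<and> a0 = 0 \<and> a1 = 0 \<and> a2 = 0 \<and> 0 \<le> a3 \<and> a3 \<le> \<theta>3) \<or>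
     (i = 2 \<and> a0 = 0 \<and> a1 = 0 \<and> 0 \<le> a2 \<and> a2 \<le> \<theta>2 \<and> a3 = \<theta>3 + 1) \<or>
     (i = 1 \<and> a0 = 0 \<and> 0 \<le> a1 \<and> a1 \<le> \<theta>1 \<and> a2 = \<theta>2 \<and> a3 = \<theta>3 + 1) \<or>
     (i = 0 \<and> s - 1 \<le> a0 \<and> a1 = \<theta>1 \<and> a2 = \<theta>2 \<and> a3 = \<theta>3 + 1))"

lemma V_dominant:
  assumes i: "in_block i a0 a1 a2 a3" and l: "used l"
  shows "V l a0 a1 a2 a3 \<le> V i a0 a1 a2 a3" "0 \<le> V i a0 a1 a2 a3"
proof -
  have nn: "0 \<le> a0" "0 \<le> a1" "0 \<le> a2" "0 \<le> a3"
    using i s \<theta> by (auto simp: in_block_def used_def)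
  consider "i = 3" "a0 = 0" "a1 = 0" "a2 = 0" "a3 \<le> \<theta>3"
    | "i = 2" "u2" "a0 = 0" "a1 = 0" "a2 \<le> \<theta>2" "a3 = \<theta>3 + 1"
    | "i = 1" "u1" "a0 = 0" "a1 \<le> \<theta>1" "a2 = \<theta>2" "a3 = \<theta>3 + 1"
    | "i = 0" "u0" "s - 1 \<le> a0" "a1 = \<theta>1" "a2 = \<theta>2" "a3 = \<theta>3 + 1"
    using i by (auto simp: in_block_def used_def)
  then have "V l a0 a1 a2 a3 \<le> V i a0 a1 a2 a3 \<and> V 3 a0 a1 a2 a3 \<le> V i a0 a1 a2 a3"
  proof cases
    case 1
    have "V 2 0 0 0 a3 \<le> V 3 0 0 0 a3" using V23 1 by simp
    moreover have "u1 \<Longrightarrow> V 1 0 0 0 a3 \<le> V 2 0 0 0 a3" using V12[of 0 a3] 1 nn \<theta> by simp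
    moreover note V0_le[of 0 0 a3]
    ultimately show ?thesis using l 1 nn \<theta> unfolding used_def by fastforce
  next
    case 2
    have "V 3 0 0 a2 a3 \<le> V 2 0 0 a2 a3" using V32 2 nn by simp
    moreover have "u1 \<Longrightarrow> V 1 0 0 a2 a3 \<le> V 2 0 0 a2 a3" using V12[of a2 a3] 2 nn \<theta> by simp
    moreover note V0_le[of 0 a2 a3]
    ultimately show ?thesis using l 2 nn \<theta> unfolding used_def by fastforce
  next
    case 3
    have "V 3 0 a1 a2 a3 \<le> V 2 0 a1 a2 a3" using V32 3 nn by simp
    moreover have "V 2 0 a1 a2 a3 \<le> V 1 0 a1 a2 a3" using V21[of 0 a1] 3 nn by simp
    moreover note V0_le[of a1 a2 a3]
    ultimately show ?thesis using l 3 nn \<theta> unfolding used_def by fastforce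
  next
    case 4
    have "V 3 a0 a1 a2 a3 \<le> V 2 a0 a1 a2 a3" using V32 4 nn by simp
    moreover have "V 2 a0 a1 a2 a3 \<le> V 1 a0 a1 a2 a3" using V21[of a0 a1] 4 nn by simp
    moreover note V_first[of a0]
    ultimately show ?thesis using l 4 nn \<theta> u1(1) unfolding used_def by fastforce
  qed
  then show "V l a0 a1 a2 a3 \<le> V i a0 a1 a2 a3" "0 \<le> V i a0 a1 a2 a3"
    using V3_nonneg[OF nn] by auto
qed

text \<open>At the origin of travel \<open>V l\<close> is \<open>\<nu> l\<close>, and the active
  piece 3 has value 0.\<close>

lemma \<nu>_nonpos: "used l \<Longrightarrow> \<nu> l \<le> 0"
  using V_dominant(1)[of 3 0 0 0 0 l] \<theta>
  by (simp add: in_block_def used_def V_def \<nu>_def)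

end

section \<open>Gluing the gaps into one trajectory\<close>

definition unit_vec :: "nat \<Rightarrow> rvec"
  where "unit_vec k = Abs_rvec (\<lambda>j. if j = k then 1 else 0)"

lemma coord_unit_vec [simp]: "coord (unit_vec k) j = (if j = k then 1 else 0)"
  by (simp add: unit_vec_def Abs_rvec_inverse)

lemma inner_unit_vec [simp]: "inner (unit_vec k) y = coord y k"
  by (subst inner_rvec_superset[of "{k}"]) auto

text \<open>\<open>B (4 * j)\<close>, \<dots>, \<open>B (4 * j + 3)\<close> delimit the four blocks of gap \<open>j\<close>, and \<open>B (4 * j + 4)\<close> is the
  long step that closes it; that step still belongs to block \<open>3\<close>. Gap \<open>0\<close> consists of block \<open>3\<close> only.\<close>

locale jump_chain =
  fixes \<eta> :: "nat \<Rightarrow> real" and m :: nat and B :: "nat \<Rightarrow> nat"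
    and \<theta> :: "nat \<Rightarrow> nat \<Rightarrow> real" and \<theta>3 \<Lambda> :: "nat \<Rightarrow> real"
  defines "\<theta> \<equiv> \<lambda>j i. \<Sum>s\<in>{B (4*j+i)<..B (4*j+i+1)}. \<eta> s"
    and "\<theta>3 \<equiv> \<lambda>j. \<Sum>s\<in>{B (4*j+3)<..<B (4*j+4)}. \<eta> s"
    and "\<Lambda> \<equiv> \<lambda>j. \<theta> j 1 + \<theta> j 2 + \<theta>3 j + 1"
  assumes \<eta>_pos: "\<And>t. t \<ge> 1 \<Longrightarrow> \<eta> t > 0"
    and B0: "\<And>k. k \<le> 3 \<Longrightarrow> B k = 0"
    and B_Suc: "\<And>k. k < 4 * m + 4 \<Longrightarrow> B k \<le> B (Suc k)"
    and B_last: "\<And>j. j \<le> m \<Longrightarrow> B (4*j+3) < B (4*j+4)"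
    and switch: "\<And>j i. j \<le> m \<Longrightarrow> i < 3 \<Longrightarrow> B (4*j+i) < B (4*j+i+1) \<Longrightarrow> \<eta> (B (4*j+i+1)) \<ge> 1"
    and block1: "\<And>j. j \<le> m \<Longrightarrow> B (4*j+1) < B (4*j+2) \<Longrightarrow> B (4*j+2) < B (4*j+3) \<and> \<theta> j 2 \<ge> 6 * (\<theta>3 j + 1)"
    and block0: "\<And>j. j \<le> m \<Longrightarrow> B (4*j) < B (4*j+1) \<Longrightarrow> \<eta> (B (4*j+1)) \<ge> 1 + \<Lambda> j \<or>
        B (4*j+1) < B (4*j+2) \<and> \<theta> j 1 \<ge> 9 * (\<theta> j 2 + \<theta>3 j + 1)"
    and jump: "\<And>j. j < m \<Longrightarrow> \<eta> (B (4*j+4)) > 1"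
begin

text \<open>The step closing the last gap is never taken, so it counts as \<open>0\<close>.\<close>

definition h :: "nat \<Rightarrow> real" where "h j = (if j < m then \<eta> (B (4*j+4)) else 0)"

text \<open>Two demands on \<open>e j\<close> compete: \<open>e j * r j\<close> is to reach 9/25 *
  \<open>\<Lambda> j\<close>, so that the pieces of gap j stay inactive before it, and
  \<open>e j * h j\<close> is not to exceed \<open>r j\<close>. They force a reserve of order sqrt
  (\<Lambda> * h); the extra \<open>\<Lambda> j\<close> keeps \<open>e j\<close> at most
  9/25.\<close>

definition r :: "nat \<Rightarrow> real" where "r j = sqrt (\<Lambda> j * h j) + \<Lambda> j"

text \<open>For j = 0 the truncated \<open>j - 1\<close> is again 0; the value 0 leaves
  \<open>vec 0 3\<close> a clean multiple of \<open>unit_vec 0\<close>.\<close>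

definition e :: "nat \<Rightarrow> real" where "e j = (if j = 0 then 0 else 9/25 * \<Lambda> j / r j)"

text \<open>During gap \<open>j\<close> coordinate \<open>j - 1\<close> recedes by \<open>p j * (w j - r j)\<close>; the reserve \<open>p j * r j\<close> pays for
  the recession \<open>p j * e j * (h j - 1)\<close> caused by the next long step. The scale \<open>p\<close> is chosen such that
  this exactly uses up the progress of the previous long step.\<close>

definition w :: "nat \<Rightarrow> real"
  where "w j = \<theta> j 0 + 3/4 * \<theta> j 1 + 3/8 * \<theta> j 2 + e j * (\<theta>3 j + 1) + r j"

primrec p :: "nat \<Rightarrow> real" where
  "p 0 = 1" | "p (Suc j) = 3/5 * (\<eta> (B (4*j+4)) - 1) * p j / w (Suc j)"

lemmas p_Suc = p.simps(2)
declare p.simps(2) [simp del]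

definition vec :: "nat \<Rightarrow> nat \<Rightarrow> rvec"
  where "vec j i = (p j * cz i) *\<^sub>R unit_vec j - (p j * cx (e j) i) *\<^sub>R unit_vec (j - 1)"

definition lab :: "nat \<Rightarrow> nat" where "lab t = (LEAST k. t < B (Suc k))"

primrec X :: "nat \<Rightarrow> rvec" where
  "X 0 = 0" | "X (Suc t) = X t - \<eta> (Suc t) *\<^sub>R vec (lab t div 4) (lab t mod 4)"

text \<open>The proximal point of the last iterate before the long step that closes gap \<open>j\<close>.\<close>

definition E :: "nat \<Rightarrow> rvec" where "E j = X (B (4*j+4) - 1) - vec j 3"

lemma \<theta>_nonneg: "0 \<le> \<theta> j i" "0 \<le> \<theta>3 j"
  unfolding \<theta>_def \<theta>3_def by (auto intro!: sum_nonneg less_imp_le[OF \<eta>_pos])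

lemma \<Lambda>_ge1: "1 \<le> \<Lambda> j" using \<theta>_nonneg by (simp add: \<Lambda>_def)

lemma h_nonneg: "0 \<le> h j"
  using jump[of j] by (auto simp: h_def)

lemma r_ge: "\<Lambda> j \<le> r j" "0 < r j" "sqrt (\<Lambda> j * h j) \<le> r j"
  using \<Lambda>_ge1[of j] h_nonneg[of j] by (auto simp: r_def intro!: add_nonneg_pos)

lemma e_bounds: "0 \<le> e j" "e j \<le> 9/25"
  using r_ge[of j] \<Lambda>_ge1[of j] by (auto simp: e_def divide_le_eq)

lemma w_pos: "0 < w j"
  using r_ge[of j] \<theta>_nonneg e_bounds[of j] unfolding w_def
  by (intro add_nonneg_pos add_nonneg_nonneg mult_nonneg_nonneg) auto

lemma p_pos: "j \<le> m \<Longrightarrow> 0 < p j"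
proof (induction j)
  case (Suc j)
  then show ?case using jump[of j] w_pos[of "Suc j"] by (simp add: p_Suc)
qed simp

lemma p_w: "p (Suc j) * w (Suc j) = 3/5 * (\<eta> (B (4*j+4)) - 1) * p j"
  using w_pos[of "Suc j"] by (simp add: p_Suc)

lemma e_h: "e j * (h j - 1) \<le> r j"
proof -
  have "e j * h j \<le> r j"
  proof (cases "j = 0")
    case False
    have "\<Lambda> j * h j = sqrt (\<Lambda> j * h j) * sqrt (\<Lambda> j * h j)"
      using \<Lambda>_ge1[of j] h_nonneg[of j] by simp
    also have "\<dots> \<le> r j * r j"
      using r_ge[of j] \<Lambda>_ge1[of j] h_nonneg[of j] by (intro mult_mono) auto
    finally have "9/25 * \<Lambda> j * h j \<le> r j * r j"
      using \<Lambda>_ge1[of j] h_nonneg[of j] mult_nonneg_nonneg[of "\<Lambda> j" "h j"] by linarith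
    then show ?thesis using False r_ge[of j] by (simp add: e_def divide_le_eq)
  qed (use r_ge[of j] in \<open>simp add: e_def\<close>)
  then show ?thesis using e_bounds(1)[of j] by (simp add: algebra_simps)
qed

text \<open>In units of \<open>p j\<close>, the fall of coordinate j from the start of gap j to
  \<open>E j\<close>.\<close>

definition side :: "nat \<Rightarrow> real"
  where "side j = 2/5 * \<theta> j 1 + 3/5 * \<theta> j 2 + 3/5 * (\<theta>3 j + 1)"

lemma side_r:
  assumes "j > 0" "i \<le> 3"
  shows "cz i * side j \<le> cx (e j) i * r j"
proof -
  have s0: "0 \<le> side j" using \<theta>_nonneg by (simp add: side_def)
  have "e j * r j = 9/25 * \<Lambda> j" using assms r_ge[of j] by (simp add: e_def)
  moreover have "3/5 * side j \<le> 9/25 * \<Lambda> j" using \<theta>_nonneg(1)[of j 1] by (simp add: side_def \<Lambda>_def)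
  ultimately have er: "3/5 * side j \<le> e j * r j" by simp
  have er2: "e j * r j \<le> 3/8 * r j" using e_bounds[of j] r_ge[of j] by (intro mult_right_mono) auto
  have er3: "3/5 * side j \<le> 3/8 * r j" using er er2 by linarith
  consider "i = 0" | "i = Suc 0" | "i = Suc (Suc 0)" | "i = Suc (Suc (Suc 0))" using assms by linarith
  then show ?thesis using er er3 s0 r_ge(2)[of j] by cases simp_all
qed

lemma B_mono: "k \<le> k' \<Longrightarrow> k' \<le> 4 * m + 4 \<Longrightarrow> B k \<le> B k'"
proof (induction k' rule: dec_induct)
  case (step n)
  then show ?case using B_Suc[of n] by simp
qed simp

lemma lab_eq:
  assumes "k < 4 * m + 4" "B k \<le> t" "t < B (Suc k)"
  shows "lab t = k"
  unfolding lab_def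
proof (rule Least_equality)
  fix k' assume "t < B (Suc k')"
  show "k \<le> k'"
  proof (rule ccontr)
    assume "\<not> k \<le> k'"
    then have "B (Suc k') \<le> B k" using assms by (intro B_mono) auto
    with \<open>t < B (Suc k')\<close> assms show False by simp
  qed
qed (use assms in simp)

lemma lab_props:
  assumes "j \<le> m" "t < B (4*j+4)"
  shows "lab t < 4*j+4" "B (lab t) \<le> t" "t < B (Suc (lab t))"
proof -
  have ex: "t < B (Suc (4*j+3))" using assms by (simp add: numeral_eq_Suc)
  then have "lab t \<le> 4*j+3" unfolding lab_def by (rule Least_le)
  then show "lab t < 4*j+4" by simp
  show "t < B (Suc (lab t))" unfolding lab_def using ex by (rule LeastI)
  show "B (lab t) \<le> t"
  proof (cases "lab t")
    case (Suc k)
    then have "k < lab t" by simp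
    then have "\<not> t < B (Suc k)" unfolding lab_def by (rule not_less_Least)
    with Suc show ?thesis by simp
  qed (use B0[of 0] in simp)
qed

lemma lab_lower:
  assumes "k \<le> 4*m+4" "B k \<le> t" "t < B (4*m+4)"
  shows "k \<le> lab t"
proof (rule ccontr)
  assume "\<not> k \<le> lab t"
  then have "B (Suc (lab t)) \<le> B k" using assms by (intro B_mono) auto
  with lab_props(3)[of m t] assms show False by simp
qed

lemma X_block:
  assumes "j \<le> m" "i \<le> 3" "B (4*j+i) \<le> t" "t \<le> t'" "t' \<le> B (4*j+i+1)"
  shows "X t = X t' + (\<Sum>s\<in>{t<..t'}. \<eta> s) *\<^sub>R vec j i"
  using assms(4,5)
proof (induction t' rule: dec_induct)
  case (step n)
  have "lab n = 4*j+i" using assms step by (intro lab_eq) auto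
  then have "X n = X (Suc n) + \<eta> (Suc n) *\<^sub>R vec j i" using assms(2) by simp
  moreover have "{t<..Suc n} = insert (Suc n) {t<..n}" using step by auto
  ultimately show ?case using step by (simp add: scaleR_add_left algebra_simps)
qed simp

lemma X_E:
  assumes j: "j \<le> m"
  shows "B (4*j+3) \<le> t \<Longrightarrow> t < B (4*j+4) \<Longrightarrow> X t = E j + ((\<Sum>s\<in>{t<..<B (4*j+4)}. \<eta> s) + 1) *\<^sub>R vec j 3"
    and "X (B (4*j+3)) = E j + (\<theta>3 j + 1) *\<^sub>R vec j 3"
    and "X (B (4*j+2)) = E j + \<theta> j 2 *\<^sub>R vec j 2 + (\<theta>3 j + 1) *\<^sub>R vec j 3"
    and "X (B (4*j+1)) = E j + \<theta> j 1 *\<^sub>R vec j 1 + \<theta> j 2 *\<^sub>R vec j 2 + (\<theta>3 j + 1) *\<^sub>R vec j 3"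
    and "X (B (4*j)) = E j + \<theta> j 0 *\<^sub>R vec j 0 + \<theta> j 1 *\<^sub>R vec j 1 + \<theta> j 2 *\<^sub>R vec j 2 + (\<theta>3 j + 1) *\<^sub>R vec j 3"
    and "X (B (4*j+4)) = E j - (\<eta> (B (4*j+4)) - 1) *\<^sub>R vec j 3"
proof -
  note last = B_last[OF j]
  have e4: "4*j+3+1 = 4*j+4" by simp
  show 3: "X t = E j + ((\<Sum>s\<in>{t<..<B (4*j+4)}. \<eta> s) + 1) *\<^sub>R vec j 3"
    if "B (4*j+3) \<le> t" "t < B (4*j+4)" for t
  proof -
    have "X t = X (B (4*j+4) - 1) + (\<Sum>s\<in>{t<..B (4*j+4) - 1}. \<eta> s) *\<^sub>R vec j 3"
      using that e4 by (intro X_block[OF j]) (auto simp: ac_simps)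
    moreover have "{t<..B (4*j+4) - 1} = {t<..<B (4*j+4)}" using last by auto
    ultimately show ?thesis by (simp add: E_def scaleR_add_left)
  qed
  show x3: "X (B (4*j+3)) = E j + (\<theta>3 j + 1) *\<^sub>R vec j 3"
    using 3[of "B (4*j+3)"] last by (simp add: \<theta>3_def)
  have step: "X (B (4*j+i)) = X (B (4*j+i+1)) + \<theta> j i *\<^sub>R vec j i" if "i < 3" for i
    using X_block[OF j, of i "B (4*j+i)" "B (4*j+i+1)"] B_Suc[of "4*j+i"] that j by (simp add: \<theta>_def)
  have i: "4*j+2+1 = 4*j+3" "4*j+1+1 = 4*j+2" "4*j+0 = 4*j" by simp_all
  show x2: "X (B (4*j+2)) = E j + \<theta> j 2 *\<^sub>R vec j 2 + (\<theta>3 j + 1) *\<^sub>R vec j 3"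
    using step[of 2, unfolded i] x3 by (simp add: algebra_simps)
  show x1: "X (B (4*j+1)) = E j + \<theta> j 1 *\<^sub>R vec j 1 + \<theta> j 2 *\<^sub>R vec j 2 + (\<theta>3 j + 1) *\<^sub>R vec j 3"
    using step[of 1, unfolded i] x2 by (simp add: algebra_simps)
  show "X (B (4*j)) = E j + \<theta> j 0 *\<^sub>R vec j 0 + \<theta> j 1 *\<^sub>R vec j 1 + \<theta> j 2 *\<^sub>R vec j 2 + (\<theta>3 j + 1) *\<^sub>R vec j 3"
    using step[of 0, unfolded i] x1 by (simp add: algebra_simps)
  let ?t = "B (4*j+4) - 1"
  have "{?t<..B (4*j+4)} = {B (4*j+4)}" using last by auto
  then show "X (B (4*j+4)) = E j - (\<eta> (B (4*j+4)) - 1) *\<^sub>R vec j 3"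
    using X_block[OF j, of 3 ?t "B (4*j+4)"] last e4 by (simp add: E_def algebra_simps)
qed

lemma coord_vec: "coord (vec j i) c = (if c = j then p j * cz i else 0) - (if c = j - 1 then p j * cx (e j) i else 0)"
  by (simp add: vec_def)

lemma inner_vec: "inner (vec j i) y = p j * (cz i * coord y j - cx (e j) i * coord y (j - 1))"
  by (simp add: vec_def inner_diff_left algebra_simps)

lemma coord_X_future:
  assumes "j \<le> m" "j < c"
  shows "t \<le> B (4*j+4) \<Longrightarrow> coord (X t) c = 0"
proof (induction t)
  case (Suc t)
  then have "lab t < 4*j+4" using assms by (intro lab_props) auto
  then have "lab t div 4 \<le> j" by auto
  then show ?case using Suc assms by (auto simp: coord_vec)
qed simp

text \<open>Coordinate c is touched only in gaps c and c + 1, and gap c + 1 ends at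
  \<open>B (4*c+8)\<close>.\<close>

lemma coord_X_past:
  assumes t: "B (4*c+8) \<le> t" "t \<le> B (4*m+4)" and c: "c < m"
  shows "coord (X t) c = coord (X (B (4*c+8))) c"
  using t
proof (induction t rule: dec_induct)
  case (step n)
  have "4*c+8 \<le> lab n" using step c by (intro lab_lower) auto
  then have "c + 2 \<le> lab n div 4" by simp
  then show ?case using step by (auto simp: coord_vec)
qed simp

lemma cz_cx_3: "cz 3 = 3/5" "cx a 3 = a" "cz 2 = 3/5" "cx a 2 = 3/8"
  by (simp_all add: numeral_3_eq_3 numeral_2_eq_2)

lemma \<theta>_0: "\<theta> 0 0 = 0" "\<theta> 0 (Suc 0) = 0" "\<theta> 0 2 = 0"
  using B0[of 0] B0[of "Suc 0"] B0[of "Suc (Suc 0)"] B0[of "Suc (Suc (Suc 0))"]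
  by (simp_all add: \<theta>_def numeral_2_eq_2)

lemma E_top:
  assumes j: "j \<le> m"
  shows "coord (E j) j = - (p j * side j)"
proof (cases j)
  case 0
  have "X (B (4*j)) = 0" using 0 B0[of 0] by simp
  then have "coord (E j + (\<theta>3 j + 1) *\<^sub>R vec j 3) j = 0"
    using X_E(5)[OF j] 0 \<theta>_0 by simp
  then have "coord (E j) j + (\<theta>3 j + 1) * (3/5) = 0"
    using 0 by (simp add: coord_vec cz_cx_3 e_def)
  then have "coord (E j) j = - ((\<theta>3 j + 1) * (3/5))" by linarith
  then show ?thesis using 0 \<theta>_0 by (simp add: side_def)
next
  case (Suc k)
  have "4*j = 4*k+4" using Suc by simp
  moreover have "coord (X (B (4*k+4))) j = 0"
    using coord_X_future[of k j "B (4*k+4)"] Suc j by simp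
  ultimately have "coord (X (B (4*j))) j = 0" by (simp only:)
  moreover have "coord (X (B (4*j))) j = coord (E j) j + p j * side j"
    unfolding X_E(5)[OF j] using Suc by (simp add: coord_vec cz_cx_3 side_def field_simps)
  ultimately show ?thesis by simp
qed

lemma E_prev:
  assumes j: "Suc j \<le> m"
  shows "coord (E (Suc j)) j = coord (E j) j - p (Suc j) * r (Suc j)"
proof -
  have i: "4 * Suc j = 4*j+4" by simp
  have "coord (X (B (4*j+4))) j = coord (E j) j - (\<eta> (B (4*j+4)) - 1) * (3/5 * p j)"
    using X_E(6)[of j] j by (cases j) (simp_all add: coord_vec cz_cx_3 e_def)
  moreover note p_w[of j]
  moreover have "coord (X (B (4*j+4))) j = coord (E (Suc j)) j - p (Suc j) * (w (Suc j) - r (Suc j))"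
    using X_E(5)[OF j, unfolded i] by (simp add: coord_vec cz_cx_3 w_def algebra_simps)
  ultimately show ?thesis by (simp add: algebra_simps)
qed

lemma E_jump:
  assumes j: "Suc j < m"
  shows "coord (X (B (4*j+8))) j = coord (E (Suc j)) j + (h (Suc j) - 1) * e (Suc j) * p (Suc j)"
proof -
  have i: "4 * Suc j + 4 = 4*j+8" by simp
  have "coord (X (B (4*j+8))) j = coord (E (Suc j) - (\<eta> (B (4*j+8)) - 1) *\<^sub>R vec (Suc j) 3) j"
    using X_E(6)[of "Suc j", unfolded i] j by simp
  then show ?thesis using j by (simp add: coord_vec cz_cx_3 h_def i algebra_simps)
qed

lemma E_future: "j \<le> m \<Longrightarrow> j < c \<Longrightarrow> coord (E j) c = 0"
  unfolding E_def using coord_X_future[of j c "B (4*j+4) - 1"] by (simp add: coord_vec)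

lemma E_past:
  assumes "j \<le> m" "Suc c < j"
  shows "coord (E j) c = coord (E (Suc c)) c + (h (Suc c) - 1) * e (Suc c) * p (Suc c)"
proof -
  have l: "B (4*c+8) \<le> B (4*j+3)" "B (4*j+4) \<le> B (4*m+4)" using assms by (auto intro!: B_mono)
  then have "coord (X (B (4*j+4) - 1)) c = coord (X (B (4*c+8))) c"
    using assms B_last[of j] by (intro coord_X_past) auto
  then show ?thesis using E_jump[of c] assms unfolding E_def[of j] by (simp add: coord_vec)
qed

section \<open>Active pieces along the trajectory\<close>

definition u :: "nat \<Rightarrow> nat \<Rightarrow> bool" where "u j i \<longleftrightarrow> B (4*j+i) < B (4*j+i+1)"

definition "nu j = gap_blocks.\<nu> (e j) (\<theta> j 1) (\<theta> j 2) (\<theta>3 j) (\<eta> (B (4*j+1))) (u j 1) (u j 2)"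
definition "VV j = gap_blocks.V (e j) (\<theta> j 1) (\<theta> j 2) (\<theta>3 j) (\<eta> (B (4*j+1))) (u j 1) (u j 2)"
definition "us j = gap_blocks.used (u j 0) (u j 1) (u j 2)"
definition "inb j = gap_blocks.in_block (\<theta> j 1) (\<theta> j 2) (\<theta>3 j) (\<eta> (B (4*j+1))) (u j 0) (u j 1) (u j 2)"

lemma gap_blocks:
  assumes j: "j \<le> m"
  shows "gap_blocks (e j) (\<theta> j 1) (\<theta> j 2) (\<theta>3 j) (\<eta> (B (4*j+1))) (u j 0) (u j 1) (u j 2)"
proof
  show "0 \<le> e j" "e j \<le> 9/25" by (rule e_bounds)+
  show "0 \<le> \<theta> j 1" "0 \<le> \<theta> j 2" "0 \<le> \<theta>3 j" by (rule \<theta>_nonneg)+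
  show "\<not> u j 1 \<Longrightarrow> \<theta> j 1 = 0" "\<not> u j 2 \<Longrightarrow> \<theta> j 2 = 0" by (simp_all add: u_def \<theta>_def)
  have i: "4*j+1+1 = 4*j+2" "4*j+2+1 = 4*j+3" by simp_all
  show "u j 1 \<Longrightarrow> u j 2" "u j 1 \<Longrightarrow> 6 * (\<theta>3 j + 1) \<le> \<theta> j 2"
    using block1[OF j] by (simp_all add: u_def i[unfolded One_nat_def] numeral_2_eq_2 numeral_3_eq_3)
  show "u j 0 \<Longrightarrow> 1 \<le> \<eta> (B (4*j+1))" using switch[OF j, of 0] by (simp add: u_def)
  show "u j 0 \<Longrightarrow> 2 + \<theta> j 1 + \<theta> j 2 + \<theta>3 j \<le> \<eta> (B (4*j+1)) \<or> (u j 1 \<and> 9 * (\<theta> j 2 + \<theta>3 j + 1) \<le> \<theta> j 1)"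
    using block0[OF j] by (auto simp: u_def \<Lambda>_def numeral_2_eq_2)
qed

lemma V_dominant:
  assumes "j \<le> m" "inb j i a0 a1 a2 a3" "us j l"
  shows "VV j l a0 a1 a2 a3 \<le> VV j i a0 a1 a2 a3" "0 \<le> VV j i a0 a1 a2 a3"
  using gap_blocks.V_dominant[OF gap_blocks[OF assms(1)]] assms(2,3)
  unfolding VV_def inb_def us_def by blast+

lemma V_eq: "j \<le> m \<Longrightarrow> VV j l a0 a1 a2 a3 =
    a0 * (cx (e j) l * cx (e j) 0 + cz l * cz 0) + a1 * (cx (e j) l * cx (e j) 1 + cz l * cz 1)
    + a2 * (cx (e j) l * cx (e j) 2 + cz l * cz 2) + a3 * (cx (e j) l * cx (e j) 3 + cz l * cz 3) + nu j l"
  unfolding VV_def nu_def gap_blocks.V_def[OF gap_blocks] gap_blocks.D_def[OF gap_blocks] ..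

lemma nu_nonpos: "j \<le> m \<Longrightarrow> us j l \<Longrightarrow> nu j l \<le> 0"
  unfolding nu_def us_def by (rule gap_blocks.\<nu>_nonpos[OF gap_blocks])

lemma nu_3: "j \<le> m \<Longrightarrow> nu j 3 = 0"
  unfolding nu_def gap_blocks.\<nu>_def[OF gap_blocks] by simp

text \<open>Normalised at \<open>E j\<close>, where piece l of gap j takes the value
  \<open>(p j)^2 * nu j l\<close>; in particular piece 3 vanishes there.\<close>

definition off :: "nat \<Rightarrow> nat \<Rightarrow> real"
  where "off j l = (p j)\<^sup>2 * nu j l - inner (vec j l) (E j)"

definition comb :: "nat \<Rightarrow> real \<Rightarrow> real \<Rightarrow> real \<Rightarrow> real \<Rightarrow> rvec"
  where "comb j a0 a1 a2 a3 = E j + a0 *\<^sub>R vec j 0 + a1 *\<^sub>R vec j 1 + a2 *\<^sub>R vec j 2 + a3 *\<^sub>R vec j 3"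

lemma us_iff: "j \<le> m \<Longrightarrow> us j l \<longleftrightarrow> (l = 0 \<and> u j 0) \<or> (l = 1 \<and> u j 1) \<or> (l = 2 \<and> u j 2) \<or> l = 3"
  unfolding us_def by (rule gap_blocks.used_def[OF gap_blocks])

lemma inb_iff: "j \<le> m \<Longrightarrow> inb j i a0 a1 a2 a3 \<longleftrightarrow> us j i \<and>
    ((i = 3 \<and> a0 = 0 \<and> a1 = 0 \<and> a2 = 0 \<and> 0 \<le> a3 \<and> a3 \<le> \<theta>3 j) \<or>
     (i = 2 \<and> a0 = 0 \<and> a1 = 0 \<and> 0 \<le> a2 \<and> a2 \<le> \<theta> j 2 \<and> a3 = \<theta>3 j + 1) \<or>
     (i = 1 \<and> a0 = 0 \<and> 0 \<le> a1 \<and> a1 \<le> \<theta> j 1 \<and> a2 = \<theta> j 2 \<and> a3 = \<theta>3 j + 1) \<or>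
     (i = 0 \<and> \<eta> (B (4*j+1)) - 1 \<le> a0 \<and> a1 = \<theta> j 1 \<and> a2 = \<theta> j 2 \<and> a3 = \<theta>3 j + 1))"
  unfolding inb_def us_def by (rule gap_blocks.in_block_def[OF gap_blocks])

lemma us_0: "us 0 l \<longleftrightarrow> l = 3"
  unfolding us_iff[OF le0] u_def
  using B0[of 0] B0[of "Suc 0"] B0[of "Suc (Suc 0)"] B0[of "Suc (Suc (Suc 0))"]
  by (simp add: numeral_2_eq_2)

lemma inb_0: "inb 0 i a0 a1 a2 a3 \<Longrightarrow> i = 3 \<and> a0 = 0 \<and> a1 = 0 \<and> a2 = 0"
  unfolding inb_iff[OF le0] us_0 by auto

lemma inb_nonneg:
  assumes "j \<le> m" "inb j i a0 a1 a2 a3"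
  shows "0 \<le> a0" "0 \<le> a1" "0 \<le> a2" "0 \<le> a3"
  using assms(2) \<theta>_nonneg(1)[of j 1] \<theta>_nonneg(1)[of j 2] \<theta>_nonneg(2)[of j] gap_blocks.s[OF gap_blocks[OF assms(1)]]
  unfolding inb_iff[OF assms(1)] us_iff[OF assms(1)] by auto

lemma value_eq: "inner (vec k l) y + off k l =
    p k * (cz l * (coord y k - coord (E k) k) - cx (e k) l * (coord y (k - 1) - coord (E k) (k - 1)))
      + (p k)\<^sup>2 * nu k l"
  by (simp add: off_def inner_vec algebra_simps)

lemma value_own:
  assumes j: "j \<le> m" and i: "inb j i a0 a1 a2 a3" and l: "us j l"
  shows "inner (vec j l) (comb j a0 a1 a2 a3) + off j l = (p j)\<^sup>2 * VV j l a0 a1 a2 a3"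
proof -
  note V = V_eq[OF j]
  show ?thesis
  proof (cases j)
    case 0
    then have z: "l = 3" "a0 = 0" "a1 = 0" "a2 = 0" using l us_0 inb_0[of i] i by auto
    show ?thesis
      unfolding value_eq V comb_def z using 0
      by (simp add: coord_vec cz_cx_3 e_def power2_eq_square algebra_simps)
  next
    case (Suc k)
    show ?thesis
      unfolding value_eq V comb_def using Suc
      by (simp add: coord_vec cz_cx_3 power2_eq_square algebra_simps)
  qed
qed

lemma comb_coords:
  assumes j: "j \<le> m" and i: "inb j i a0 a1 a2 a3"
  shows "coord (comb j a0 a1 a2 a3) j \<ge> coord (E j) j"
    and "j > 0 \<Longrightarrow> coord (comb j a0 a1 a2 a3) (j - 1) \<le> coord (E j) (j - 1)"
    and "c < j - 1 \<or> c > j \<Longrightarrow> coord (comb j a0 a1 a2 a3) c = coord (E j) c"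
proof -
  note a = inb_nonneg[OF j i] and p = p_pos[OF j]
  show "coord (comb j a0 a1 a2 a3) j \<ge> coord (E j) j"
    using a p inb_0[of i a0 a1 a2 a3] i by (cases j) (auto simp: comb_def coord_vec cz_cx_3 e_def)
  show "coord (comb j a0 a1 a2 a3) (j - 1) \<le> coord (E j) (j - 1)" if "j > 0"
  proof -
    have "0 \<le> a0 * p j + a1 * (p j * 3/4) + a2 * (p j * 3/8) + a3 * (p j * e j)"
      using a p e_bounds(1)[of j] by (intro add_nonneg_nonneg mult_nonneg_nonneg) auto
    moreover have "coord (comb j a0 a1 a2 a3) (j - 1) = coord (E j) (j - 1) -
        (a0 * p j + a1 * (p j * 3/4) + a2 * (p j * 3/8) + a3 * (p j * e j))"
      using that by (cases j) (simp_all add: comb_def coord_vec cz_cx_3)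
    ultimately show ?thesis by simp
  qed
  show "coord (comb j a0 a1 a2 a3) c = coord (E j) c" if "c < j - 1 \<or> c > j"
    using that by (auto simp: comb_def coord_vec)
qed

lemma cx_nonneg: "0 \<le> cx (e k) l" and cz_nonneg: "0 \<le> cz l"
  using e_bounds(1)[of k] by (cases "(e k, l)" rule: cx.cases; simp)+

lemma side_nonneg: "0 \<le> side j"
  using \<theta>_nonneg by (simp add: side_def)

text \<open>Before gap k, coordinate k lies \<open>p k * side k\<close> above its value at
  \<open>E k\<close>, which raises the piece, but coordinate k - 1 lies above by at least the
  reserve \<open>p k * r k\<close>; \<open>side_r\<close> balances the two. After gap k, coordinate
  k is at or below and coordinate k - 1 at or above its value at \<open>E k\<close>; the rise of
  coordinate k by the long step closing gap k + 1 is covered by \<open>e_h\<close>.\<close>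

lemma value_other:
  assumes j: "j \<le> m" and i: "inb j i a0 a1 a2 a3" and k: "k \<le> m" "us k l" "k \<noteq> j"
  shows "inner (vec k l) (comb j a0 a1 a2 a3) + off k l \<le> 0"
proof -
  let ?y = "comb j a0 a1 a2 a3"
  note p = p_pos[OF k(1)]
  have nu: "nu k l \<le> 0" using nu_nonpos[OF k(1,2)] .
  have l: "l \<le> 3" using k(2) unfolding us_iff[OF k(1)] by auto
  have "cz l * (coord ?y k - coord (E k) k) - cx (e k) l * (coord ?y (k - 1) - coord (E k) (k - 1)) \<le> 0"
  proof (cases "j < k")
    case True
    then obtain k' where k': "k = Suc k'" "j \<le> k'" "k' \<le> m" using k(1) by (cases k) auto
    have y0: "coord ?y k = 0" using comb_coords(3)[OF j i, of k] E_future[OF j True] True by simp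
    have y1: "coord ?y k' \<ge> coord (E k') k'"
    proof (cases "k' = j")
      case False
      then have "coord ?y k' = 0" using comb_coords(3)[OF j i, of k'] E_future[OF j, of k'] k' by simp
      then show ?thesis using E_top[OF k'(3)] p_pos[OF k'(3)] side_nonneg[of k'] by simp
    qed (use comb_coords(1)[OF j i] in simp)
    have "coord ?y k - coord (E k) k = p k * side k"
      using y0 E_top[OF k(1)] by simp
    moreover have "coord ?y (k - 1) - coord (E k) (k - 1) \<ge> p k * r k"
      using y1 E_prev[of k'] k' k(1) by simp
    then have "cx (e k) l * (coord ?y (k - 1) - coord (E k) (k - 1)) \<ge> cx (e k) l * (p k * r k)"
      by (intro mult_left_mono cx_nonneg)
    moreover have "p k * (cz l * side k) \<le> p k * (cx (e k) l * r k)"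
      using side_r[of k l] l True p by (intro mult_left_mono) auto
    ultimately show ?thesis by (simp add: algebra_simps)
  next
    case False
    then have kj: "k < j" using k by simp
    have y0: "coord ?y k \<le> coord (E k) k"
    proof (cases "Suc k = j")
      case True
      then have "coord ?y k \<le> coord (E j) k" using comb_coords(2)[OF j i] by auto
      also have "\<dots> \<le> coord (E k) k"
        using E_prev[of k] True j p_pos[OF j] r_ge(2)[of j] by simp
      finally show ?thesis .
    next
      case False
      then have sk: "Suc k < j" using kj by simp
      then have "coord ?y k = coord (E j) k" using comb_coords(3)[OF j i, of k] by simp
      also have "\<dots> = coord (E k) k - p (Suc k) * r (Suc k) + (h (Suc k) - 1) * e (Suc k) * p (Suc k)"
        using E_past[OF j sk] E_prev[of k] sk j by simp
      also have "\<dots> \<le> coord (E k) k"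
        using mult_right_mono[OF e_h[of "Suc k"], of "p (Suc k)"] p_pos[of "Suc k"] sk j
        by (simp add: algebra_simps)
      finally show ?thesis .
    qed
    have y1: "coord ?y (k - 1) \<ge> coord (E k) (k - 1)" if k0: "k > 0"
    proof -
      obtain c where c: "k = Suc c" using k0 by (cases k) auto
      have "coord ?y c = coord (E j) c" using comb_coords(3)[OF j i, of c] kj c by simp
      also have "\<dots> = coord (E k) c + (h k - 1) * e k * p k"
        using E_past[OF j, of c] c kj by simp
      also have "\<dots> \<ge> coord (E k) c"
        using jump[of k] kj j e_bounds(1)[of k] p by (simp add: h_def)
      finally show ?thesis using c by simp
    qed
    have "cz l * (coord ?y k - coord (E k) k) \<le> 0"
      using y0 cz_nonneg[of l] by (simp add: mult_nonneg_nonpos)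
    moreover have "0 \<le> cx (e k) l * (coord ?y (k - 1) - coord (E k) (k - 1))"
    proof (cases "k = 0")
      case True
      then have "cx (e k) l = 0" using k(2) us_0 by (simp add: cz_cx_3 e_def)
      then show ?thesis by simp
    qed (use y1 cx_nonneg in auto)
    ultimately show ?thesis by simp
  qed
  then have "p k * (cz l * (coord ?y k - coord (E k) k) - cx (e k) l * (coord ?y (k - 1) - coord (E k) (k - 1))) \<le> 0"
    using p by (simp add: mult_nonneg_nonpos)
  moreover have "(p k)\<^sup>2 * nu k l \<le> 0" using nu by (simp add: mult_nonneg_nonpos)
  ultimately show ?thesis unfolding value_eq by simp
qed

lemma sum_split:
  assumes "t < b" "b = Suc b'"
  shows "\<eta> b \<le> (\<Sum>s\<in>{t<..b}. \<eta> s)"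
  using assms \<eta>_pos by (intro member_le_sum) (auto intro: less_imp_le)

text \<open>Blocks 0 to 2 end with a step of at least 1, so the unit by which the proximal point
  runs ahead stays inside the block. In block 3 it cancels the extra 1 measured from
  \<open>E j\<close>.\<close>

lemma prox_point:
  assumes t: "t < B (4*m+4)"
  obtains j i a0 a1 a2 a3 where "j \<le> m" "lab t = 4*j+i" "i \<le> 3" "inb j i a0 a1 a2 a3"
    "X t - vec j i = comb j a0 a1 a2 a3"
proof -
  define j i where "j = lab t div 4" and "i = lab t mod 4"
  have lab: "lab t = 4*j+i" "i \<le> 3" by (auto simp: j_def i_def)
  note L = lab_props[OF order_refl t]
  have j: "j \<le> m" using L(1) lab by linarith
  note bt = L(2,3)[unfolded lab]
  define \<rho> where "\<rho> = (\<Sum>s\<in>{t<..B (4*j+i+1)}. \<eta> s)"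
  have i3: "4*j+3+1 = 4*j+4" "4*j+2+1 = 4*j+3" "4*j+1+1 = 4*j+2" "4*j+0+1=4*j+1" "4*j+0=4*j" by simp_all
  have \<rho>: "\<eta> (B (4*j+i+1)) \<le> \<rho>" "\<rho> \<le> \<theta> j i" if "i < 3"
  proof -
    show "\<eta> (B (4*j+i+1)) \<le> \<rho>"
      unfolding \<rho>_def using bt by (intro sum_split[of _ _ "B (4*j+i+1) - 1"]) auto
    show "\<rho> \<le> \<theta> j i"
      unfolding \<rho>_def \<theta>_def using bt \<eta>_pos by (intro sum_mono2) (auto intro: less_imp_le)
  qed
  have sw: "1 \<le> \<eta> (B (4*j+i+1))" if "i < 3" using switch[OF j that] bt by simp
  have X: "X t = X (B (4*j+i+1)) + \<rho> *\<^sub>R vec j i"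
    unfolding \<rho>_def using bt by (intro X_block[OF j lab(2)]) auto
  have us: "us j i"
    unfolding us_iff[OF j] u_def using bt lab(2) by (auto simp: le_Suc_eq numeral_2_eq_2 numeral_3_eq_3)
  consider "i = 3" | "i = 2" | "i = 1" | "i = 0" using lab(2) by linarith
  then show ?thesis
  proof cases
    case 1
    have e4: "B (Suc (4*j+3)) = B (4*j+4)" by (rule arg_cong[of _ _ B]) simp
    let ?\<rho> = "\<Sum>s\<in>{t<..<B (4*j+4)}. \<eta> s"
    have "X t = E j + (?\<rho> + 1) *\<^sub>R vec j 3"
      using bt e4 unfolding 1 by (intro X_E(1)[OF j]) simp_all
    then have "X t - vec j i = comb j 0 0 0 ?\<rho>" using 1 by (simp add: comb_def scaleR_add_left)
    moreover have "0 \<le> ?\<rho>" using \<eta>_pos by (intro sum_nonneg) (auto intro: less_imp_le)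
    moreover have "?\<rho> \<le> \<theta>3 j"
      unfolding \<theta>3_def using bt 1 \<eta>_pos by (intro sum_mono2) (auto intro: less_imp_le)
    ultimately show ?thesis using that[OF j lab] 1 us unfolding inb_iff[OF j] by simp
  next
    case 2
    have "X t - vec j i = comb j 0 0 (\<rho> - 1) (\<theta>3 j + 1)"
      using X X_E(2)[OF j] unfolding 2 i3 by (simp add: comb_def algebra_simps)
    then show ?thesis using that[OF j lab, of 0 0 "\<rho> - 1" "\<theta>3 j + 1"] 2 us \<rho> sw unfolding inb_iff[OF j] by simp
  next
    case 3
    have "X t - vec j i = comb j 0 (\<rho> - 1) (\<theta> j 2) (\<theta>3 j + 1)"
      using X X_E(3)[OF j] unfolding 3 i3 by (simp add: comb_def algebra_simps)
    then show ?thesis using that[OF j lab, of 0 "\<rho> - 1" "\<theta> j 2" "\<theta>3 j + 1"] 3 us \<rho> sw unfolding inb_iff[OF j] by simp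
  next
    case 4
    have "X t - vec j i = comb j (\<rho> - 1) (\<theta> j 1) (\<theta> j 2) (\<theta>3 j + 1)"
      using X X_E(4)[OF j] unfolding 4 i3 by (simp add: comb_def algebra_simps)
    then show ?thesis using that[OF j lab, of "\<rho> - 1" "\<theta> j 1" "\<theta> j 2" "\<theta>3 j + 1"] 4 us \<rho> sw unfolding inb_iff[OF j] by simp
  qed
qed

definition pieces :: "(rvec \<times> real) set"
  where "pieces = insert (0, 0) ((\<lambda>(j, l). (vec j l, off j l)) ` {(j, l). j \<le> m \<and> us j l})"

lemma dominant:
  assumes j: "j \<le> m" and i: "inb j i a0 a1 a2 a3" and q: "q \<in> pieces"
  shows "inner (fst q) (comb j a0 a1 a2 a3) + snd q \<le> inner (vec j i) (comb j a0 a1 a2 a3) + off j i"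
proof -
  have usi: "us j i" using i unfolding inb_iff[OF j] by simp
  have own: "inner (vec j i) (comb j a0 a1 a2 a3) + off j i = (p j)\<^sup>2 * VV j i a0 a1 a2 a3"
    by (rule value_own[OF j i usi])
  have nn: "0 \<le> (p j)\<^sup>2 * VV j i a0 a1 a2 a3"
    using V_dominant(2)[OF j i usi] by simp
  from q consider "q = (0, 0)" | k l where "q = (vec k l, off k l)" "k \<le> m" "us k l"
    by (auto simp: pieces_def)
  then show ?thesis
  proof cases
    case 1
    then show ?thesis using own nn by simp
  next
    case 2
    show ?thesis
    proof (cases "k = j")
      case True
      then have "us j l" using 2 by simp
      then show ?thesis
        using 2 True value_own[OF j i] V_dominant(1)[OF j i] own by (simp add: mult_left_mono)
    next
      case False
      then show ?thesis using value_other[OF j i 2(2,3)] 2(1) own nn by simp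
    qed
  qed
qed

lemma norm_vec_3: "(3/5 * p j)\<^sup>2 \<le> (norm (vec j 3))\<^sup>2"
  unfolding power2_norm_eq_inner inner_vec
  using e_bounds(1)[of j]
  by (cases j) (simp_all add: coord_vec cz_cx_3 power2_eq_square algebra_simps, simp add: e_def)

text \<open>\<open>E 0\<close> is a minimiser, because piece 3 of gap 0 is active there with value
  0; its distance from the start is 3/5 * (\<open>\<theta>3 0\<close> + 1). The last iterate is
  \<open>E m + vec m 3\<close>, and its piece vanishes at \<open>E m\<close>, so the value is half
  the squared norm of the slope.\<close>

lemma worst_rate_chain:
  "ereal ((p m / ((\<Sum>s\<in>{0<..<B 4}. \<eta> s) + 1))\<^sup>2 / 2) \<le> worst_rate (B (4*m+4) - 1) \<eta>"
proof -
  let ?n = "B (4*m+4) - 1"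
  define G where "G t = (vec (lab t div 4) (lab t mod 4), off (lab t div 4) (lab t mod 4))" for t
  have n: "?n < B (4*m+4)" using B_last[of m] by simp
  have B4: "0 < B 4" using B_last[of 0] by simp
  have B4n: "B 4 \<le> B (4*m+4)" by (intro B_mono) auto
  have fin: "finite pieces"
  proof -
    have "{(j, l). j \<le> m \<and> us j l} \<subseteq> {..m} \<times> {..3}"
      using us_iff by auto
    then have "finite {(j, l). j \<le> m \<and> us j l}" by (rule finite_subset) auto
    then show ?thesis by (simp add: pieces_def)
  qed
  have sub: "pieces \<subseteq> \<R> (m + 1) \<times> UNIV"
    by (auto simp: pieces_def Rd_def coord_vec)
  have in0: "inb 0 3 0 0 0 0"
    unfolding inb_iff[OF le0] us_0 using \<theta>_nonneg by simp
  have comb0: "comb 0 0 0 0 0 = E 0" by (simp add: comb_def)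
  have us3: "us j 3" if "j \<le> m" for j unfolding us_iff[OF that] by simp
  have v0: "inner (vec j 3) (E j) + off j 3 = 0" if j: "j \<le> m" for j
    using nu_3[OF j] by (simp add: off_def)
  have xs: "inner (fst q) (E 0) + snd q \<le> 0" if "q \<in> pieces" for q
    using dominant[OF _ in0 that] v0[of 0] comb0 by simp
  have E0: "E 0 = - ((\<theta>3 0 + 1) * (3/5)) *\<^sub>R unit_vec 0"
  proof -
    have "E 0 + (\<theta>3 0 + 1) *\<^sub>R vec 0 3 = 0"
      using X_E(2)[of 0] B0[of 3] by simp
    then have "E 0 = - ((\<theta>3 0 + 1) *\<^sub>R vec 0 3)" by (simp add: eq_neg_iff_add_eq_0)
    then show ?thesis by (simp add: vec_def cz_cx_3 e_def)
  qed
  have wr: "ereal (hull_val (X ?n) (G ?n) / (norm (X 0 - E 0))\<^sup>2) \<le> worst_rate ?n \<eta>"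
  proof (rule worst_rate_ge_env[of "m + 1" pieces])
    show "1 \<le> m + 1" "finite pieces" "pieces \<subseteq> \<R> (m + 1) \<times> UNIV" by (simp, rule fin, rule sub)
    show "(0, 0) \<in> pieces" by (simp add: pieces_def)
    show "E 0 \<in> \<R> (m + 1)" unfolding E0 by (simp add: Rd_def)
    show "inner (fst q) (E 0) + snd q \<le> 0" if "q \<in> pieces" for q by (rule xs[OF that])
    show "X 0 \<in> \<R> (m + 1)" by (simp add: Rd_def)
    show "X (Suc t) = X t - \<eta> (Suc t) *\<^sub>R fst (G t)" if "t < ?n" for t by (simp add: G_def)
    have "lab 0 = 3" using B0[of 3] B4 by (intro lab_eq) (auto simp: numeral_eq_Suc)
    then have "coord (fst (G 0)) 0 = 3/5" by (simp add: G_def coord_vec cz_cx_3 e_def)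
    then show "fst (G 0) \<noteq> 0" by auto
    fix t assume "t \<le> ?n"
    then have t: "t < B (4*m+4)" using n by simp
    from prox_point[OF t] obtain j i a0 a1 a2 a3 where pp: "j \<le> m" "lab t = 4*j+i" "i \<le> 3"
      "inb j i a0 a1 a2 a3" "X t - vec j i = comb j a0 a1 a2 a3" .
    have ji: "lab t div 4 = j" "lab t mod 4 = i" using pp(2,3) by auto
    have "us j i" using pp(4) unfolding inb_iff[OF pp(1)] by simp
    then show "G t \<in> pieces" using pp(1) by (auto simp: G_def ji pieces_def)
    show "inner (fst q) (X t - fst (G t)) + snd q \<le> inner (fst (G t)) (X t - fst (G t)) + snd (G t)"
      if "q \<in> pieces" for q
      using dominant[OF pp(1,4) that] pp(5) by (simp add: G_def ji)
  qed
  have "lab ?n = 4*m+3"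
    using B_last[of m] by (intro lab_eq) (auto simp: numeral_eq_Suc)
  then have Gn: "G ?n = (vec m 3, off m 3)" by (simp add: G_def)
  have "X ?n = E m + vec m 3" by (simp add: E_def)
  then have hv: "hull_val (X ?n) (G ?n) = (norm (vec m 3))\<^sup>2 / 2"
    unfolding Gn hull_val_def using v0[of m] by (simp add: inner_add_right power2_norm_eq_inner)
  have nrm: "(norm (X 0 - E 0))\<^sup>2 = ((\<theta>3 0 + 1) * (3/5))\<^sup>2"
    unfolding E0 power2_norm_eq_inner by (simp add: power2_eq_square)
  have th: "(\<Sum>s\<in>{0<..<B 4}. \<eta> s) + 1 = \<theta>3 0 + 1"
    using B0[of 3] by (simp add: \<theta>3_def)
  have id: "(p m / (\<theta>3 0 + 1))\<^sup>2 / 2 = ((3/5 * p m)\<^sup>2 / 2) / ((\<theta>3 0 + 1) * (3/5))\<^sup>2"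
  proof -
    have "(q / a)\<^sup>2 / 2 = ((3/5 * q)\<^sup>2 / 2) / (a * (3/5))\<^sup>2" for a q :: real
      by (simp add: power_mult_distrib power_divide)
    then show ?thesis .
  qed
  have ineq: "((3/5 * p m)\<^sup>2 / 2) / ((\<theta>3 0 + 1) * (3/5))\<^sup>2
      \<le> ((norm (vec m 3))\<^sup>2 / 2) / ((\<theta>3 0 + 1) * (3/5))\<^sup>2"
    using norm_vec_3[of m] by (intro divide_right_mono) auto
  have "(p m / ((\<Sum>s\<in>{0<..<B 4}. \<eta> s) + 1))\<^sup>2 / 2 \<le> hull_val (X ?n) (G ?n) / (norm (X 0 - E 0))\<^sup>2"
    unfolding th hv nrm id by (rule ineq)
  then have "ereal ((p m / ((\<Sum>s\<in>{0<..<B 4}. \<eta> s) + 1))\<^sup>2 / 2)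
      \<le> ereal (hull_val (X ?n) (G ?n) / (norm (X 0 - E 0))\<^sup>2)"
    by (simp only: ereal_less_eq)
  also note wr
  finally show ?thesis .
qed

section \<open>The chain bound in terms of the step sizes\<close>

lemma sum_gap:
  assumes j: "j \<le> m"
  shows "(\<Sum>s\<in>{B (4*j)<..<B (4*j+4)}. \<eta> s) = \<theta> j 0 + \<theta> j 1 + \<theta> j 2 + \<theta>3 j"
proof -
  have b: "B (4*j) \<le> B (4*j+1)" "B (4*j+1) \<le> B (4*j+2)" "B (4*j+2) \<le> B (4*j+3)" "B (4*j+3) < B (4*j+4)"
    using j B_last[OF j] by (auto intro!: B_mono)
  have i: "4*j+2+1 = 4*j+3" "4*j+1+1 = 4*j+2" "4*j+0 = 4*j" by simp_all
  have split: "(\<Sum>s\<in>{a<..<c}. \<eta> s) = (\<Sum>s\<in>{a<..b}. \<eta> s) + (\<Sum>s\<in>{b<..<c}. \<eta> s)"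
    if "a \<le> b" "b < c" for a b c
  proof -
    have "{a<..<c} = {a<..b} \<union> {b<..<c}" "{a<..b} \<inter> {b<..<c} = {}" using that by auto
    then show ?thesis by (simp add: sum.union_disjoint)
  qed
  show ?thesis
    using split[of "B (4*j)" "B (4*j+1)" "B (4*j+4)"] split[of "B (4*j+1)" "B (4*j+2)" "B (4*j+4)"]
      split[of "B (4*j+2)" "B (4*j+3)" "B (4*j+4)"] b
    unfolding \<theta>_def \<theta>3_def i by linarith
qed

lemma w_le:
  assumes j: "j \<le> m"
  shows "w j \<le> (\<Sum>s\<in>{B (4*j)<..<B (4*j+4)}. \<eta> s) + 2 * \<Lambda> j + sqrt (\<Lambda> j * h j)"
proof -
  have "e j * (\<theta>3 j + 1) \<le> 1 * (\<theta>3 j + 1)"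
    using e_bounds[of j] \<theta>_nonneg(2)[of j] by (intro mult_right_mono) auto
  then show ?thesis
    unfolding sum_gap[OF j] w_def r_def using \<theta>_nonneg(1)[of j 1] \<theta>_nonneg(1)[of j 2] \<Lambda>_ge1[of j] by simp
qed

lemma p_ge:
  assumes W: "\<And>j. j < m \<Longrightarrow> w (Suc j) \<le> W j"
  shows "n \<le> m \<Longrightarrow> (\<Prod>j<n. 3/5 * (\<eta> (B (4*j+4)) - 1) / W j) \<le> p n"
proof (induction n)
  case (Suc n)
  then have n: "n < m" by simp
  have "(\<Prod>j<Suc n. 3/5 * (\<eta> (B (4*j+4)) - 1) / W j)
      = (\<Prod>j<n. 3/5 * (\<eta> (B (4*j+4)) - 1) / W j) * (3/5 * (\<eta> (B (4*n+4)) - 1) / W n)" by simp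
  also have "\<dots> \<le> p n * (3/5 * (\<eta> (B (4*n+4)) - 1) / w (Suc n))"
    using Suc n W[OF n] w_pos[of "Suc n"] jump[OF n] p_pos[of n]
    by (intro mult_mono divide_left_mono divide_nonneg_nonneg mult_pos_pos) auto
  also have "\<dots> = p (Suc n)" by (simp add: p_Suc)
  finally show ?case .
qed simp

lemma worst_rate_chain_ge:
  assumes L: "\<And>j. j < m \<Longrightarrow> \<Lambda> (Suc j) \<le> L j"
    and W: "\<And>j. j < m \<Longrightarrow> (\<Sum>s\<in>{B (4*j+4)<..<B (4*j+8)}. \<eta> s) + 2 * L j
        + sqrt (L j * (if Suc j < m then \<eta> (B (4*j+8)) else 0)) \<le> W j"
  shows "ereal (((\<Prod>j<m. 3/5 * (\<eta> (B (4*j+4)) - 1) / W j) / ((\<Sum>s\<in>{0<..<B 4}. \<eta> s) + 1))\<^sup>2 / 2)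
      \<le> worst_rate (B (4*m+4) - 1) \<eta>"
proof -
  have wW: "w (Suc j) \<le> W j" if j: "j < m" for j
  proof -
    have i: "4 * Suc j = 4*j+4" "4*j+4+4 = 4*j+8" by simp_all
    have hS: "h (Suc j) = (if Suc j < m then \<eta> (B (4*j+8)) else 0)" unfolding h_def i ..
    have "sqrt (\<Lambda> (Suc j) * h (Suc j)) \<le> sqrt (L j * h (Suc j))"
      using L[OF j] h_nonneg[of "Suc j"] by (intro real_sqrt_le_mono mult_right_mono)
    moreover have "w (Suc j) \<le> (\<Sum>s\<in>{B (4*j+4)<..<B (4*j+8)}. \<eta> s) + 2 * \<Lambda> (Suc j) + sqrt (\<Lambda> (Suc j) * h (Suc j))"
      using w_le[of "Suc j", unfolded i] j by (simp only: Suc_le_eq)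
    ultimately show ?thesis using L[OF j] W[OF j, folded hS] by linarith
  qed
  have nn: "0 \<le> (\<Prod>j<m. 3/5 * (\<eta> (B (4*j+4)) - 1) / W j)"
  proof (intro prod_nonneg ballI)
    fix j assume "j \<in> {..<m}"
    then show "0 \<le> 3/5 * (\<eta> (B (4*j+4)) - 1) / W j"
      using jump[of j] wW[of j] w_pos[of "Suc j"] by auto
  qed
  have "0 \<le> (\<Sum>s\<in>{0<..<B 4}. \<eta> s)" by (auto intro!: sum_nonneg less_imp_le[OF \<eta>_pos])
  then have "((\<Prod>j<m. 3/5 * (\<eta> (B (4*j+4)) - 1) / W j) / ((\<Sum>s\<in>{0<..<B 4}. \<eta> s) + 1))\<^sup>2 / 2
      \<le> (p m / ((\<Sum>s\<in>{0<..<B 4}. \<eta> s) + 1))\<^sup>2 / 2"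
    using p_ge[OF wW, of m] nn
    by (intro divide_right_mono power_mono divide_nonneg_nonneg) auto
  then have "ereal (((\<Prod>j<m. 3/5 * (\<eta> (B (4*j+4)) - 1) / W j) / ((\<Sum>s\<in>{0<..<B 4}. \<eta> s) + 1))\<^sup>2 / 2)
      \<le> ereal ((p m / ((\<Sum>s\<in>{0<..<B 4}. \<eta> s) + 1))\<^sup>2 / 2)"
    by (simp only: ereal_less_eq)
  also note worst_rate_chain
  finally show ?thesis .
qed

end

section \<open>Averaging over thresholds\<close>

text \<open>Used with w of order sqrt (l / H) and v = sqrt (h' / H), this splits the mixed term sqrt
  (l * h') into a part linear in l and a small multiple of v. For small w, ln (1 + x) \<le> x is
  enough; otherwise ln v \<le> \<epsilon> * v + const, and the square of w absorbs the rest.\<close>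

lemma ln_one_plus_mult_le:
  fixes \<epsilon> :: real
  assumes "0 < \<epsilon>" "\<epsilon> \<le> 1"
  shows "\<exists>A\<ge>0. \<forall>w\<ge>0. \<forall>v\<ge>1. ln (1 + w * v) \<le> A * w\<^sup>2 + \<epsilon> * v"
proof -
  define A where "A = 1 / \<epsilon> + ln (1 / \<epsilon>) / \<epsilon>\<^sup>2"
  have l: "0 \<le> ln (1 / \<epsilon>)" using assms by simp
  then have A: "A \<ge> 0" using assms by (simp add: A_def)
  have "ln (1 + w * v) \<le> A * w\<^sup>2 + \<epsilon> * v" if w: "0 \<le> w" and v: "1 \<le> v" for w v
  proof (cases "w \<le> \<epsilon>")
    case True
    have "ln (1 + w * v) \<le> w * v" using w v by (intro ln_add_one_self_le_self) auto
    also have "\<dots> \<le> \<epsilon> * v" using True v by (intro mult_right_mono) auto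
    also have "\<dots> \<le> A * w\<^sup>2 + \<epsilon> * v" using A by simp
    finally show ?thesis .
  next
    case False
    have "ln (1 + w * v) \<le> ln ((1 + w) * v)"
      using w v by (subst ln_le_cancel_iff) (auto simp: algebra_simps intro!: add_pos_nonneg)
    also have "\<dots> = ln (1 + w) + ln v" using w v by (simp add: ln_mult)
    also have "\<dots> \<le> w + ln v" using ln_add_one_self_le_self[OF w] by simp
    also have "ln v = ln (\<epsilon> * v) + ln (1 / \<epsilon>)"
      using assms v by (simp add: ln_mult ln_div)
    also have "ln (\<epsilon> * v) \<le> \<epsilon> * v - 1" using assms v by (intro ln_le_minus_one) auto
    finally have 1: "ln (1 + w * v) \<le> w + \<epsilon> * v + ln (1 / \<epsilon>)" by simp
    have "w * \<epsilon> \<le> w * w" using False w by (intro mult_left_mono) auto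
    then have 2: "w \<le> 1 / \<epsilon> * w\<^sup>2" using assms by (simp add: field_simps power2_eq_square)
    have "\<epsilon>\<^sup>2 \<le> w\<^sup>2" using False assms by (intro power_mono) auto
    then have "1 \<le> w\<^sup>2 / \<epsilon>\<^sup>2" using assms by (simp add: field_simps)
    then have "ln (1 / \<epsilon>) \<le> ln (1 / \<epsilon>) * (w\<^sup>2 / \<epsilon>\<^sup>2)" using l by (metis mult_left_mono mult.right_neutral)
    then have 3: "ln (1 / \<epsilon>) \<le> ln (1 / \<epsilon>) / \<epsilon>\<^sup>2 * w\<^sup>2" by simp
    show ?thesis using 1 2 3 by (simp add: A_def algebra_simps)
  qed
  with A show ?thesis by blast
qed

text \<open>The contribution of a step \<open>x\<close> to the logarithm of the jump bound when all steps above the threshold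
  \<open>H\<close> are used as jumps: the others only lengthen the gaps. The weight \<open>H powr (-3/10)\<close> below turns it into
  a multiple of \<open>x\<close>, up to lower order.\<close>

definition kernel :: "real \<Rightarrow> real \<Rightarrow> real"
  where "kernel x H = (if H \<le> x then ln (x / H) - 19/50 - sqrt (x / H) / 400 else - (3/7) * (x / H))"

lemma integral_above:
  fixes a x :: real
  assumes H: "0 < a" "a \<le> x"
  shows "((\<lambda>H. H powr (-3/10) * (ln (x / H) - 19/50 - sqrt (x / H) / 400)) has_integral
      x powr (7/10) * (100/49 - 19/35 - 1/80) -
      (a powr (7/10) * ((ln (x / a) - 19/50) * (10/7) + 100/49) - x powr (1/2) * a powr (1/5) / 80)) {a..x}"
proof -
  define F where "F H = H powr (7/10) * ((ln (x / H) - 19/50) * (10/7) + 100/49) - x powr (1/2) * H powr (1/5) / 80" for H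
  have "((\<lambda>H. H powr (-3/10) * (ln (x / H) - 19/50 - sqrt (x / H) / 400)) has_integral (F x - F a)) {a..x}"
  proof (rule fundamental_theorem_of_calculus[OF H(2)])
    fix t assume t: "t \<in> {a..x}"
    then have t0: "0 < t" "0 < x" using H by auto
    have p: "t powr (7/10) = t powr (-3/10) * t" using t0 powr_add[of t "-3/10" 1] by simp
    have q: "sqrt (x / t) * t powr (-3/10) = x powr (1/2) * t powr (-4/5)"
    proof -
      have "sqrt (x / t) = x powr (1/2) * t powr (-1/2)"
        using t0 by (simp add: powr_half_sqrt[symmetric] powr_divide powr_minus_divide)
      then show ?thesis using powr_add[of t "-1/2" "-3/10"] by simp
    qed
    have D: "(F has_real_derivative
        (7/10 * t powr (7/10 - 1)) * ((ln (x / t) - 19/50) * (10/7) + 100/49)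
        + t powr (7/10) * (- 1 / t * (10/7)) - x powr (1/2) * (1/5 * t powr (1/5 - 1)) / 80) (at t)"
      unfolding F_def using t0
      by (auto intro!: derivative_eq_intros simp: field_simps)
    define u where "u = t powr (-3/10)"
    define r where "r = x powr (1/2) * t powr (-4/5)"
    have e: "t powr (7/10 - 1) = u" "t powr (7/10) = u * t" "sqrt (x / t) * u = r"
      using p q by (simp_all add: u_def r_def)
    have r': "x powr (1/2) * (1/5 * t powr (1/5 - 1)) / 80 = r / 400" by (simp add: r_def)
    have "(7/10 * t powr (7/10 - 1)) * ((ln (x / t) - 19/50) * (10/7) + 100/49)
        + t powr (7/10) * (- 1 / t * (10/7)) - x powr (1/2) * (1/5 * t powr (1/5 - 1)) / 80
        = u * (ln (x / t) - 19/50) - sqrt (x / t) * u / 400"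
      using t0 unfolding e r' by (simp add: algebra_simps)
    then have eq: "(7/10 * t powr (7/10 - 1)) * ((ln (x / t) - 19/50) * (10/7) + 100/49)
        + t powr (7/10) * (- 1 / t * (10/7)) - x powr (1/2) * (1/5 * t powr (1/5 - 1)) / 80
        = u * (ln (x / t) - 19/50 - sqrt (x / t) / 400)"
      by (simp add: algebra_simps)
    have "(F has_real_derivative t powr (-3/10) * (ln (x / t) - 19/50 - sqrt (x / t) / 400)) (at t)"
      using D unfolding eq u_def .
    then show "(F has_vector_derivative t powr (-3/10) * (ln (x / t) - 19/50 - sqrt (x / t) / 400)) (at t within {a..x})"
      by (metis has_real_derivative_iff_has_vector_derivative has_vector_derivative_at_within)
  qed
  moreover have "F x = x powr (7/10) * (100/49 - 19/35 - 1/80)"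
  proof -
    have "x powr (1/2) * x powr (1/5) = x powr (7/10)" using powr_add[of x "1/2" "1/5"] by simp
    then show ?thesis using H by (simp add: F_def algebra_simps)
  qed
  moreover have "F a = a powr (7/10) * ((ln (x / a) - 19/50) * (10/7) + 100/49) - x powr (1/2) * a powr (1/5) / 80"
    by (simp only: F_def)
  ultimately show ?thesis by (simp only:)
qed

lemma integral_below:
  fixes a b x :: real
  assumes H: "0 < a" "a \<le> b"
  shows "((\<lambda>H. H powr (-3/10) * (- (3/7) * (x / H))) has_integral
      10/7 * x * (b powr (-3/10) - a powr (-3/10))) {a..b}"
proof -
  define F where "F H = 10/7 * x * H powr (-3/10)" for H
  have "((\<lambda>H. H powr (-3/10) * (- (3/7) * (x / H))) has_integral (F b - F a)) {a..b}"
  proof (rule fundamental_theorem_of_calculus[OF H(2)])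
    fix t assume t: "t \<in> {a..b}"
    then have t0: "0 < t" using H by auto
    have p: "t powr (-3/10 - 1) = t powr (-3/10) / t" by (subst powr_diff) (use t0 in simp)
    have D: "(F has_real_derivative 10/7 * x * (-3/10 * t powr (-3/10 - 1))) (at t)"
      unfolding F_def using t0 by (auto intro!: derivative_eq_intros)
    have "10/7 * x * (-3/10 * t powr (-3/10 - 1)) = t powr (-3/10) * (- (3/7) * (x / t))"
      using t0 unfolding p by simp
    then show "(F has_vector_derivative t powr (-3/10) * (- (3/7) * (x / t))) (at t within {a..b})"
      using D by (metis has_real_derivative_iff_has_vector_derivative has_vector_derivative_at_within)
  qed
  then show ?thesis by (simp add: F_def algebra_simps)
qed

text \<open>The two sides of the threshold x nearly cancel: the coefficient of x powr (7/10) is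
  100/49 - 19/35 - 1/80 - 10/7, about 0.057 and thus positive. What remains is the negative tail
  saved by stopping at M, which is the main term, and boundary terms at a.\<close>

lemma kernel_integral:
  fixes a x M :: real
  assumes a: "0 < a" "a \<le> M" and x: "0 < x" "x \<le> M"
  shows "\<exists>I. ((\<lambda>H. H powr (-3/10) * kernel x H) has_integral I) {a..M} \<and>
    I \<ge> 10/7 * x * M powr (-3/10) - 60 * a powr (7/10)"
proof (cases "a \<le> x")
  case True
  let ?k = "\<lambda>H. H powr (-3/10) * kernel x H"
  have 1: "(?k has_integral
      x powr (7/10) * (100/49 - 19/35 - 1/80) -
      (a powr (7/10) * ((ln (x / a) - 19/50) * (10/7) + 100/49) - x powr (1/2) * a powr (1/5) / 80)) {a..x}"
    (is "(_ has_integral ?I1) _")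
    by (rule has_integral_eq[OF _ integral_above[OF a(1) True]]) (simp add: kernel_def)
  have 2: "(?k has_integral 10/7 * x * (M powr (-3/10) - x powr (-3/10))) {x..M}" (is "(_ has_integral ?I2) _")
    by (rule has_integral_spike_finite[OF _ _ integral_below[OF x], of "{x}"]) (auto simp: kernel_def)
  have "(?k has_integral ?I1 + ?I2) {a..M}"
    by (rule has_integral_combine[OF True x(2) 1 2])
  moreover have "?I1 + ?I2 \<ge> 10/7 * x * M powr (-3/10) - 60 * a powr (7/10)"
  proof -
    define z where "z = (x / a) powr (7/10)"
    have xa: "1 \<le> x / a" using a True by simp
    have xz: "x powr (7/10) = a powr (7/10) * z" using a x by (simp add: z_def powr_divide)
    have z1: "z > 0" using a x by (simp add: z_def)
    have xx: "x * x powr (-3/10) = x powr (7/10)" using x powr_add[of x 1 "-3/10"] by simp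
    have lnz: "ln (x / a) = 10/7 * ln z" using a x by (simp add: z_def ln_powr)
    \<comment> \<open>The tangent at 50 gives z the coefficient (10/7)^2 / 50, about 0.041, below
      the available 0.057.\<close>
    have "ln (z / 50) \<le> z / 50 - 1" using z1 by (intro ln_le_minus_one) auto
    then have "ln z \<le> z / 50 + ln 50 - 1" using z1 by (simp add: ln_div)
    moreover have "ln 50 \<le> (8::real)"
    proof -
      have "(50::real) \<le> 2 ^ 8" by simp
      then have "ln (50::real) \<le> ln (2 ^ 8)" by (subst ln_le_cancel_iff) auto
      also have "\<dots> = 8 * ln 2" by (subst ln_realpow) auto
      also have "\<dots> \<le> 8 * 1" using ln_2_less_1 by simp
      finally show ?thesis by simp
    qed
    ultimately have lz: "ln z \<le> z / 50 + 7" by simp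
    have "?I1 + ?I2 - 10/7 * x * M powr (-3/10) \<ge>
        a powr (7/10) * (z * (100/49 - 19/35 - 1/80 - 10/7) - ((10/7 * ln z - 19/50) * (10/7) + 100/49))"
    proof -
      define g where "g = x powr (1/2) * a powr (1/5) / 80"
      have "g \<ge> 0" by (simp add: g_def)
      moreover have "10/7 * x * (M powr (-3/10) - x powr (-3/10)) = 10/7 * x * M powr (-3/10) - 10/7 * (a powr (7/10) * z)"
        using xx unfolding xz by (simp add: right_diff_distrib)
      ultimately show ?thesis unfolding lnz xz g_def[symmetric] by (simp add: algebra_simps)
    qed
    moreover have "a powr (7/10) * (z * (100/49 - 19/35 - 1/80 - 10/7) - ((10/7 * ln z - 19/50) * (10/7) + 100/49))
        \<ge> a powr (7/10) * (-60)"
      using lz z1 by (intro mult_left_mono) (auto simp: algebra_simps)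
    ultimately show ?thesis by linarith
  qed
  ultimately show ?thesis by blast
next
  case False
  let ?k = "\<lambda>H. H powr (-3/10) * kernel x H"
  have int: "(?k has_integral 10/7 * x * (M powr (-3/10) - a powr (-3/10))) {a..M}"
    by (rule has_integral_eq[OF _ integral_below[OF a]]) (use False in \<open>auto simp: kernel_def\<close>)
  have "x * a powr (-3/10) \<le> a * a powr (-3/10)"
    using False by (intro mult_right_mono) auto
  also have "\<dots> = a powr (7/10)" using a powr_add[of a 1 "-3/10"] by simp
  finally have "x * a powr (-3/10) \<le> a powr (7/10)" .
  moreover have "0 \<le> a powr (7/10)" by simp
  moreover have "10/7 * x * (M powr (-3/10) - a powr (-3/10)) = 10/7 * x * M powr (-3/10) - 10/7 * (x * a powr (-3/10))"
    by (simp add: right_diff_distrib)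
  ultimately have "10/7 * x * (M powr (-3/10) - a powr (-3/10)) \<ge> 10/7 * x * M powr (-3/10) - 60 * a powr (7/10)"
    by linarith
  with int show ?thesis by blast
qed

lemma kernel_sum_bound:
  fixes f :: "'b \<Rightarrow> real"
  assumes fin: "finite T" and a: "1 \<le> a" "a \<le> M" and f: "\<And>t. t \<in> T \<Longrightarrow> 0 < f t \<and> f t \<le> M"
    and Y: "0 \<le> Y" "0 \<le> Z"
    and le: "\<And>H. H \<in> {a..M} \<Longrightarrow> (\<Sum>t\<in>T. kernel (f t) H) \<le> Y + Z / H"
  shows "(\<Sum>t\<in>T. f t) \<le> Y * M + (42 * a powr (7/10) * real (card T) + 7/3 * Z) * M powr (3/10)"
proof -
  have a0: "0 < a" using a by simp
  have "\<forall>t\<in>T. \<exists>I. ((\<lambda>H. H powr (-3/10) * kernel (f t) H) has_integral I) {a..M} \<and>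
    I \<ge> 10/7 * f t * M powr (-3/10) - 60 * a powr (7/10)"
    using kernel_integral[OF a0 a(2)] f by blast
  from bchoice[OF this] obtain I where I: "\<And>t. t \<in> T \<Longrightarrow> ((\<lambda>H. H powr (-3/10) * kernel (f t) H) has_integral I t) {a..M}"
    "\<And>t. t \<in> T \<Longrightarrow> I t \<ge> 10/7 * f t * M powr (-3/10) - 60 * a powr (7/10)" by blast
  have lhs: "((\<lambda>H. \<Sum>t\<in>T. H powr (-3/10) * kernel (f t) H) has_integral (\<Sum>t\<in>T. I t)) {a..M}"
    by (rule has_integral_sum[OF fin I(1)])
  define F where "F H = 10/7 * Y * H powr (7/10) - 10/3 * Z * H powr (-3/10)" for H
  have rhs: "((\<lambda>H. H powr (-3/10) * (Y + Z / H)) has_integral F M - F a) {a..M}"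
  proof (rule fundamental_theorem_of_calculus[OF a(2)])
    fix t assume t: "t \<in> {a..M}"
    then have t0: "0 < t" using a by auto
    have p: "t powr (-3/10 - 1) = t powr (-3/10) / t" by (subst powr_diff) (use t0 in simp)
    have q: "t powr (7/10 - 1) = t powr (-3/10)" by simp
    have D: "(F has_real_derivative 10/7 * Y * (7/10 * t powr (7/10 - 1)) - 10/3 * Z * (-3/10 * t powr (-3/10 - 1))) (at t)"
      unfolding F_def using t0 by (auto intro!: derivative_eq_intros)
    have "10/7 * Y * (7/10 * t powr (7/10 - 1)) - 10/3 * Z * (-3/10 * t powr (-3/10 - 1)) = t powr (-3/10) * (Y + Z / t)"
      using t0 unfolding q p by (simp add: field_simps)
    then show "(F has_vector_derivative t powr (-3/10) * (Y + Z / t)) (at t within {a..M})"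
      using D by (metis has_real_derivative_iff_has_vector_derivative has_vector_derivative_at_within)
  qed
  have "(\<Sum>t\<in>T. I t) \<le> F M - F a"
  proof (rule has_integral_le[OF lhs rhs])
    fix H assume H: "H \<in> {a..M}"
    show "(\<Sum>t\<in>T. H powr (-3/10) * kernel (f t) H) \<le> H powr (-3/10) * (Y + Z / H)"
      unfolding sum_distrib_left[symmetric] using le[OF H] by (intro mult_left_mono) auto
  qed
  also have "\<dots> \<le> 10/7 * Y * M powr (7/10) + 10/3 * Z"
  proof -
    have "a powr (-3/10) \<le> 1" using a powr_mono[of "-3/10" 0 a] by simp
    then have "Z * a powr (-3/10) \<le> Z" using Y by (simp add: mult_left_le)
    moreover have "0 \<le> Z * M powr (-3/10)" "0 \<le> Y * a powr (7/10)" using Y by auto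
    ultimately show ?thesis by (simp add: F_def)
  qed
  finally have up: "(\<Sum>t\<in>T. I t) \<le> 10/7 * Y * M powr (7/10) + 10/3 * Z" .
  have lo: "(\<Sum>t\<in>T. 10/7 * f t * M powr (-3/10) - 60 * a powr (7/10)) \<le> (\<Sum>t\<in>T. I t)"
    by (rule sum_mono) (rule I(2))
  have "10/7 * (\<Sum>t\<in>T. f t) * M powr (-3/10) - 60 * a powr (7/10) * real (card T)
      \<le> 10/7 * Y * M powr (7/10) + 10/3 * Z"
  proof -
    have "(\<Sum>t\<in>T. 10/7 * f t * M powr (-3/10)) = 10/7 * (\<Sum>t\<in>T. f t) * M powr (-3/10)"
      by (simp only: sum_distrib_left sum_distrib_right)
    moreover have "(\<Sum>t\<in>T. 10/7 * f t * M powr (-3/10) - 60 * a powr (7/10)) =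
        (\<Sum>t\<in>T. 10/7 * f t * M powr (-3/10)) - 60 * a powr (7/10) * real (card T)"
      unfolding sum_subtractf by simp
    ultimately show ?thesis using up lo by linarith
  qed
  then have 1: "(\<Sum>t\<in>T. f t) * M powr (-3/10) \<le> Y * M powr (7/10) + (42 * a powr (7/10) * real (card T) + 7/3 * Z)"
    by (simp add: algebra_simps)
  have M0: "0 < M" using a by simp
  have e: "M powr (-3/10) * M powr (3/10) = 1" "M powr (7/10) * M powr (3/10) = M"
    using M0 by (simp_all add: powr_add[symmetric])
  have "(\<Sum>t\<in>T. f t) * M powr (-3/10) * M powr (3/10)
      \<le> (Y * M powr (7/10) + (42 * a powr (7/10) * real (card T) + 7/3 * Z)) * M powr (3/10)"
    using 1 by (intro mult_right_mono) auto
  then show ?thesis using e by (simp add: algebra_simps)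
qed

text \<open>963/700 = 1 + 19/50 - 3/700 is what the constant 19/50 of \<open>kernel\<close> leaves
  for this logarithm.\<close>

lemma ln_constant_bound: "ln ((35000::real) / 8991) \<le> 963 / 700"
proof -
  have "(35000::real) / 8991 \<le> (1 + 963/5600 + (963/5600)\<^sup>2 / 2) ^ 8" by (simp add: power_divide field_simps)
  also have "\<dots> \<le> exp (963/5600) ^ 8"
    using exp_lower_Taylor_quadratic[of "963/5600 :: real"] by (intro power_mono) auto
  also have "\<dots> = exp (963/700)" by (simp flip: exp_of_nat_mult)
  finally have "ln ((35000::real) / 8991) \<le> ln (exp (963 / 700))" by (subst ln_le_cancel_iff) auto
  then show ?thesis by simp
qed

section \<open>Schedules\<close>

locale positive_steps =
  fixes \<eta> :: "nat \<Rightarrow> real"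
  assumes \<eta>_pos: "\<And>t. t \<ge> 1 \<Longrightarrow> \<eta> t > 0"
begin

definition S :: "nat \<Rightarrow> nat \<Rightarrow> real" where "S a b = (\<Sum>s\<in>{a<..b}. \<eta> s)"

lemma S_nonneg: "0 \<le> S a b"
  unfolding S_def by (auto intro!: sum_nonneg less_imp_le[OF \<eta>_pos])

lemma S_split: "a \<le> b \<Longrightarrow> b \<le> c \<Longrightarrow> S a c = S a b + S b c"
proof -
  assume "a \<le> b" "b \<le> c"
  then have "{a<..c} = {a<..b} \<union> {b<..c}" by auto
  then show ?thesis unfolding S_def by (simp add: sum.union_disjoint)
qed

lemma S_self [simp]: "S a a = 0" by (simp add: S_def)

lemma S_first: "a < b \<Longrightarrow> S a b = \<eta> (Suc a) + S (Suc a) b"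
proof -
  have "{a<..Suc a} = {Suc a}" by auto
  then show "a < b \<Longrightarrow> ?thesis" using S_split[of a "Suc a" b] by (simp add: S_def)
qed

section \<open>Cutting an arbitrary gap into blocks\<close>

lemma small_run:
  assumes "a \<le> c"
  obtains q where "a \<le> q" "q \<le> c" "q = a \<or> \<eta> q \<ge> 1" "S q c \<le> real (c - q)"
proof -
  let ?A = "{k \<in> {a..c}. k = a \<or> \<eta> k \<ge> 1}"
  define q where "q = Max ?A"
  have A: "finite ?A" "a \<in> ?A" using assms by auto
  have q: "q \<in> ?A" unfolding q_def using A by (intro Max_in) auto
  have "\<eta> s \<le> 1" if "s \<in> {q<..c}" for s
  proof (rule ccontr)
    assume "\<not> \<eta> s \<le> 1"
    then have "s \<in> ?A" using that q by auto
    then have "s \<le> q" unfolding q_def using A by (intro Max_ge) auto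
    with that show False by simp
  qed
  then have "S q c \<le> (\<Sum>s\<in>{q<..c}. 1)" unfolding S_def by (intro sum_mono)
  then have "S q c \<le> real (c - q)" by simp
  with q that show ?thesis by auto
qed

text \<open>Going backwards from \<open>q\<close>, either a step that dominates everything after it is met early,
  or the sum reaches \<open>X\<close> without overshooting by more than a constant factor.\<close>

lemma scan:
  assumes aq: "a \<le> q" and X: "0 < X" and Y: "0 \<le> Y"
  obtains q' where "a \<le> q'" "q' \<le> q" "S q' q \<le> 2 * X + 2 + Y + real (q - q')"
    "q' = a \<or> \<eta> q' \<ge> 2 + Y + S q' q \<or> (\<eta> q' \<ge> 1 \<and> S q' q \<ge> X)"
proof (cases "S a q < X")
  case True
  then show ?thesis using that[of a] aq X Y by simp
next
  case False
  let ?A = "{k \<in> {a..q}. S k q \<ge> X}"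
  define c where "c = Max ?A"
  have A: "finite ?A" "a \<in> ?A" using aq False by auto
  have c: "c \<in> ?A" unfolding c_def using A by (intro Max_in) auto
  then have cq: "c < q" using X by (cases "c = q") auto
  have c1: "S (Suc c) q < X"
  proof (rule ccontr)
    assume "\<not> S (Suc c) q < X"
    then have "Suc c \<in> ?A" using c cq by auto
    then have "Suc c \<le> c" unfolding c_def using A by (intro Max_ge) auto
    then show False by simp
  qed
  note cs = S_first[OF cq]
  show ?thesis
  proof (cases "\<eta> (Suc c) \<ge> 2 + Y + S (Suc c) q")
    case True
    then show ?thesis using that[of "Suc c"] c cq c1 X Y by auto
  next
    case small: False
    obtain q' where q': "a \<le> q'" "q' \<le> c" "q' = a \<or> \<eta> q' \<ge> 1" "S q' c \<le> real (c - q')"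
      using small_run[of a c] c by auto
    have sp: "S q' q = S q' c + S c q" using q' cq by (intro S_split) auto
    have "real (c - q') \<le> real (q - q')" using cq by simp
    then have "S q' q \<le> 2 * X + 2 + Y + real (q - q')" using sp q'(4) cs small c1 by linarith
    moreover have "S q' q \<ge> X" using sp S_nonneg[of q' c] c by simp
    ultimately show ?thesis using that[of q'] q' cq by auto
  qed
qed

text \<open>Blocks 1 to 3 are at most of the order of the number of steps; only block 0 may be
  longer, and it enters \<open>w\<close> with the factor 1, which therefore governs the leading cost
  of a gap.\<close>

definition gap_ok :: "nat \<Rightarrow> nat \<Rightarrow> nat \<Rightarrow> nat \<Rightarrow> nat \<Rightarrow> bool" where
  "gap_ok a b q1 q2 q3 \<longleftrightarrow> a \<le> q1 \<and> q1 \<le> q2 \<and> q2 \<le> q3 \<and> q3 \<le> b \<and>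
    (a < q1 \<longrightarrow> \<eta> q1 \<ge> 1) \<and> (q1 < q2 \<longrightarrow> \<eta> q2 \<ge> 1) \<and> (q2 < q3 \<longrightarrow> \<eta> q3 \<ge> 1) \<and>
    (q1 < q2 \<longrightarrow> q2 < q3 \<and> S q2 q3 \<ge> 6 * (S q3 b + 1)) \<and>
    (a < q1 \<longrightarrow> \<eta> q1 \<ge> 2 + S q1 q2 + S q2 q3 + S q3 b \<or> (q1 < q2 \<and> S q1 q2 \<ge> 9 * (S q2 q3 + S q3 b + 1))) \<and>
    S q1 q2 + S q2 q3 + S q3 b + 1 \<le> 304 * real (b + 1 - a)"

text \<open>The blocks are built from the end: a run of steps below 1, then up to two scans, stopped
  early by a dominating step. The lengths are at most g, 14 * (g + 1) and 288 * (g + 1), which fits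
  under 304.\<close>

lemma gap_split:
  assumes ab: "a \<le> b"
  shows "\<exists>q1 q2 q3. gap_ok a b q1 q2 q3"
proof -
  obtain q3 where q3: "a \<le> q3" "q3 \<le> b" "q3 = a \<or> \<eta> q3 \<ge> 1" "S q3 b \<le> real (b - q3)"
    using small_run[OF ab] by blast
  define g where "g = real (b - a)"
  have g: "0 \<le> g" "real (b + 1 - a) = g + 1" "real (b - q3) \<le> g" using ab q3 by (auto simp: g_def)
  have t3: "S q3 b \<le> g" using q3(4) g(3) by (rule order_trans)
  note nn = S_nonneg[of q3 b]
  show ?thesis
  proof (cases "q3 = a")
    case True
    then have "gap_ok a b a a a" using q3 t3 g(1,2) ab by (simp add: gap_ok_def)
    then show ?thesis by blast
  next
    case n3: False
    obtain q2 where q2: "a \<le> q2" "q2 \<le> q3" "S q2 q3 \<le> 2 * (6 * (S q3 b + 1)) + 2 + S q3 b + real (q3 - q2)"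
      "q2 = a \<or> \<eta> q2 \<ge> 2 + S q3 b + S q2 q3 \<or> (\<eta> q2 \<ge> 1 \<and> S q2 q3 \<ge> 6 * (S q3 b + 1))"
      using scan[OF q3(1), of "6 * (S q3 b + 1)" "S q3 b"] nn by auto
    have "real (q3 - q2) \<le> g" using q2 q3 by (simp add: g_def)
    then have "S q2 q3 \<le> 2 * (6 * (S q3 b + 1)) + 2 + S q3 b + g" using q2(3) by (rule order_trans[OF _ add_left_mono, rotated])
    then have b2: "S q2 q3 \<le> 14 * (g + 1)" using t3 g(1) by (simp add: algebra_simps)
    note nn2 = S_nonneg[of q2 q3]
    show ?thesis
    proof (cases "q2 = a \<or> \<eta> q2 \<ge> 2 + S q3 b + S q2 q3")
      case True
      then have "gap_ok a b q2 q2 q3" using True q2(1,2) q3 n3 t3 g(1,2) b2 nn nn2 by (auto simp: gap_ok_def)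
      then show ?thesis by blast
    next
      case n2: False
      then have c2: "\<eta> q2 \<ge> 1" "S q2 q3 \<ge> 6 * (S q3 b + 1)" using q2 by auto
      then have lt: "q2 < q3" using q2(2) nn by (cases "q2 = q3") auto
      obtain q1 where q1: "a \<le> q1" "q1 \<le> q2"
        "S q1 q2 \<le> 2 * (9 * (S q2 q3 + S q3 b + 1)) + 2 + (S q2 q3 + S q3 b) + real (q2 - q1)"
        "q1 = a \<or> \<eta> q1 \<ge> 2 + (S q2 q3 + S q3 b) + S q1 q2 \<or> (\<eta> q1 \<ge> 1 \<and> S q1 q2 \<ge> 9 * (S q2 q3 + S q3 b + 1))"
        using scan[OF q2(1), of "9 * (S q2 q3 + S q3 b + 1)" "S q2 q3 + S q3 b"] nn nn2 by auto
      have "real (q2 - q1) \<le> g" using q1 q2 q3 by (simp add: g_def)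
      then have "S q1 q2 \<le> 2 * (9 * (S q2 q3 + S q3 b + 1)) + 2 + (S q2 q3 + S q3 b) + g"
        using q1(3) by (rule order_trans[OF _ add_left_mono, rotated])
      then have b1: "S q1 q2 \<le> 288 * (g + 1)" using b2 t3 g(1) by (simp add: algebra_simps)
      have "\<eta> q1 \<ge> 2 + S q1 q2 + S q2 q3 + S q3 b \<or> (q1 < q2 \<and> S q1 q2 \<ge> 9 * (S q2 q3 + S q3 b + 1))"
        if "a < q1"
      proof (cases "q1 = q2")
        case True
        then show ?thesis using q1(4) that nn nn2 by auto
      qed (use q1 that in auto)
      moreover have "a < q1 \<Longrightarrow> \<eta> q1 \<ge> 1" using q1(4) nn nn2 S_nonneg[of q1 q2] by auto
      moreover have "S q1 q2 + S q2 q3 + S q3 b + 1 \<le> 304 * real (b + 1 - a)"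
        unfolding g(2) using b1 b2 t3 g(1) by (simp add: algebra_simps)
      ultimately have "gap_ok a b q1 q2 q3" using q1 q2 q3 c2 lt n3 by (auto simp: gap_ok_def)
      then show ?thesis by blast
    qed
  qed
qed

text \<open>Each gap is cut by \<open>gap_split\<close>; 608 = 2 * 304 stems from the term 2 *
  \<Lambda> in \<open>w_le\<close>. The steps before \<open>T 0\<close> form gap 0, which is not cut
  and enters through the distance to the minimiser.\<close>

lemma worst_rate_jumps:
  fixes T :: "nat \<Rightarrow> nat" and m :: nat
  assumes T0: "1 \<le> T 0" and T: "\<And>j. j < m \<Longrightarrow> T j < T (Suc j)"
    and big: "\<And>j. j < m \<Longrightarrow> \<eta> (T j) > 1"
  defines "W \<equiv> \<lambda>j. S (T j) (T (Suc j) - 1) + 608 * real (T (Suc j) - T j)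
      + sqrt (304 * real (T (Suc j) - T j) * (if Suc j < m then \<eta> (T (Suc j)) else 0))"
  shows "ereal (((\<Prod>j<m. 3/5 * (\<eta> (T j) - 1) / W j) / (S 0 (T 0 - 1) + 1))\<^sup>2 / 2) \<le> worst_rate (T m - 1) \<eta>"
proof -
  have "\<exists>q1 q2 q3. gap_ok (T j) (T (Suc j) - 1) q1 q2 q3" if "j < m" for j
    using T[OF that] by (intro gap_split) simp
  then obtain q1 q2 q3 where q: "\<And>j. j < m \<Longrightarrow> gap_ok (T j) (T (Suc j) - 1) (q1 j) (q2 j) (q3 j)" by metis
  define B where "B k = (if k div 4 = 0 then 0 else if k mod 4 = 0 then T (k div 4 - 1)
    else if k mod 4 = 1 then q1 (k div 4 - 1) else if k mod 4 = 2 then q2 (k div 4 - 1) else q3 (k div 4 - 1))" for k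
  have B0: "B k = 0" if "k \<le> 3" for k using that by (simp add: B_def)
  have B4: "B (4*j+4) = T j" "B (4*j+8) = T (Suc j)" for j by (simp_all add: B_def)
  have BS: "B (4 * Suc j) = T j" "B (4 * Suc j + 0) = T j" "B (4 * Suc j + 0 + 1) = q1 j" "B (4 * Suc j + 1) = q1 j" "B (4 * Suc j + 1 + 1) = q2 j" "B (4 * Suc j + 2) = q2 j"
    "B (4 * Suc j + 2 + 1) = q3 j" "B (4 * Suc j + 3) = q3 j" "B (4 * Suc j + 4) = T (Suc j)" for j
    by (simp_all add: B_def mod_Suc div_Suc)
  have S3: "(\<Sum>s\<in>{a<..<T (Suc j)}. \<eta> s) = S a (T (Suc j) - 1)" if "j < m" for a j
  proof -
    have "{a<..<T (Suc j)} = {a<..T (Suc j) - 1}" using T[OF that] by auto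
    then show ?thesis by (simp add: S_def)
  qed
  have lt: "x \<le> T (Suc j) - 1 \<longleftrightarrow> x < T (Suc j)" "T (Suc j) - 1 + 1 - T j = T (Suc j) - T j" if "j < m" for x j
    using T[OF that] by auto
  have chain: "jump_chain \<eta> m B"
  proof
    show "\<eta> t > 0" if "t \<ge> 1" for t by (rule \<eta>_pos[OF that])
    show "B k = 0" if "k \<le> 3" for k by (rule B0[OF that])
  next
    fix j assume j: "j \<le> m"
    show last: "B (4*j+3) < B (4*j+4)"
    proof (cases j)
      case 0
      then show ?thesis using T0 B0[of 3] B4(1)[of 0] by simp
    next
      case (Suc j')
      then have j': "j' < m" using j by simp
      have "q3 j' \<le> T (Suc j') - 1" using q[OF j'] unfolding gap_ok_def by blast
      then show ?thesis unfolding Suc BS lt(1)[OF j'] .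
    qed
    show "\<eta> (B (4*j+i+1)) \<ge> 1" if i: "i < 3" "B (4*j+i) < B (4*j+i+1)" for i
    proof (cases j)
      case 0
      have "B (4*j+i+1) = 0" by (rule B0) (use 0 i in simp)
      then show ?thesis using i by simp
    next
      case (Suc j')
      have ok: "gap_ok (T j') (T (Suc j') - 1) (q1 j') (q2 j') (q3 j')" using q[of j'] j Suc by simp
      consider "i = 0" | "i = 1" | "i = 2" using i by linarith
      then show ?thesis
      proof cases
        case 1
        show ?thesis using i(2) ok unfolding 1 Suc BS gap_ok_def by blast
      next
        case 2
        show ?thesis using i(2) ok unfolding 2 Suc BS gap_ok_def by blast
      next
        case 3
        show ?thesis using i(2) ok unfolding 3 Suc BS gap_ok_def by blast
      qed
    qed
    show "B (4*j+2) < B (4*j+3) \<and>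
       (\<Sum>s\<in>{B (4*j+2)<..B (4*j+2+1)}. \<eta> s) \<ge> 6 * ((\<Sum>s\<in>{B (4*j+3)<..<B (4*j+4)}. \<eta> s) + 1)"
      if "B (4*j+1) < B (4*j+2)"
    proof (cases j)
      case 0
      have "B (4*j+2) = 0" by (rule B0) (simp add: 0)
      then show ?thesis using that by simp
    next
      case (Suc j')
      have ok: "gap_ok (T j') (T (Suc j') - 1) (q1 j') (q2 j') (q3 j')" and j': "j' < m" using q[of j'] j Suc by simp_all
      show ?thesis using that ok unfolding Suc BS S3[OF j'] S_def[symmetric] gap_ok_def by blast
    qed
    show "1 + ((\<Sum>s\<in>{B (4*j+1)<..B (4*j+1+1)}. \<eta> s) + (\<Sum>s\<in>{B (4*j+2)<..B (4*j+2+1)}. \<eta> s) +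
          (\<Sum>s\<in>{B (4*j+3)<..<B (4*j+4)}. \<eta> s) + 1) \<le> \<eta> (B (4*j+1)) \<or>
        B (4*j+1) < B (4*j+2) \<and> 9 * ((\<Sum>s\<in>{B (4*j+2)<..B (4*j+2+1)}. \<eta> s) +
          (\<Sum>s\<in>{B (4*j+3)<..<B (4*j+4)}. \<eta> s) + 1) \<le> (\<Sum>s\<in>{B (4*j+1)<..B (4*j+1+1)}. \<eta> s)"
      if "B (4*j) < B (4*j+1)"
    proof (cases j)
      case 0
      have "B (4*j+1) = 0" by (rule B0) (simp add: 0)
      then show ?thesis using that by simp
    next
      case (Suc j')
      have ok: "gap_ok (T j') (T (Suc j') - 1) (q1 j') (q2 j') (q3 j')" and j': "j' < m" using q[of j'] j Suc by simp_all
      have "2 + S (q1 j') (q2 j') + S (q2 j') (q3 j') + S (q3 j') (T (Suc j') - 1) \<le> \<eta> (q1 j') \<or>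
         q1 j' < q2 j' \<and> 9 * (S (q2 j') (q3 j') + S (q3 j') (T (Suc j') - 1) + 1) \<le> S (q1 j') (q2 j')"
        using that ok unfolding Suc BS gap_ok_def by blast
      then show ?thesis unfolding Suc BS S3[OF j'] S_def[symmetric] by auto
    qed
  next
    fix k assume k: "k < 4 * m + 4"
    show "B k \<le> B (Suc k)"
    proof (cases "k \<le> 3")
      case True
      then show ?thesis using B0[of k] by simp
    next
      case False
      define j i where "j = k div 4 - 1" and "i = k mod 4"
      have ki: "k = 4 * Suc j + i" "i < 4" "j < m" using False k unfolding j_def i_def by auto
      have ok: "gap_ok (T j) (T (Suc j) - 1) (q1 j) (q2 j) (q3 j)" using q[OF ki(3)] .
      have e: "4 * Suc j + 3 + 1 = 4 * Suc j + 4" by simp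
      consider "i = 0" | "i = 1" | "i = 2" | "i = 3" using ki by linarith
      then have "B (4 * Suc j + i) \<le> B (4 * Suc j + i + 1)"
      proof cases
        case 1
        show ?thesis using ok unfolding 1 BS gap_ok_def by blast
      next
        case 2
        show ?thesis using ok unfolding 2 BS gap_ok_def by blast
      next
        case 3
        show ?thesis using ok unfolding 3 BS gap_ok_def by blast
      next
        case 4
        have "q3 j \<le> T (Suc j) - 1" using ok unfolding gap_ok_def by blast
        then have "q3 j < T (Suc j)" unfolding lt(1)[OF ki(3)] .
        then show ?thesis unfolding 4 e BS by simp
      qed
      then show ?thesis using ki(1) by simp
    qed
  next
    show "\<eta> (B (4*j+4)) > 1" if "j < m" for j using big[OF that] B4 by simp
  qed
  have "ereal (((\<Prod>j<m. 3/5 * (\<eta> (B (4*j+4)) - 1) / W j) / ((\<Sum>s\<in>{0<..<B 4}. \<eta> s) + 1))\<^sup>2 / 2)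
      \<le> worst_rate (B (4*m+4) - 1) \<eta>"
  proof (rule jump_chain.worst_rate_chain_ge[OF chain])
    fix j assume j: "j < m"
    have ok: "gap_ok (T j) (T (Suc j) - 1) (q1 j) (q2 j) (q3 j)" using q[OF j] .
    show "(\<Sum>s\<in>{B (4 * Suc j + 1)<..B (4 * Suc j + 1 + 1)}. \<eta> s) + (\<Sum>s\<in>{B (4 * Suc j + 2)<..B (4 * Suc j + 2 + 1)}. \<eta> s) +
         (\<Sum>s\<in>{B (4 * Suc j + 3)<..<B (4 * Suc j + 4)}. \<eta> s) + 1 \<le> 304 * real (T (Suc j) - T j)"
      using ok unfolding BS S3[OF j] S_def[symmetric] gap_ok_def lt(2)[OF j] by blast
    show "(\<Sum>s\<in>{B (4*j+4)<..<B (4*j+8)}. \<eta> s) + 2 * (304 * real (T (Suc j) - T j)) +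
         sqrt (304 * real (T (Suc j) - T j) * (if Suc j < m then \<eta> (B (4*j+8)) else 0)) \<le> W j"
      unfolding B4 S3[OF j] W_def by simp
  qed
  moreover have "(\<Sum>s\<in>{0<..<B 4}. \<eta> s) = S 0 (T 0 - 1)"
  proof -
    have "{0<..<T 0} = {0<..T 0 - 1}" using T0 by auto
    then show ?thesis using B4(1)[of 0] by (simp add: S_def)
  qed
  ultimately show ?thesis unfolding B4 by simp
qed

section \<open>The single-slope bound and the logarithm of the jump bound\<close>

lemma S_last: "a < b \<Longrightarrow> S a b = S a (b - 1) + \<eta> b"
  using S_split[of a "b - 1" b] S_first[of "b - 1" b] by simp

text \<open>One dimension and one slope: the minimiser is put at distance 2 * A, so far away that n
  steps of total length A - 1 never leave the slope and the value stays above A.\<close>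

lemma worst_rate_linear: "ereal (1 / (4 * (S 0 n + 1))) \<le> worst_rate n \<eta>"
proof -
  define u where "u = unit_vec 0"
  define A where "A = S 0 n + 1"
  have A: "A \<ge> 1" using S_nonneg by (simp add: A_def)
  have u: "u \<in> \<R> 1" "inner u u = 1" "norm u = 1" "u \<noteq> 0"
  proof -
    show "u \<in> \<R> 1" by (simp add: u_def Rd_def)
    show "inner u u = 1" by (simp add: u_def)
    then show "norm u = 1" by (simp add: norm_eq_sqrt_inner)
    then show "u \<noteq> 0" by auto
  qed
  let ?X = "\<lambda>t. - S 0 t *\<^sub>R u" and ?G = "\<lambda>t::nat. (u, 2 * A)" and ?P = "{(0, 0), (u, 2 * A)}"
  have S: "S 0 t + 1 \<le> A" if "t \<le> n" for t
    using S_split[of 0 t n] S_nonneg[of t n] that by (simp add: A_def)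
  have sub: "c *\<^sub>R u \<in> \<R> 1" for c using u(1) subspace_Rd by (rule subspace_scale[rotated])
  have "ereal (hull_val (?X n) (?G n) / (norm (?X 0 - (- (2 * A)) *\<^sub>R u))\<^sup>2) \<le> worst_rate n \<eta>"
  proof (rule worst_rate_ge_env[where P = ?P and d = 1])
    show "?P \<subseteq> \<R> 1 \<times> UNIV" using u(1) by (auto simp: Rd_def)
    show "inner (fst p) ((- (2 * A)) *\<^sub>R u) + snd p \<le> 0" if "p \<in> ?P" for p using that u by auto
    show "?X (Suc t) = ?X t - \<eta> (Suc t) *\<^sub>R fst (?G t)" for t
      using S_last[of 0 "Suc t"] by (simp add: algebra_simps)
    show "inner (fst q) (?X t - fst (?G t)) + snd q \<le> inner (fst (?G t)) (?X t - fst (?G t)) + snd (?G t)"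
      if "t \<le> n" "q \<in> ?P" for t q
      using that S[of t] A u by (auto simp: inner_diff_right)
  qed (use u sub[of "- (2 * A)"] sub[of 0] in auto)
  moreover have "hull_val (?X n) (?G n) = A + 1/2"
    using u by (simp add: hull_val_def A_def)
  moreover have "(norm (?X 0 - (- (2 * A)) *\<^sub>R u))\<^sup>2 = 4 * A\<^sup>2"
    using u by (simp add: power_mult_distrib)
  moreover have "1 / (4 * A) \<le> (A + 1/2) / (4 * A\<^sup>2)"
    using A by (simp add: field_simps power2_eq_square)
  ultimately have "ereal (1 / (4 * A)) \<le> worst_rate n \<eta>"
    by (metis ereal_less_eq(3) order_trans)
  then show ?thesis by (simp add: A_def)
qed

text \<open>The slope 3/7 is s / (1 - s) for the weight exponent s = 3/10; up to small corrections
  it maximises the net coefficient in \<open>kernel_integral\<close>. The constant is 19/50 =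
  963/700 - 1 + 3/700.\<close>

lemma ln_factor_ge:
  fixes G l h h' H A s :: real
  assumes H: "1000 \<le> H" "H \<le> h" "H \<le> h'" and G: "0 \<le> G" and l: "1 \<le> l"
    and s: "0 \<le> s" "s \<le> sqrt (304 * l * h')"
    and A: "\<And>w v. 0 \<le> w \<Longrightarrow> 1 \<le> v \<Longrightarrow> ln (1 + w * v) \<le> A * w\<^sup>2 + v / 400"
  shows "ln (h / H) - 19/50 - sqrt (h' / H) / 400 - 3/7 * G / H - (261 + 3040000 * A) * l / H
      \<le> ln (3/5 * (h - 1) / (G + 608 * l + s))"
proof -
  have H0: "0 < H" using H by simp
  have A0: "0 \<le> A"
  proof -
    have "ln (1 + 1 * 1) \<le> A * 1\<^sup>2 + 1 / (400::real)" by (rule A) auto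
    then show ?thesis using ln2_ge_two_thirds by simp
  qed
  define B where "B = G + 608 * l + H / 100"
  have B: "0 < B" using H0 G l by (simp add: B_def add_pos_nonneg add_nonneg_pos)
  \<comment> \<open>\<open>ln B\<close> is bounded by its tangent at \<open>7/3 * H\<close>, the square root is absorbed by \<open>ln (1 + w * v)\<close>,
    and \<open>35000 / 8991\<close> is \<open>(7/3) / (2997/5000)\<close>.\<close>
  define w v where "w = 100 * sqrt (304 * l / H)" and "v = sqrt (h' / H)"
  have wv: "0 \<le> w" "1 \<le> v" using H0 H l by (auto simp: w_def v_def)
  have "sqrt (304 * l * h') = sqrt ((304 * l / H) * (h' / H) * H\<^sup>2)"
    using H0 by (simp add: power2_eq_square)
  also have "\<dots> = w * v * (H / 100)"
    using H0 unfolding real_sqrt_mult w_def v_def by simp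
  finally have s': "s \<le> w * v * (H / 100)" using s by simp
  also have "\<dots> \<le> w * v * B"
    using wv G l by (intro mult_left_mono) (auto simp: B_def)
  finally have "s \<le> w * v * B" .
  moreover have "G + 608 * l \<le> B" using H0 by (simp add: B_def)
  moreover have "B * (1 + w * v) = B + w * v * B" by (simp add: distrib_left)
  ultimately have "G + 608 * l + s \<le> B * (1 + w * v)" by linarith
  moreover have pos: "0 < G + 608 * l + s" using G l s by linarith
  ultimately have "ln (G + 608 * l + s) \<le> ln (B * (1 + w * v))"
    using wv B by (subst ln_le_cancel_iff) (auto intro!: mult_pos_pos add_pos_nonneg)
  also have "\<dots> = ln B + ln (1 + w * v)"
    using B wv by (intro ln_mult_pos) (auto intro!: add_pos_nonneg)
  also have "ln (1 + w * v) \<le> A * w\<^sup>2 + v / 400" using A wv by blast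
  also have "w\<^sup>2 = 3040000 * l / H" using l H0 by (simp add: w_def power_mult_distrib)
  also have "ln B = ln (B / (7/3 * H)) + ln (7/3 * H)" using B H0 ln_mult_pos[of "B / (7/3 * H)" "7/3 * H"] by simp
  also have "ln (B / (7/3 * H)) \<le> B / (7/3 * H) - 1" using B H0 by (intro ln_le_minus_one) auto
  also have "B / (7/3 * H) = 3/7 * G / H + 1824/7 * l / H + 3/700"
    using H0 by (simp add: B_def field_simps)
  finally have W: "ln (G + 608 * l + s) \<le> 3/7 * G / H + 1824/7 * l / H + 3/700 - 1 + ln (7/3 * H)
      + (A * (3040000 * l / H) + v / 400)" by simp
  \<comment> \<open>2997/5000 = 3/5 * 999/1000, using h \<ge> 1000.\<close>
  have "ln (2997/5000 * h) \<le> ln (3/5 * (h - 1))" using H by (subst ln_le_cancel_iff) auto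
  moreover have "ln (2997/5000 * h) = ln (h / H) + ln (7/3 * H) - ln (35000 / 8991)"
  proof -
    have "2997/5000 * h = (h / H) * (7/3 * H) / (35000 / 8991)" using H0 by simp
    also have "ln \<dots> = ln ((h / H) * (7/3 * H)) - ln (35000 / 8991)"
      using H0 H by (intro ln_divide_pos) auto
    also have "ln ((h / H) * (7/3 * H)) = ln (h / H) + ln (7/3 * H)"
      using H0 H by (intro ln_mult_pos) auto
    finally show ?thesis .
  qed
  ultimately have N: "ln (h / H) + ln (7/3 * H) - 963 / 700 \<le> ln (3/5 * (h - 1))"
    using ln_constant_bound by linarith
  have "ln (3/5 * (h - 1) / (G + 608 * l + s)) = ln (3/5 * (h - 1)) - ln (G + 608 * l + s)"
    using pos H by (intro ln_divide_pos) auto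
  moreover have "1824/7 * l / H \<le> 261 * l / H" using H0 l by (intro divide_right_mono) auto
  moreover have "(261 + 3040000 * A) * l / H = 261 * l / H + A * (3040000 * l / H)"
    by (simp add: add_divide_distrib distrib_right)
  ultimately show ?thesis using W N unfolding v_def by linarith
qed

lemma jump_sum:
  fixes T :: "nat \<Rightarrow> nat" and m :: nat
  assumes T0: "1 \<le> T 0" and T: "\<And>j. j < m \<Longrightarrow> T j < T (Suc j)"
    and H: "1000 \<le> H" "\<And>j. j \<le> m \<Longrightarrow> H \<le> \<eta> (T j)"
    and A: "\<And>w v. 0 \<le> w \<Longrightarrow> 1 \<le> v \<Longrightarrow> ln (1 + w * v) \<le> A * w\<^sup>2 + v / 400"
    and rate: "worst_rate (T m - 1) \<eta> \<le> 1"
  shows "(\<Sum>j<m. ln (\<eta> (T j) / H) - 19/50 - sqrt (\<eta> (T (Suc j)) / H) / 400)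
    \<le> ln 2 + ln (S 0 (T 0 - 1) + 1) + 3/7 * (\<Sum>j<m. S (T j) (T (Suc j) - 1)) / H
      + (261 + 3040000 * A) * real (T m - T 0) / H"
proof -
  define W where "W j = S (T j) (T (Suc j) - 1) + 608 * real (T (Suc j) - T j)
      + sqrt (304 * real (T (Suc j) - T j) * (if Suc j < m then \<eta> (T (Suc j)) else 0))" for j
  define r where "r j = 3/5 * (\<eta> (T j) - 1) / W j" for j
  define D where "D = S 0 (T 0 - 1) + 1"
  have D: "1 \<le> D" using S_nonneg by (simp add: D_def)
  have big: "1 < \<eta> (T j)" if "j < m" for j using H(1) H(2)[of j] that by simp
  have hp: "0 \<le> (if Suc j < m then \<eta> (T (Suc j)) else 0)" for j using H(1) H(2)[of "Suc j"] by auto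
  have Wpos: "0 < W j" if "j < m" for j
  proof -
    have "1 \<le> T (Suc j) - T j" using T[OF that] by simp
    then have "1 \<le> real (T (Suc j) - T j)" by linarith
    moreover have "0 \<le> sqrt (304 * real (T (Suc j) - T j) * (if Suc j < m then \<eta> (T (Suc j)) else 0))"
      using hp by simp
    ultimately show ?thesis using S_nonneg[of "T j" "T (Suc j) - 1"] unfolding W_def by linarith
  qed
  have rpos: "0 < r j" if "j < m" for j using Wpos[OF that] big[OF that] by (simp add: r_def)
  have "ereal (((\<Prod>j<m. r j) / D)\<^sup>2 / 2) \<le> worst_rate (T m - 1) \<eta>"
    unfolding r_def W_def D_def by (rule worst_rate_jumps[OF T0 T big])
  also have "\<dots> \<le> ereal 1" using rate by (simp add: one_ereal_def)
  finally have "((\<Prod>j<m. r j) / D)\<^sup>2 \<le> 2\<^sup>2" by simp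
  then have "(\<Prod>j<m. r j) / D \<le> 2" by (rule power2_le_imp_le) simp
  then have "(\<Prod>j<m. r j) \<le> 2 * D" using D by (simp add: field_simps)
  then have "ln (\<Prod>j<m. r j) \<le> ln (2 * D)"
    using D rpos by (subst ln_le_cancel_iff) (auto intro!: prod_pos)
  also have "\<dots> = ln 2 + ln D" using D by (simp add: ln_mult)
  also have "ln (\<Prod>j<m. r j) = (\<Sum>j<m. ln (r j))" using rpos by (intro ln_prod) (auto, metis less_irrefl)
  finally have up: "(\<Sum>j<m. ln (r j)) \<le> ln 2 + ln D" .
  have "(\<Sum>j<m. ln (\<eta> (T j) / H) - 19/50 - sqrt (\<eta> (T (Suc j)) / H) / 400 - 3/7 * S (T j) (T (Suc j) - 1) / H
      - (261 + 3040000 * A) * (real (T (Suc j)) - real (T j)) / H) \<le> (\<Sum>j<m. ln (r j))"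
  proof (rule sum_mono)
    fix j assume "j \<in> {..<m}"
    then have j: "j < m" by simp
    have l: "1 \<le> T (Suc j) - T j" "real (T (Suc j) - T j) = real (T (Suc j)) - real (T j)"
      using T[OF j] by auto
    show "ln (\<eta> (T j) / H) - 19/50 - sqrt (\<eta> (T (Suc j)) / H) / 400 - 3/7 * S (T j) (T (Suc j) - 1) / H
      - (261 + 3040000 * A) * (real (T (Suc j)) - real (T j)) / H \<le> ln (r j)"
      unfolding r_def W_def l(2)[symmetric]
    proof (rule ln_factor_ge[OF H(1) _ _ S_nonneg _ _ _ A])
      show "H \<le> \<eta> (T j)" "H \<le> \<eta> (T (Suc j))" using H(2) j by auto
      then have h0: "0 \<le> \<eta> (T (Suc j))" using H(1) by simp
      show "1 \<le> real (T (Suc j) - T j)" using l(1) by linarith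
      show "0 \<le> sqrt (304 * real (T (Suc j) - T j) * (if Suc j < m then \<eta> (T (Suc j)) else 0))"
        using hp by simp
      show "sqrt (304 * real (T (Suc j) - T j) * (if Suc j < m then \<eta> (T (Suc j)) else 0))
          \<le> sqrt (304 * real (T (Suc j) - T j) * \<eta> (T (Suc j)))"
        using h0 by (intro real_sqrt_le_mono mult_left_mono) auto
    qed
  qed
  also have "(\<Sum>j<m. ln (\<eta> (T j) / H) - 19/50 - sqrt (\<eta> (T (Suc j)) / H) / 400 - 3/7 * S (T j) (T (Suc j) - 1) / H
      - (261 + 3040000 * A) * (real (T (Suc j)) - real (T j)) / H)
    = (\<Sum>j<m. ln (\<eta> (T j) / H) - 19/50 - sqrt (\<eta> (T (Suc j)) / H) / 400)
      - (\<Sum>j<m. 3/7 * S (T j) (T (Suc j) - 1) / H) - (\<Sum>j<m. (261 + 3040000 * A) * (real (T (Suc j)) - real (T j)) / H)"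
    by (simp only: sum_subtractf)
  also have "(\<Sum>j<m. 3/7 * S (T j) (T (Suc j) - 1) / H) = 3/7 * (\<Sum>j<m. S (T j) (T (Suc j) - 1)) / H"
    by (simp only: sum_distrib_left sum_divide_distrib)
  also have "(\<Sum>j<m. (261 + 3040000 * A) * (real (T (Suc j)) - real (T j)) / H)
      = (261 + 3040000 * A) * (\<Sum>j<m. real (T (Suc j)) - real (T j)) / H"
    by (simp only: sum_distrib_left sum_divide_distrib)
  also have "(\<Sum>j<m. real (T (Suc j)) - real (T j)) = real (T m) - real (T 0)"
    by (rule sum_lessThan_telescope)
  also have "\<dots> = real (T m - T 0)"
  proof -
    have "T 0 \<le> T k" if "k \<le> m" for k using that
    proof (induction k)
      case (Suc k) then show ?case using T[of k] by simp
    qed simp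
    then show ?thesis by (simp add: of_nat_diff)
  qed
  finally show ?thesis using up unfolding D_def by linarith
qed

end

section \<open>Growth of a schedule that is too fast\<close>

locale fast_schedule = positive_steps +
  fixes N :: nat
  assumes N: "1 \<le> N"
    and fast: "\<And>n. N \<le> n \<Longrightarrow> worst_rate n \<eta> \<le> ereal (real n powr (-59/50))"
begin

definition total :: "nat \<Rightarrow> real" where "total n = S 0 n + 1"

lemma total_mono: "a \<le> b \<Longrightarrow> total a \<le> total b"
  using S_split[of 0 a b] S_nonneg[of a b] by (simp add: total_def)

lemma total_ge_1: "1 \<le> total n"
  using S_nonneg by (simp add: total_def)

lemma total_lower:
  assumes "N \<le> n"
  shows "real n powr (59/50) / 4 \<le> total n"
proof -
  have n: "0 < real n powr (59/50)" using assms N by simp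
  have "ereal (1 / (4 * total n)) \<le> ereal (real n powr (-59/50))"
    using order_trans[OF worst_rate_linear fast[OF assms]] by (simp add: total_def)
  then have "1 / (4 * total n) \<le> 1 / real n powr (59/50)"
    by (simp add: powr_minus_divide)
  then show ?thesis using n total_ge_1[of n] by (simp add: field_simps)
qed

text \<open>A single jump at t followed by an empty gap, so that W = 608; 1520 = 608 * 5/3 * 3/2,
  with 3/2 in place of sqrt 2.\<close>

lemma step_le:
  assumes "N \<le> t"
  shows "\<eta> t \<le> 1 + 1520 * (real t powr (-59/100) * total (t - 1))"
proof (cases "\<eta> t \<le> 1")
  case True
  have "0 \<le> real t powr (-59/100) * total (t - 1)" using total_ge_1[of "t - 1"] by simp
  then show ?thesis using True by linarith
next
  case False
  define x where "x = 3/5 * (\<eta> t - 1) / 608 / total (t - 1)"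
  have "ereal (x\<^sup>2 / 2) \<le> worst_rate t \<eta>"
    using worst_rate_jumps[of "\<lambda>j. t + j" 1] False assms N by (simp add: x_def total_def)
  also have "\<dots> \<le> ereal (real t powr (-59/50))" by (rule fast[OF assms])
  finally have "x\<^sup>2 \<le> 2 * real t powr (-59/50)" by simp
  also have "real t powr (-59/50) = (real t powr (-59/100))\<^sup>2"
    by (simp add: power2_eq_square flip: powr_add)
  also have "2 * (real t powr (-59/100))\<^sup>2 \<le> (3/2 * real t powr (-59/100))\<^sup>2"
    unfolding power_mult_distrib by (intro mult_right_mono) (auto simp: power2_eq_square)
  finally have "x \<le> 3/2 * real t powr (-59/100)" by (rule power2_le_imp_le) simp
  then have "\<eta> t - 1 \<le> 1520 * (real t powr (-59/100) * total (t - 1))"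
    using total_ge_1[of "t - 1"] by (simp add: x_def field_simps)
  then show ?thesis by simp
qed

text \<open>The steps below H fill the gaps between the jumps, so the total gap length is at most
  their sum, and each of them is charged 3/7 * \<eta> t / H, as in \<open>kernel\<close>.\<close>

lemma window_kernel_sum:
  assumes L: "N \<le> L" and H: "1000 \<le> H" "H \<le> M"
    and M: "\<And>t. t \<in> {L<..2 * L} \<Longrightarrow> \<eta> t \<le> M"
    and A: "\<And>w v. 0 \<le> w \<Longrightarrow> 1 \<le> v \<Longrightarrow> ln (1 + w * v) \<le> A * w\<^sup>2 + v / 400" and A0: "0 \<le> A"
  shows "(\<Sum>t\<in>{L<..2 * L}. kernel (\<eta> t) H)
    \<le> (ln 2 + ln (total (2 * L)) + ln M) + (261 + 3040000 * A) * real L / H"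
proof -
  define B where "B = {t \<in> {L<..2 * L}. H \<le> \<eta> t}"
  have H0: "0 < H" using H by simp
  have B: "finite B" "B \<subseteq> {L<..2 * L}" by (auto simp: B_def)
  have pos: "0 < \<eta> t" if "t \<in> {L<..2 * L}" for t using that by (intro \<eta>_pos) auto
  have Y: "0 \<le> ln (total (2 * L))" "0 \<le> ln (2::real)" "0 \<le> ln M" using H total_ge_1 by auto
  have Z: "0 \<le> (261 + 3040000 * A) * real L / H" using A0 H0 by simp
  have "(\<Sum>t\<in>{L<..2 * L}. kernel (\<eta> t) H)
      = (\<Sum>t\<in>{L<..2 * L} - B. kernel (\<eta> t) H) + (\<Sum>t\<in>B. kernel (\<eta> t) H)"
    by (rule sum.subset_diff) (auto simp: B_def)
  also have "(\<Sum>t\<in>{L<..2 * L} - B. kernel (\<eta> t) H) = (\<Sum>t\<in>{L<..2 * L} - B. - (3/7 / H) * \<eta> t)"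
    by (intro sum.cong) (auto simp: B_def kernel_def)
  also have "\<dots> = - (3/7 / H) * (\<Sum>t\<in>{L<..2 * L} - B. \<eta> t)" by (simp only: sum_distrib_left)
  also have "(\<Sum>t\<in>{L<..2 * L} - B. \<eta> t) = S L (2 * L) - (\<Sum>t\<in>B. \<eta> t)"
    unfolding S_def using B by (intro sum_diff) auto
  also have "(\<Sum>t\<in>B. kernel (\<eta> t) H) = (\<Sum>t\<in>B. ln (\<eta> t / H) - 19/50 - sqrt (\<eta> t / H) / 400)"
    by (intro sum.cong) (auto simp: B_def kernel_def)
  finally have split: "(\<Sum>t\<in>{L<..2 * L}. kernel (\<eta> t) H) = - (3/7 / H) * (S L (2 * L) - (\<Sum>t\<in>B. \<eta> t))
      + (\<Sum>t\<in>B. ln (\<eta> t / H) - 19/50 - sqrt (\<eta> t / H) / 400)" .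
  show ?thesis
  proof (cases "B = {}")
    case True
    have "0 \<le> 3/7 / H * S L (2 * L)" using H0 S_nonneg[of L "2 * L"] by simp
    moreover have "(\<Sum>t\<in>{L<..2 * L}. kernel (\<eta> t) H) = - (3/7 / H * S L (2 * L))"
      using split True by simp
    ultimately show ?thesis using Y Z by linarith
  next
    case False
    define T where "T = enumerate B"
    define m where "m = card B - 1"
    have cB: "card B = Suc m" using False B(1) by (simp add: m_def card_gt_0_iff)
    have bij: "bij_betw T {..<Suc m} B"
      using finite_bij_enumerate[OF B(1)] by (simp add: T_def cB)
    have TB: "T j \<in> B" if "j \<le> m" for j using bij that by (auto simp: bij_betw_def)
    have TL: "L < T j" "T j \<le> 2 * L" "H \<le> \<eta> (T j)" if "j \<le> m" for j
      using TB[OF that] by (auto simp: B_def)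
    have T: "T j < T (Suc j)" if "j < m" for j
      unfolding T_def using that B(1) cB by (intro finite_enumerate_mono) auto
    have sumB: "(\<Sum>t\<in>B. g t) = (\<Sum>j<Suc m. g (T j))" for g :: "nat \<Rightarrow> real"
      by (rule sum.reindex_bij_betw[OF bij, symmetric])
    have T0m: "T 0 \<le> T k" if "k \<le> m" for k using that
    proof (induction k)
      case (Suc k) then show ?case using T[of k] by simp
    qed simp
    define G where "G = (\<Sum>j<m. S (T j) (T (Suc j) - 1))"
    have "(\<Sum>j<k. S (T j) (T (Suc j) - 1)) + (\<Sum>j<k. \<eta> (T (Suc j))) = S (T 0) (T k)" if "k \<le> m" for k
      using that
    proof (induction k)
      case (Suc k)
      have "S (T 0) (T (Suc k)) = S (T 0) (T k) + S (T k) (T (Suc k))"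
        using T0m[of k] T[of k] Suc.prems by (intro S_split) auto
      then show ?case using Suc S_last[OF T[of k]] by simp
    qed simp
    then have G: "G + (\<Sum>j<m. \<eta> (T (Suc j))) = S (T 0) (T m)" by (simp add: G_def)
    have "S L (2 * L) = S L (T 0) + (S (T 0) (T m) + S (T m) (2 * L))"
      using S_split[of L "T 0" "2 * L"] S_split[of "T 0" "T m" "2 * L"] TL[of 0] TL[of m] T0m[of m] by simp
    moreover have "S L (T 0) = S L (T 0 - 1) + \<eta> (T 0)" using TL[of 0] by (intro S_last) simp
    moreover have "(\<Sum>t\<in>B. \<eta> t) = \<eta> (T 0) + (\<Sum>j<m. \<eta> (T (Suc j)))"
      unfolding sumB by (rule sum.lessThan_Suc_shift)
    ultimately have GB: "G \<le> S L (2 * L) - (\<Sum>t\<in>B. \<eta> t)"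
      using G S_nonneg[of L "T 0 - 1"] S_nonneg[of "T m" "2 * L"] by linarith
    have "worst_rate (T m - 1) \<eta> \<le> ereal (real (T m - 1) powr (-59/50))"
      using TL[of m] L by (intro fast) simp
    also have "\<dots> \<le> 1"
      using powr_mono[of "-59/50" 0 "real (T m - 1)"] TL[of m] L N by (simp add: one_ereal_def)
    finally have rate: "worst_rate (T m - 1) \<eta> \<le> 1" .
    have "(\<Sum>j<m. ln (\<eta> (T j) / H) - 19/50 - sqrt (\<eta> (T (Suc j)) / H) / 400)
      \<le> ln 2 + ln (S 0 (T 0 - 1) + 1) + 3/7 * G / H + (261 + 3040000 * A) * real (T m - T 0) / H"
      unfolding G_def
    proof (rule jump_sum[OF _ T H(1) TL(3) A rate])
      show "1 \<le> T 0" using TL[of 0] by simp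
    qed
    also have "ln (S 0 (T 0 - 1) + 1) \<le> ln (total (2 * L))"
    proof -
      have "total (T 0 - 1) \<le> total (2 * L)" using TL[of 0] by (intro total_mono) simp
      then show ?thesis using total_ge_1[of "T 0 - 1"] by (simp add: total_def)
    qed
    also have "real (T m - T 0) \<le> real L" using TL[of 0] TL[of m] by simp
    finally have J: "(\<Sum>j<m. ln (\<eta> (T j) / H) - 19/50 - sqrt (\<eta> (T (Suc j)) / H) / 400)
      \<le> ln 2 + ln (total (2 * L)) + 3/7 * G / H + (261 + 3040000 * A) * real L / H"
      using A0 H0 by (simp add: divide_right_mono mult_left_mono)
    \<comment> \<open>\<open>jump_sum\<close> charges a logarithm to the earlier jump and a square
      root to the later one. Regrouping by jumps leaves the logarithm of the last jump, at most ln
      M, and the square root of the first, which has a favourable sign.\<close>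
    have "(\<Sum>t\<in>B. ln (\<eta> t / H) - 19/50 - sqrt (\<eta> t / H) / 400)
        = (\<Sum>j<Suc m. ln (\<eta> (T j) / H) - 19/50) - (\<Sum>j<Suc m. sqrt (\<eta> (T j) / H) / 400)"
      unfolding sumB by (simp only: sum_subtractf)
    also have "(\<Sum>j<Suc m. sqrt (\<eta> (T j) / H) / 400)
        = sqrt (\<eta> (T 0) / H) / 400 + (\<Sum>j<m. sqrt (\<eta> (T (Suc j)) / H) / 400)"
      by (rule sum.lessThan_Suc_shift)
    finally have "(\<Sum>t\<in>B. ln (\<eta> t / H) - 19/50 - sqrt (\<eta> t / H) / 400)
        = (\<Sum>j<m. ln (\<eta> (T j) / H) - 19/50 - sqrt (\<eta> (T (Suc j)) / H) / 400)
          + (ln (\<eta> (T m) / H) - 19/50) - sqrt (\<eta> (T 0) / H) / 400"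
      by (simp add: sum_subtractf add_divide_distrib)
    moreover have "ln (\<eta> (T m) / H) \<le> ln M"
    proof -
      have "\<eta> (T m) \<le> M" using M TB[of m] B(2) by auto
      then have "\<eta> (T m) / H \<le> M / 1" using H TL(3)[of m] by (intro frac_le) auto
      then show ?thesis using H TL(3)[of m] by (subst ln_le_cancel_iff) auto
    qed
    moreover have "0 \<le> sqrt (\<eta> (T 0) / H)" using H0 TL(3)[of 0] by simp
    moreover have "3/7 / H * G \<le> 3/7 / H * (S L (2 * L) - (\<Sum>t\<in>B. \<eta> t))"
      using GB H0 by (intro mult_left_mono) auto
    moreover have "3/7 / H * G = 3/7 * G / H" by simp
    ultimately show ?thesis using J split unfolding mult_minus_left by linarith
  qed
qed

text \<open>Otherwise \<open>total\<close> would grow at most linearly along the numbers 2 ^ k * L,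
  against its lower bound of order n powr (59/50).\<close>

lemma doubling: "\<exists>L\<ge>K. 2 * total L \<le> total (2 * L)"
proof (rule ccontr)
  assume "\<not> ?thesis"
  then have c: "total (2 * L) < 2 * total L" if "K \<le> L" for L using that by (meson not_le)
  define L where "L = max K N"
  have L: "K \<le> L" "N \<le> L" "1 \<le> L" using N by (auto simp: L_def)
  have up: "total (2 ^ k * L) \<le> 2 ^ k * total L" for k
  proof (induction k)
    case (Suc k)
    have "K \<le> 2 ^ k * L" using L(1) by (metis le_trans mult_le_mono1 nat_mult_1 one_le_numeral one_le_power)
    from c[OF this] Suc show ?case by (simp add: mult.assoc)
  qed simp
  obtain k where k: "4 * total L < (2 powr (9/50)) ^ k"
    using real_arch_pow[of "2 powr (9/50)" "4 * total L"] by auto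
  have "(2 ^ k) powr (59/50) \<le> (real (2 ^ k * L)) powr (59/50)"
    using L(3) by (intro powr_mono2) auto
  also have "\<dots> \<le> 4 * total (2 ^ k * L)"
  proof -
    have "N \<le> 2 ^ k * L" using L(2) by (metis le_trans mult_le_mono1 nat_mult_1 one_le_numeral one_le_power)
    from total_lower[OF this] show ?thesis by simp
  qed
  also have "\<dots> \<le> 4 * (2 ^ k * total L)" using up by simp
  also have "\<dots> < 2 ^ k * (2 powr (9/50)) ^ k" using k by simp
  also have "(2 powr (9/50)) ^ k = (2 ^ k :: real) powr (9/50)"
    by (simp add: powr_powr mult.commute flip: powr_realpow)
  also have "2 ^ k * (2 ^ k :: real) powr (9/50) = (2 ^ k) powr (59/50)"
    using powr_add[of "2 ^ k :: real" 1 "9/50"] by simp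
  finally show False by simp
qed

text \<open>The relative increments of \<open>total\<close> are at most 1526 / sqrt (t + 1), with
  1526 = 1520 + 6, and sum to a multiple of sqrt t. The exponent 59/100 is weakened to 1/2, since
  later only ln (total t) = o(t powr (59/100)) matters.\<close>

lemma ln_total_le: "\<exists>C\<ge>0. \<forall>t\<ge>N. ln (total t) \<le> C + 3052 * sqrt (real t)"
proof -
  have increment: "ln (total (Suc t)) \<le> ln (total t) + 3052 * (sqrt (real (Suc t)) - sqrt (real t))" if t: "N \<le> t" for t
  proof -
    define q where "q = sqrt (real (Suc t))"
    have q: "0 < q" "q\<^sup>2 = real (Suc t)" by (simp_all add: q_def)
    have t1: "1 \<le> t" using t N by simp
    have a: "0 < total t" using total_ge_1[of t] by simp
    have "q / 6 \<le> sqrt (real t) / 4"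
    proof -
      have "q \<le> sqrt ((3/2)\<^sup>2 * real t)" unfolding q_def using t1 by (intro real_sqrt_le_mono) (simp add: power2_eq_square)
      also have "\<dots> = 3/2 * sqrt (real t)" by (simp add: real_sqrt_mult)
      finally show ?thesis by simp
    qed
    also have "\<dots> \<le> real t powr (59/50) / 4"
      using powr_mono[of "1/2" "59/50" "real t"] t1 by (simp add: powr_half_sqrt)
    also have "\<dots> \<le> total t" by (rule total_lower[OF t])
    finally have "1 \<le> 6 * total t / q" using q by (simp add: field_simps)
    moreover have "real (Suc t) powr (-59/100) * total t \<le> total t / q"
    proof -
      have "real (Suc t) powr (-59/100) \<le> real (Suc t) powr (-1/2)" by (rule powr_mono) auto
      also have "\<dots> = 1 / q" by (simp add: q_def powr_minus_divide powr_half_sqrt)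
      finally have "real (Suc t) powr (-59/100) * total t \<le> 1 / q * total t"
        using a by (intro mult_right_mono) auto
      then show ?thesis by simp
    qed
    ultimately have "\<eta> (Suc t) \<le> 1526 * (total t / q)" using step_le[of "Suc t"] t by simp
    then have "total (Suc t) \<le> total t * (1 + 1526 / q)"
      using S_last[of 0 "Suc t"] by (simp add: total_def algebra_simps)
    then have "ln (total (Suc t)) \<le> ln (total t * (1 + 1526 / q))"
      using total_ge_1[of "Suc t"] a q by (subst ln_le_cancel_iff) (auto intro!: mult_pos_pos add_pos_nonneg)
    also have "\<dots> = ln (total t) + ln (1 + 1526 / q)"
      using a q by (intro ln_mult_pos) (auto intro!: add_pos_nonneg)
    also have "ln (1 + 1526 / q) \<le> 1526 / q" using q by (intro ln_add_one_self_le_self) auto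
    also have "1526 / q \<le> 3052 * (q - sqrt (real t))"
    proof -
      have "(q - sqrt (real t)) * (q + sqrt (real t)) = 1"
        using q(2) by (simp add: algebra_simps power2_eq_square)
      moreover have "0 \<le> q - sqrt (real t)" by (simp add: q_def)
      then have "(q - sqrt (real t)) * (q + sqrt (real t)) \<le> (q - sqrt (real t)) * (2 * q)"
        by (intro mult_left_mono) auto
      ultimately have "1 \<le> (q - sqrt (real t)) * (2 * q)" by simp
      then show ?thesis using q(1) by (simp add: field_simps)
    qed
    finally show ?thesis by (simp add: q_def)
  qed
  have "ln (total t) \<le> ln (total N) + 3052 * (sqrt (real t) - sqrt (real N))" if "N \<le> t" for t
    using that
  proof (induction t rule: dec_induct)
    case (step t)
    then show ?case using increment[of t] by simp
  qed simp
  then have "\<forall>t\<ge>N. ln (total t) \<le> ln (total N) + 3052 * sqrt (real t)" by (smt (verit) real_sqrt_ge_zero of_nat_0_le_iff)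
  then show ?thesis using total_ge_1[of N] by (intro exI[of _ "ln (total N)"]) auto
qed

text \<open>With A = \<open>total (2 * L)\<close>, the steps of the window are at most of order L
  powr (-59/100) * A. Of the two terms in \<open>kernel_sum_bound\<close>, Y * M is o(A) because Y =
  O(sqrt L), and L * M powr (3/10) is o(A) because A is at least of order L powr (59/50).\<close>

lemma impossible: False
proof -
  obtain K where K: "0 \<le> K" "\<And>w v :: real. 0 \<le> w \<Longrightarrow> 1 \<le> v \<Longrightarrow> ln (1 + w * v) \<le> K * w\<^sup>2 + v / 400"
    using ln_one_plus_mult_le[of "1/400"] by auto
  obtain C where C: "0 \<le> C" "\<And>t. N \<le> t \<Longrightarrow> ln (total t) \<le> C + 3052 * sqrt (real t)"
    using ln_total_le by blast
  define Z where "Z = 261 + 3040000 * K"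
  define C2 where "C2 = ln 2 + ln 1524 + 2 * C + 12208"
  define C3 where "C3 = 1524 * C2"
  define c where "c = 42 * 1000 powr (7/10) + 7/3 * Z"
  define C4 where "C4 = c * (1524 powr (3/10) * 4 powr (7/10))"
  have Z: "0 \<le> Z" using K by (simp add: Z_def)
  have c: "0 \<le> c" using Z by (simp add: c_def)
  have "((\<lambda>L. C3 * real L powr (-9/100) + C4 * real L powr (-3/1000)) \<longlongrightarrow> C3 * 0 + C4 * 0) at_top"
    by (intro tendsto_intros tendsto_neg_powr filterlim_real_sequentially) auto
  then have "\<forall>\<^sub>F L in at_top. C3 * real L powr (-9/100) + C4 * real L powr (-3/1000) < 1/2"
    by (rule order_tendstoD) simp
  moreover have "((\<lambda>L. real L powr (-59/100)) \<longlongrightarrow> 0) at_top"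
    by (intro tendsto_neg_powr filterlim_real_sequentially) auto
  then have "\<forall>\<^sub>F L in at_top. real L powr (-59/100) < 1/4" by (rule order_tendstoD) simp
  ultimately have "\<forall>\<^sub>F L in at_top. C3 * real L powr (-9/100) + C4 * real L powr (-3/1000) < 1/2 \<and> real L powr (-59/100) < 1/4"
    by (rule eventually_conj)
  then obtain L0 where L0: "\<And>L. L0 \<le> L \<Longrightarrow> C3 * real L powr (-9/100) + C4 * real L powr (-3/1000) < 1/2 \<and> real L powr (-59/100) < 1/4"
    unfolding eventually_at_top_linorder by blast
  obtain L where L: "max L0 N \<le> L" "2 * total L \<le> total (2 * L)" using doubling by blast
  then have LN: "N \<le> L" "1 \<le> L" "N \<le> 2 * L" using N by auto
  have l: "1 \<le> real L" using LN by simp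
  have small: "C3 * real L powr (-9/100) + C4 * real L powr (-3/1000) < 1/2" and big: "real L powr (-59/100) < 1/4"
    using L0[of L] L(1) by auto
  define A where "A = total (2 * L)"
  have A1: "1 \<le> A" by (simp add: A_def total_ge_1)
  have "real L powr (59/50) \<le> real (2 * L) powr (59/50)" by (intro powr_mono2) auto
  then have AL: "real L powr (59/50) / 4 \<le> A" using total_lower[OF LN(3)] by (simp add: A_def)
  define q where "q = real L powr (-59/100) * A"
  have "real L powr (-59/100) * (real L powr (59/50) / 4) \<le> q"
    unfolding q_def using AL by (intro mult_left_mono) auto
  moreover have "real L powr (-59/100) * real L powr (59/50) = real L powr (59/100)"
    by (simp flip: powr_add)
  moreover have "4 \<le> real L powr (59/100)" using big l by (simp add: powr_minus_divide field_simps)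
  ultimately have q1: "1 \<le> q" by simp
  have "q \<le> 1 * A" unfolding q_def using A1 l powr_mono[of "-59/100" 0 "real L"] by (intro mult_right_mono) auto
  then have qA: "q \<le> A" by simp
  define M where "M = 1 + 1520 * q"
  have M: "1000 \<le> M" "M \<le> 1524 * q" using q1 by (auto simp: M_def)
  have eta: "\<eta> t \<le> M" if t: "t \<in> {L<..2 * L}" for t
  proof -
    have "real t powr (-59/100) * total (t - 1) \<le> real L powr (-59/100) * A"
      unfolding A_def using t l total_ge_1[of "t - 1"] by (intro mult_mono powr_mono2' total_mono) auto
    then show ?thesis using step_le[of t] t LN by (simp add: M_def q_def)
  qed
  have pos: "0 < \<eta> t" if "t \<in> {L<..2 * L}" for t using that by (intro \<eta>_pos) auto
  define Y where "Y = ln 2 + ln A + ln M"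
  have Y0: "0 \<le> Y" using A1 M by (auto simp: Y_def intro!: add_nonneg_nonneg)
  have YL: "Y \<le> C2 * sqrt (real L)"
  proof -
    have "ln M \<le> ln (1524 * A)" using M qA by (subst ln_le_cancel_iff) auto
    also have "\<dots> = ln 1524 + ln A" using A1 by (intro ln_mult_pos) auto
    finally have "Y \<le> ln 2 + ln 1524 + 2 * ln A" by (simp add: Y_def)
    moreover have "ln A \<le> C + 3052 * sqrt (real (2 * L))" using C(2)[OF LN(3)] by (simp add: A_def)
    moreover have "sqrt (real (2 * L)) \<le> 2 * sqrt (real L)"
    proof -
      have "sqrt (real (2 * L)) \<le> sqrt (2\<^sup>2 * real L)" by (intro real_sqrt_le_mono) simp
      then show ?thesis by (simp add: real_sqrt_mult)
    qed
    ultimately have "Y \<le> (ln 2 + ln 1524 + 2 * C) * 1 + 12208 * sqrt (real L)" by simp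
    also have "(ln 2 + ln 1524 + 2 * C) * 1 \<le> (ln 2 + ln 1524 + 2 * C) * sqrt (real L)"
      using C(1) l by (intro mult_left_mono) (auto intro!: add_nonneg_nonneg)
    finally show ?thesis by (simp add: C2_def algebra_simps)
  qed
  have "(\<Sum>t\<in>{L<..2 * L}. \<eta> t) \<le> Y * M + (42 * 1000 powr (7/10) * real (card {L<..2 * L}) + 7/3 * (Z * real L)) * M powr (3/10)"
  proof (rule kernel_sum_bound)
    fix H assume H: "H \<in> {1000..M}"
    then show "(\<Sum>t\<in>{L<..2 * L}. kernel (\<eta> t) H) \<le> Y + Z * real L / H"
      unfolding Y_def A_def Z_def using window_kernel_sum[OF LN(1) _ _ eta K(2) K(1)] by simp
  qed (use pos eta M Y0 Z in auto)
  also have "\<dots> = Y * M + c * (real L * M powr (3/10))" by (simp add: c_def algebra_simps)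
  also have "S L (2 * L) = A - total L" using S_split[of 0 L "2 * L"] by (simp add: A_def total_def)
  then have "(\<Sum>t\<in>{L<..2 * L}. \<eta> t) = A - total L" by (simp add: S_def)
  finally have main: "A / 2 \<le> Y * M + c * (real L * M powr (3/10))" using L(2) by (simp add: A_def)
  have "Y * M \<le> (C2 * sqrt (real L)) * (1524 * q)"
    using YL M Y0 by (intro mult_mono) auto
  also have "\<dots> = C3 * (sqrt (real L) * real L powr (-59/100)) * A" by (simp add: C3_def q_def)
  also have "sqrt (real L) * real L powr (-59/100) = real L powr (-9/100)"
    by (simp flip: powr_half_sqrt powr_add)
  finally have one: "Y * M \<le> C3 * real L powr (-9/100) * A" .
  have "real L * M powr (3/10) \<le> real L * (1524 * q) powr (3/10)"
    using M by (intro mult_left_mono powr_mono2) auto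
  also have "\<dots> = 1524 powr (3/10) * (real L powr 1 * real L powr (-177/1000)) * A powr (3/10)"
    unfolding q_def using A1 by (simp add: powr_mult powr_powr)
  also have "real L powr 1 * real L powr (-177/1000) = real L powr (823/1000)"
    by (simp only: powr_add[symmetric]) simp
  \<comment> \<open>823/1000 - 59/50 * 7/10 = -3/1000: this sign is where 59/50 > 20/17
    enters.\<close>
  also have "real L powr (823/1000) = real L powr (-3/1000) * (real L powr (59/50)) powr (7/10)"
    by (simp add: powr_powr flip: powr_add)
  also have "\<dots> \<le> real L powr (-3/1000) * (4 * A) powr (7/10)"
    using AL by (intro mult_left_mono powr_mono2) auto
  also have "(4 * A) powr (7/10) = 4 powr (7/10) * A powr (7/10)" using A1 by (simp add: powr_mult)
  finally have "real L * M powr (3/10) \<le> 1524 powr (3/10) * (real L powr (-3/1000) * (4 powr (7/10) * A powr (7/10))) * A powr (3/10)"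
    by (simp add: mult_right_mono mult_left_mono)
  also have "\<dots> = (1524 powr (3/10) * 4 powr (7/10)) * real L powr (-3/1000) * (A powr (7/10) * A powr (3/10))"
    by simp
  also have "A powr (7/10) * A powr (3/10) = A" using A1 by (simp flip: powr_add)
  finally have "c * (real L * M powr (3/10)) \<le> c * ((1524 powr (3/10) * 4 powr (7/10)) * real L powr (-3/1000) * A)"
    using c by (intro mult_left_mono) auto
  also have "\<dots> = C4 * real L powr (-3/1000) * A" by (simp add: C4_def)
  finally have "A / 2 \<le> (C3 * real L powr (-9/100) + C4 * real L powr (-3/1000)) * A"
    using main one by (simp add: distrib_right)
  also have "\<dots> < 1/2 * A" using small A1 by (intro mult_strict_right_mono) auto
  finally show False by simp
qed

end

section \<open>The exponent and the conclusion\<close>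

lemma beta_star_gt: "59/50 < \<beta>\<^sub>\<star>"
proof -
  have "(433/250)\<^sup>2 < (3::real)" by (simp add: power2_eq_square)
  then have s: "433/250 < sqrt 3" by (rule real_less_rsqrt)
  \<comment> \<open>The claim is equivalent to 59 < 41 * \<open>\<alpha>\<^sub>\<star>\<close>, i.e.
    to 2 ^ 59 < (1 + sqrt 3) ^ 41.\<close>
  have "(2::real) ^ 59 < (683/250) ^ 41" by (simp add: power_divide)
  also have "\<dots> \<le> (1 + sqrt 3) ^ 41" using s by (intro power_mono) auto
  finally have "log 2 (2 ^ 59) < log 2 ((1 + sqrt 3) ^ 41)"
    by (subst log_less_cancel_iff) (auto intro: add_pos_nonneg)
  also have "log 2 ((1 + sqrt 3) ^ 41) = real 41 * \<alpha>\<^sub>\<star>"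
    unfolding alpha_star_def by (rule log_nat_power) (auto intro: add_pos_nonneg)
  also have "log 2 (2 ^ 59) = real 59" by (rule log_pow_cancel) auto
  finally have "59 < 41 * \<alpha>\<^sub>\<star>" by simp
  then show ?thesis by (simp add: beta_star_def field_simps)
qed

lemma limsup_less_1_imp: "limsup (\<lambda>n. ereal (real n powr \<beta>\<^sub>\<star>) * worst_rate n \<eta>) < 1 \<Longrightarrow>
  \<exists>N\<ge>1. \<forall>n\<ge>N. worst_rate n \<eta> \<le> ereal (real n powr (-59/50))"
proof -
  assume "limsup (\<lambda>n. ereal (real n powr \<beta>\<^sub>\<star>) * worst_rate n \<eta>) < 1"
  then have "\<forall>\<^sub>F n in sequentially. ereal (real n powr \<beta>\<^sub>\<star>) * worst_rate n \<eta> < 1"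
    by (rule Limsup_lessD)
  then obtain N where N: "\<And>n. N \<le> n \<Longrightarrow> ereal (real n powr \<beta>\<^sub>\<star>) * worst_rate n \<eta> < 1"
    by (auto simp: eventually_sequentially)
  have "worst_rate n \<eta> \<le> ereal (real n powr (-59/50))" if n: "max N 1 \<le> n" for n
  proof -
    obtain r where r: "worst_rate n \<eta> = ereal r"
      using worst_rate_finite[of n \<eta>] by (cases "worst_rate n \<eta>") auto
    have "real n powr \<beta>\<^sub>\<star> * r < 1" using N[of n] n by (simp add: r one_ereal_def)
    moreover have "0 < real n powr \<beta>\<^sub>\<star>" using n by simp
    ultimately have "r \<le> real n powr (- \<beta>\<^sub>\<star>)" by (simp add: powr_minus_divide field_simps)
    also have "\<dots> \<le> real n powr (-59/50)" using n beta_star_gt by (intro powr_mono) auto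
    finally show ?thesis by (simp add: r)
  qed
  then show ?thesis by (intro exI[of _ "max N 1"]) auto
qed

lemma smallo_limsup:
  assumes "(\<lambda>n. real_of_ereal (worst_rate n \<eta>)) \<in> o(\<lambda>n. real n powr (- \<beta>\<^sub>\<star>))"
  shows "limsup (\<lambda>n. ereal (real n powr \<beta>\<^sub>\<star>) * worst_rate n \<eta>) = 0"
proof (rule lim_imp_Limsup)
  have "((\<lambda>n. ereal (real_of_ereal (worst_rate n \<eta>) / real n powr (- \<beta>\<^sub>\<star>))) \<longlongrightarrow> ereal 0) sequentially"
    using smalloD_tendsto[OF assms] by simp
  \<comment> \<open>At n = 0 both sides are 0, since \<open>0 powr x = 0\<close> and division by 0
    gives 0.\<close>
  moreover have "ereal (real_of_ereal (worst_rate n \<eta>) / real n powr (- \<beta>\<^sub>\<star>)) = ereal (real n powr \<beta>\<^sub>\<star>) * worst_rate n \<eta>" for n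
    using worst_rate_finite[of n \<eta>] by (cases "worst_rate n \<eta>") (auto simp: powr_minus_divide)
  ultimately show "(\<lambda>n. ereal (real n powr \<beta>\<^sub>\<star>) * worst_rate n \<eta>) \<longlonglongrightarrow> 0" by (simp add: zero_ereal_def)
qed simp

theorem theorem1p2:
  shows "(\<exists>C>0::real. \<forall>\<eta>. (\<forall>t\<ge>1. \<eta> t > 0) \<longrightarrow>
            limsup (\<lambda>n. ereal (real n powr \<beta>\<^sub>\<star>) * worst_rate n \<eta>) \<ge> ereal C)
       \<and> \<not> (\<exists>\<eta>. (\<forall>t\<ge>1. \<eta> t > 0) \<and>
            (\<lambda>n. real_of_ereal (worst_rate n \<eta>)) \<in> o(\<lambda>n. real n powr (- \<beta>\<^sub>\<star>)))"
proof -
  \<comment> \<open>The value 1 is arbitrary: as 59/50 < \<open>\<beta>\<^sub>\<star>\<close>, any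
    finite limsup would lead to \<open>fast_schedule\<close> for large N.\<close>
  have lower: "1 \<le> limsup (\<lambda>n. ereal (real n powr \<beta>\<^sub>\<star>) * worst_rate n \<eta>)" if "\<forall>t\<ge>1. \<eta> t > 0" for \<eta>
  proof (rule ccontr)
    assume "\<not> ?thesis"
    then obtain N where "1 \<le> N" "\<forall>n\<ge>N. worst_rate n \<eta> \<le> ereal (real n powr (-59/50))"
      using limsup_less_1_imp by (auto simp: not_le)
    with that interpret fast_schedule \<eta> N by unfold_locales auto
    show False by (rule impossible)
  qed
  moreover have False if "\<forall>t\<ge>1. \<eta> t > 0" "(\<lambda>n. real_of_ereal (worst_rate n \<eta>)) \<in> o(\<lambda>n. real n powr (- \<beta>\<^sub>\<star>))" for \<eta>
    using lower[OF that(1)] smallo_limsup[OF that(2)] by simp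
  ultimately show ?thesis by (intro conjI exI[of _ 1]) (auto simp: one_ereal_def)
qed

end
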